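(* Let $\alpha\in(0,1)$ and $C_0\ge1$, and assume that, uniformly for all $u\in U$, $$\Sigma(\cdot,u)\ge \mathbb I_d/C_0,\qquad \|r(\cdot,u)\|_{0,\alpha},\ \|b(\cdot,u)\|_{0,\alpha},\ \|\Sigma(\cdot,u)\|_{0,\alpha}\le C_0 .$$ Let $v^*$ be the bounded solution on $\mathbb R^d$ of the exploratory HJB equation $\rho v-F(x,Dv,D^2v)=0$, and let $v^n$, $n\in\mathbb N$, be the bounded solutions produced by the policy iteration algorithm. If the functions $v^n$, $n\in\mathbb N$, are uniformly bounded in $\mathcal C^{2,\alpha}(\mathbb R^d)$, then $v^n\to v^*$ as $n\to\infty$ locally uniformly in $\mathcal C^{2,\alpha}(\mathbb R^d)$, i.e. $\|v^n-v^*\|_{\mathcal C^{2,\alpha}(B_R)}\to0$ for every $R>0$.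
   Context: Setting. $d,m,l$ are fixed positive integers, $U\subset\mathbb R^l$ is a bounded domain with Lebesgue measure $|U|=1$, $\lambda>0$, $\rho>0$, and $r:\mathbb R^d\times U\to\mathbb R$, $b:\mathbb R^d\times U\to\mathbb R^d$, $\sigma:\mathbb R^d\times U\to\mathbb R^{d\times m}$ are given (measurable in $u$); $\Sigma:=\sigma\sigma^T$. $B_R$ is the open ball of radius $R$ centered at $0$. $\mathcal P(U)$ is the set of probability densities on $U$. For $\pi\in\mathcal P(U)$, $x,p\in\mathbb R^d$ and $X$ a symmetric $d\times d$ matrix, $$F_\pi(x,p,X)=\int_U\left[r(x,u)+b(x,u)\cdot p+\tfrac12\mathrm{tr}(\Sigma(x,u)X)-\lambda\ln\pi(u)\right]\pi(u)\,du,\qquad F(x,p,X)=\sup_{\pi\in\mathcal P(U)}F_\pi(x,p,X).$$ The HJB equation is understood in the viscosity sense. Norms: for an open set $V\subseteq\mathbb R^d$ and $k\in\mathbb N\cup\{0\}$, $\|w\|_{\mathcal C^{k,\alpha}(V)}=\sum_{j\le k}\big(\sup_{|a|_1=j}\|D^aw\|_{L^\infty(V)}+[w]_{\mathcal C^{j,\alpha}(V)}\big)$, where $[w]_{\mathcal C^{j,\alpha}(V)}=\sup_{x,y\in V,\ 0<|x-y|\le1,\ |a|_1=j}\frac{|D^aw(x)-D^aw(y)|}{|x-y|^\alpha}$; the subscript $k,\alpha$ in $\|\cdot\|_{k,\alpha}$ refers to $V=\mathbb R^d$. For vector- or matrix-valued functions, $|\cdot|$ is the maximum of the absolute values of the entries.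 Policy iteration algorithm: given an initial $v^0\in\mathcal C^2$, for $n\ge1$ let $$\pi^n(x,u)=\frac{\exp\left[\frac1\lambda\left(r(x,u)+b(x,u)\cdot Dv^{n-1}(x)+\frac12\mathrm{tr}(\Sigma(x,u)D^2v^{n-1}(x))\right)\right]}{\int_U\exp\left[\frac1\lambda\left(r(x,u')+b(x,u')\cdot Dv^{n-1}(x)+\frac12\mathrm{tr}(\Sigma(x,u')D^2v^{n-1}(x))\right)\right]du'},$$ and let $v^n$ be the solution on $\mathbb R^d$ of $\rho v^n-F_{\pi^n(x,\cdot)}(x,Dv^n,D^2v^n)=0$. *)

theory Defs
  imports "HOL-Analysis.Analysis" "HOL-Probability.Essential_Supremum"
begin

definition partial :: "'d::finite \<Rightarrow> (real^'d \<Rightarrow> 'b::real_normed_vector) \<Rightarrow> real^'d \<Rightarrow> 'b"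
  where "partial i w x = frechet_derivative w (at x) (axis i 1)"

text \<open>A multi-index of order \<open>j\<close> is encoded by a list of \<open>j\<close> coordinate directions.  On functions
  of class \<open>C^j\<close> the partial derivatives commute, so that lists with the same multiplicities
  denote the same derivative and the lists of length \<open>j\<close> range over all derivatives of order \<open>j\<close>.\<close>

primrec partials :: "'d::finite list \<Rightarrow> (real^'d \<Rightarrow> 'b::real_normed_vector) \<Rightarrow> real^'d \<Rightarrow> 'b"
  where
    "partials [] w = w"
  | "partials (i # is) w = partial i (partials is w)"

text \<open>\<open>V\<close> is meant to be open, here and in the norms below.\<close>

definition Ck_on :: "nat \<Rightarrow> (real^'d::finite) set \<Rightarrow> (real^'d \<Rightarrow> 'b::real_normed_vector) \<Rightarrow> bool"
  where "Ck_on k V w \<longleftrightarrow>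
    (\<forall>is. length is < k \<longrightarrow> (\<forall>x\<in>V. partials is w differentiable (at x))) \<and>
    (\<forall>is. length is \<le> k \<longrightarrow> continuous_on V (partials is w))"

definition grad :: "(real^'d::finite \<Rightarrow> real) \<Rightarrow> real^'d \<Rightarrow> real^'d"
  where "grad w x = (\<chi> i. partials [i] w x)"

definition hess :: "(real^'d::finite \<Rightarrow> real) \<Rightarrow> real^'d \<Rightarrow> real^'d^'d"
  where "hess w x = (\<chi> i j. partials [i, j] w x)"

text \<open>The function \<open>infnorm\<close> is the maximum of the absolute values of the entries, for numbers,
  vectors and matrices alike.  The norms take values in the extended half-line.\<close>

definition hoelder_seminorm ::
    "nat \<Rightarrow> real \<Rightarrow> (real^'d::finite) set \<Rightarrow> (real^'d \<Rightarrow> 'b::euclidean_space) \<Rightarrow> ennreal"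
  where "hoelder_seminorm j \<alpha> V w =
    (SUP (x, y, is) \<in> {(x, y, is). x \<in> V \<and> y \<in> V \<and> 0 < dist x y \<and> dist x y \<le> 1 \<and> length is = j}.
       ennreal (infnorm (partials is w x - partials is w y) / dist x y powr \<alpha>))"

definition Linf_norm ::
    "(real^'d::finite) set \<Rightarrow> (real^'d \<Rightarrow> 'b::euclidean_space) \<Rightarrow> ennreal"
  where "Linf_norm V w = esssup (lebesgue_on V) (\<lambda>x. ennreal (infnorm (w x)))"

definition hoelder_norm ::
    "nat \<Rightarrow> real \<Rightarrow> (real^'d::finite) set \<Rightarrow> (real^'d \<Rightarrow> 'b::euclidean_space) \<Rightarrow> ennreal"
  where "hoelder_norm k \<alpha> V w =
    (\<Sum>j\<le>k. (SUP is \<in> {is. length is = j}. Linf_norm V (partials is w)) + hoelder_seminorm j \<alpha> V w)"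

definition hoelder_space ::
    "nat \<Rightarrow> real \<Rightarrow> (real^'d::finite) set \<Rightarrow> (real^'d \<Rightarrow> 'b::euclidean_space) set"
  where "hoelder_space k \<alpha> V = {w. Ck_on k V w \<and> hoelder_norm k \<alpha> V w < \<infinity>}"

text \<open>Solutions on the whole space of \<open>H(x, v, Dv, D\<^sup>2v) = 0\<close> for an extended-real-valued \<open>H\<close>.\<close>

definition viscosity_subsolution ::
    "(real^'d::finite \<Rightarrow> real \<Rightarrow> real^'d \<Rightarrow> real^'d^'d \<Rightarrow> ereal) \<Rightarrow> (real^'d \<Rightarrow> real) \<Rightarrow> bool"
  where "viscosity_subsolution H v \<longleftrightarrow>
    (\<forall>\<phi> x. Ck_on 2 UNIV \<phi> \<and> (\<forall>\<^sub>F y in nhds x. v y - \<phi> y \<le> v x - \<phi> x)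
       \<longrightarrow> H x (v x) (grad \<phi> x) (hess \<phi> x) \<le> 0)"

definition viscosity_supersolution ::
    "(real^'d::finite \<Rightarrow> real \<Rightarrow> real^'d \<Rightarrow> real^'d^'d \<Rightarrow> ereal) \<Rightarrow> (real^'d \<Rightarrow> real) \<Rightarrow> bool"
  where "viscosity_supersolution H v \<longleftrightarrow>
    (\<forall>\<phi> x. Ck_on 2 UNIV \<phi> \<and> (\<forall>\<^sub>F y in nhds x. v y - \<phi> y \<ge> v x - \<phi> x)
       \<longrightarrow> H x (v x) (grad \<phi> x) (hess \<phi> x) \<ge> 0)"

definition viscosity_solution ::
    "(real^'d::finite \<Rightarrow> real \<Rightarrow> real^'d \<Rightarrow> real^'d^'d \<Rightarrow> ereal) \<Rightarrow> (real^'d \<Rightarrow> real) \<Rightarrow> bool"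
  where "viscosity_solution H v \<longleftrightarrow>
    continuous_on UNIV v \<and> viscosity_subsolution H v \<and> viscosity_supersolution H v"

text \<open>The integral with values in the extended reals.  The entropy of a density may be \<open>-\<infinity>\<close>,
  where the Bochner integral would return the default value \<open>0\<close>.\<close>

definition ext_integral :: "'a measure \<Rightarrow> ('a \<Rightarrow> real) \<Rightarrow> ereal"
  where "ext_integral M f =
    enn2ereal (\<integral>\<^sup>+ u. ennreal (f u) \<partial>M) - enn2ereal (\<integral>\<^sup>+ u. ennreal (- f u) \<partial>M)"

definition prob_densities :: "(real^'l::finite) set \<Rightarrow> (real^'l \<Rightarrow> real) set"
  where "prob_densities U =
    {\<pi>. \<pi> \<in> borel_measurable (lebesgue_on U) \<and> (\<forall>u\<in>U. 0 \<le> \<pi> u) \<and>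
        (\<integral>\<^sup>+ u. ennreal (\<pi> u) \<partial>lebesgue_on U) = 1}"

definition diffusion_matrix ::
    "(real^'d::finite \<Rightarrow> real^'l::finite \<Rightarrow> real^'m::finite^'d) \<Rightarrow> real^'d \<Rightarrow> real^'l \<Rightarrow> real^'d^'d"
  where "diffusion_matrix \<sigma> x u = \<sigma> x u ** transpose (\<sigma> x u)"

definition hamiltonian ::
    "(real^'d::finite \<Rightarrow> real^'l::finite \<Rightarrow> real) \<Rightarrow> (real^'d \<Rightarrow> real^'l \<Rightarrow> real^'d) \<Rightarrow>
     (real^'d \<Rightarrow> real^'l \<Rightarrow> real^'m::finite^'d) \<Rightarrow> real^'d \<Rightarrow> real^'l \<Rightarrow> real^'d \<Rightarrow> real^'d^'d \<Rightarrow> real"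
  where "hamiltonian r b \<sigma> x u p X =
    r x u + b x u \<bullet> p + 1/2 * trace (diffusion_matrix \<sigma> x u ** X)"

text \<open>The library convention \<open>ln 0 = 0\<close> yields the usual convention \<open>0 ln 0 = 0\<close>.\<close>

definition F_policy ::
    "(real^'l::finite) set \<Rightarrow> real \<Rightarrow> (real^'d::finite \<Rightarrow> real^'l \<Rightarrow> real) \<Rightarrow>
     (real^'d \<Rightarrow> real^'l \<Rightarrow> real^'d) \<Rightarrow> (real^'d \<Rightarrow> real^'l \<Rightarrow> real^'m::finite^'d) \<Rightarrow>
     (real^'l \<Rightarrow> real) \<Rightarrow> real^'d \<Rightarrow> real^'d \<Rightarrow> real^'d^'d \<Rightarrow> ereal"
  where "F_policy U lam r b \<sigma> \<pi> x p X =
    ext_integral (lebesgue_on U) (\<lambda>u. (hamiltonian r b \<sigma> x u p X - lam * ln (\<pi> u)) * \<pi> u)"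

definition F_max ::
    "(real^'l::finite) set \<Rightarrow> real \<Rightarrow> (real^'d::finite \<Rightarrow> real^'l \<Rightarrow> real) \<Rightarrow>
     (real^'d \<Rightarrow> real^'l \<Rightarrow> real^'d) \<Rightarrow> (real^'d \<Rightarrow> real^'l \<Rightarrow> real^'m::finite^'d) \<Rightarrow>
     real^'d \<Rightarrow> real^'d \<Rightarrow> real^'d^'d \<Rightarrow> ereal"
  where "F_max U lam r b \<sigma> x p X = (SUP \<pi> \<in> prob_densities U. F_policy U lam r b \<sigma> \<pi> x p X)"

text \<open>The policy produced from a function \<open>w\<close>; it is \<open>\<pi>\<^sup>n\<close> for \<open>w = v\<^sup>n\<^sup>-\<^sup>1\<close>.\<close>

definition gibbs_policy ::
    "(real^'l::finite) set \<Rightarrow> real \<Rightarrow> (real^'d::finite \<Rightarrow> real^'l \<Rightarrow> real) \<Rightarrow>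
     (real^'d \<Rightarrow> real^'l \<Rightarrow> real^'d) \<Rightarrow> (real^'d \<Rightarrow> real^'l \<Rightarrow> real^'m::finite^'d) \<Rightarrow>
     (real^'d \<Rightarrow> real) \<Rightarrow> real^'d \<Rightarrow> real^'l \<Rightarrow> real"
  where "gibbs_policy U lam r b \<sigma> w x u =
    exp (1 / lam * hamiltonian r b \<sigma> x u (grad w x) (hess w x)) /
    (\<integral>u'. exp (1 / lam * hamiltonian r b \<sigma> x u' (grad w x) (hess w x)) \<partial>lebesgue_on U)"

definition policy_iteration ::
    "(real^'l::finite) set \<Rightarrow> real \<Rightarrow> real \<Rightarrow> (real^'d::finite \<Rightarrow> real^'l \<Rightarrow> real) \<Rightarrow>
     (real^'d \<Rightarrow> real^'l \<Rightarrow> real^'d) \<Rightarrow> (real^'d \<Rightarrow> real^'l \<Rightarrow> real^'m::finite^'d) \<Rightarrow>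
     (nat \<Rightarrow> real^'d \<Rightarrow> real) \<Rightarrow> bool"
  where "policy_iteration U lam \<rho> r b \<sigma> v \<longleftrightarrow>
    Ck_on 2 UNIV (v 0) \<and>
    (\<forall>n\<ge>1. viscosity_solution
       (\<lambda>x s p X. ereal (\<rho> * s) - F_policy U lam r b \<sigma> (gibbs_policy U lam r b \<sigma> (v (n - 1)) x) x p X)
       (v n))"

definition loewner_le :: "real^'d::finite^'d \<Rightarrow> real^'d^'d \<Rightarrow> bool"
  where "loewner_le A B \<longleftrightarrow> (\<forall>\<xi>. \<xi> \<bullet> (A *v \<xi>) \<le> \<xi> \<bullet> (B *v \<xi>))"

end

theory Submission
  imports Defs "HOL-Complex_Analysis.Great_Picard" "HOL-Probability.Probability_Measure"
begin

text \<open>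
  Let \<open>L x q = lam ln \<integral> exp ((r + a \<bullet> q) / lam)\<close> with \<open>a = (b, \<Sigma>/2)\<close> and \<open>q = (Dv, D\<^sup>2v)\<close>.  By the Gibbs
  variational principle the HJB equation reads \<open>\<rho> v = L x q\<close>, and policy iteration is Newton's method
  \<open>\<rho> v\<^sup>n = L x q\<^sup>n\<^sup>-\<^sup>1 + A x q\<^sup>n\<^sup>-\<^sup>1 \<bullet> (q\<^sup>n - q\<^sup>n\<^sup>-\<^sup>1)\<close> for the convex function \<open>L x\<close> with derivative \<open>A x\<close>.
  Convexity and the maximum principle make \<open>v\<^sup>n\<close> increasing; by Arzela-Ascoli it converges in \<open>C\<^sup>2\<close>
  on compact sets to a classical solution, which can be used as a test function and therefore is \<open>v\<^sup>*\<close>.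

  Convergence of the Hoelder seminorm of \<open>D\<^sup>2v\<^sup>n\<close> replaces the interior Schauder estimate by a blow-up.
  If the seminorms of \<open>w\<^sup>n = v\<^sup>n - v\<^sup>*\<close> did not tend to zero on a ball, then \<open>D\<^sup>2w\<^sup>n\<close> would oscillate by at
  least \<open>\<epsilon> h\<^sup>\<alpha>\<close> over distances \<open>h\<close> tending to \<open>0\<close>.  Rescaling \<open>w\<^sup>n\<close> minus its Taylor polynomial by \<open>h\<^sup>-\<^sup>2\<^sup>-\<^sup>\<alpha>\<close>,
  which is possible because of the global \<open>C\<^sup>2\<^sup>,\<^sup>\<alpha>\<close> bound, produces in the limit an entire solution of
  an elliptic equation with constant coefficients whose Hessian is Hoelder continuous but not constant.
  This contradicts the Liouville theorem, which is proved by a reflection coupling.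
\<close>

section \<open>Positive semidefinite matrices and functions of class \<open>C\<^sup>2\<close>\<close>

text \<open>The a priori bound has the same order C^{2,\<alpha>} as the claimed convergence.
  Compactness or interpolation alone therefore reaches only exponents below \<alpha>, and the
  exponent \<alpha> itself has to be won from the equation. What makes this possible is
  quantitative: over a distance d the linearised equation for the error has an oscillation bounded
  by lower order terms of size d plus d^\<alpha> times a factor tending to zero, so it disappears
  after division by d^\<alpha>. Each dangerous term is a product: one factor is an increment of size
  d^\<alpha> of a coefficient or a jet, the other is a further such increment, the gap between
  consecutive jets, or the gap to the limit jet. These gaps tend to zero locally uniformly by
  monotonicity and compactness, and no rate is required. The blow-up freezes the coefficients at a
  limit of the centres, which is why a Liouville theorem for constant coefficients is enough. The
  Hessian of the blow-up limit may grow like a power \<alpha> of the distance, so that theorem has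
  to allow unbounded Hessians.\<close>

lemma psd_Cauchy_Schwarz:
  fixes B :: "real^'n::finite^'n"
  assumes sym: "transpose B = B" and psd: "\<And>\<xi>. 0 \<le> \<xi> \<bullet> (B *v \<xi>)"
  shows "(x \<bullet> (B *v y))\<^sup>2 \<le> (x \<bullet> (B *v x)) * (y \<bullet> (B *v y))"
proof -
  have s: "y \<bullet> (B *v x) = x \<bullet> (B *v y)" for x y
    by (metis dot_lmul_matrix inner_commute sym transpose_matrix_vector)
  have q: "0 \<le> x \<bullet> (B *v x) + 2 * t * (x \<bullet> (B *v y)) + t\<^sup>2 * (y \<bullet> (B *v y))" for t
  proof -
    have "0 \<le> (x + t *\<^sub>R y) \<bullet> (B *v (x + t *\<^sub>R y))"
      by (rule psd)
    also have "\<dots> = x \<bullet> (B *v x) + 2 * t * (x \<bullet> (B *v y)) + t\<^sup>2 * (y \<bullet> (B *v y))"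
      using s[of y x]
      by (simp add: matrix_vector_right_distrib inner_add_left inner_add_right
          matrix_vector_mult_scaleR power2_eq_square algebra_simps)
    finally show ?thesis .
  qed
  show ?thesis
  proof (cases "y \<bullet> (B *v y) = 0")
    case True
    have "x \<bullet> (B *v y) = 0"
    proof (rule ccontr)
      assume n: "x \<bullet> (B *v y) \<noteq> 0"
      \<comment> \<open>The polynomial in \<open>t\<close> has become affine; at this value of
        \<open>t\<close> it equals -1.\<close>
      show False
        using q[of "- (x \<bullet> (B *v x) + 1) / (2 * (x \<bullet> (B *v y)))"] True n by (simp add: field_simps)
    qed
    then show ?thesis using True by simp
  next
    case False
    then have p: "y \<bullet> (B *v y) > 0" using psd[of y] by linarith
    have "0 \<le> x \<bullet> (B *v x) - (x \<bullet> (B *v y))\<^sup>2 / (y \<bullet> (B *v y))"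
      using q[of "- (x \<bullet> (B *v y)) / (y \<bullet> (B *v y))"] False
      by (simp add: field_simps power2_eq_square)
    then show ?thesis using p by (simp add: field_simps)
  qed
qed

lemma inner_matrix_sum: "A \<bullet> B = (\<Sum>i\<in>UNIV. \<Sum>j\<in>UNIV. A$i$j * B$i$j)" for A B :: "real^'n::finite^'m::finite"
  by (simp add: inner_vec_def)

lemma quadratic_form_sum: "x \<bullet> (B *v y) = (\<Sum>i\<in>UNIV. \<Sum>j\<in>UNIV. x$i * B$i$j * y$j)"
  for B :: "real^'n::finite^'m::finite"
  by (simp add: inner_vec_def matrix_vector_mult_def sum_distrib_left mult.assoc)

lemma axis_quadratic: "axis i 1 \<bullet> (B *v axis j 1) = B$i$j" for B :: "real^'n::finite^'m::finite"
  by (simp add: inner_axis' matrix_vector_mult_basis column_def)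

text \<open>Each step of the Cholesky decomposition of \<open>B\<close> splits off a rank one term \<open>s s\<^sup>T\<close>.\<close>

lemma psd_inner_nonpos:
  fixes B Z :: "real^'n::finite^'n"
  assumes sym: "transpose B = B" and psd: "\<And>\<xi>. 0 \<le> \<xi> \<bullet> (B *v \<xi>)"
    and Z: "\<And>\<xi>. \<xi> \<bullet> (Z *v \<xi>) \<le> 0"
  shows "B \<bullet> Z \<le> 0"
  using sym psd
\<comment> \<open>The measure counts nonzero diagonal entries: the pivot entry is cleared, and by
  \<open>CS\<close> a zero diagonal entry forces its whole row to vanish, so that it stays
  zero.\<close>
proof (induction "card {i. B$i$i \<noteq> 0}" arbitrary: B rule: less_induct)
  case less
  have S: "B$i$j = B$j$i" for i j
    using arg_cong[OF less.prems(1), of "\<lambda>X. X $ j $ i"] by (simp add: transpose_def)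
  have CS: "(B$i$j)\<^sup>2 \<le> B$i$i * B$j$j" for i j
    using psd_Cauchy_Schwarz[OF less.prems, of "axis i 1" "axis j 1"] by (simp add: axis_quadratic)
  have nn: "B$i$i \<ge> 0" for i
    using less.prems(2)[of "axis i 1"] by (simp add: axis_quadratic)
  show ?case
  proof (cases "\<exists>i. B$i$i \<noteq> 0")
    case False
    then have "B = 0"
      using CS by (simp add: vec_eq_iff)
    then show ?thesis by simp
  next
    case True
    then obtain i where i: "B$i$i > 0" using nn by (metis less_eq_real_def)
    define s where "s = B *v axis i 1"
    have s: "s $ p = B$p$i" for p
      by (simp add: s_def matrix_vector_mult_def axis_def if_distrib[of "\<lambda>x. _ * x"] cong: if_cong)
    define B' where "B' = (\<chi> p q. B$p$q - s$p * s$q / B$i$i)"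
    have sym': "transpose B' = B'"
      using S by (simp add: B'_def transpose_def vec_eq_iff)
    have rank1: "x \<bullet> (B' *v y) = x \<bullet> (B *v y) - (x \<bullet> s) * (y \<bullet> s) / B$i$i" for x y
    proof -
      have "(x \<bullet> s) * (y \<bullet> s) / B$i$i = (\<Sum>p\<in>UNIV. \<Sum>q\<in>UNIV. x$p * (s$p * s$q / B$i$i) * y$q)"
        by (simp add: inner_vec_def sum_product sum_divide_distrib algebra_simps)
      then show ?thesis
        by (simp add: quadratic_form_sum B'_def sum_subtractf algebra_simps)
    qed
    have psd': "0 \<le> \<xi> \<bullet> (B' *v \<xi>)" for \<xi>
    proof -
      have "(\<xi> \<bullet> s)\<^sup>2 \<le> (\<xi> \<bullet> (B *v \<xi>)) * B$i$i"
        using psd_Cauchy_Schwarz[OF less.prems, of \<xi> "axis i 1"] by (simp add: axis_quadratic s_def)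
      then show ?thesis using i by (simp add: rank1 field_simps power2_eq_square)
    qed
    have zero: "B$j$j = 0 \<Longrightarrow> B'$j$j = 0" for j
      using CS[of j i] by (simp add: B'_def s)
    have "{j. B'$j$j \<noteq> 0} \<subset> {j. B$j$j \<noteq> 0}"
    proof
      show "{j. B'$j$j \<noteq> 0} \<subseteq> {j. B$j$j \<noteq> 0}" using zero by auto
      have "B'$i$i = 0" using i by (simp add: B'_def s)
      then show "{j. B'$j$j \<noteq> 0} \<noteq> {j. B$j$j \<noteq> 0}" using i by force
    qed
    then have IH: "B' \<bullet> Z \<le> 0"
      by (intro less.hyps psubset_card_mono sym' psd') auto
    have "B \<bullet> Z = B' \<bullet> Z + (s \<bullet> (Z *v s)) / B$i$i"
      by (simp add: quadratic_form_sum inner_matrix_sum B'_def sum_subtractf sum_divide_distrib algebra_simps)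
    moreover have "(s \<bullet> (Z *v s)) / B$i$i \<le> 0"
      using Z[of s] i by (simp add: divide_nonpos_pos)
    ultimately show ?thesis using IH by linarith
  qed
qed

section \<open>Second order conditions at a maximum and a calculus of functions of class C^2\<close>

lemma second_derivative_at_max:
  fixes f f' :: "real \<Rightarrow> real"
  assumes f: "\<And>t. (f has_real_derivative f' t) (at t)"
    and f': "(f' has_real_derivative k) (at 0)"
    and max: "\<forall>\<^sub>F t in nhds 0. f t \<le> f 0"
  shows "f' 0 = 0" "k \<le> 0"
proof -
  obtain d where d: "d > 0" "\<And>t. \<bar>t\<bar> < d \<Longrightarrow> f t \<le> f 0"
    using max by (auto simp: eventually_nhds_metric)
  show 0: "f' 0 = 0"
    by (rule DERIV_local_max[OF f d(1)]) (use d(2) in auto)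
  show "k \<le> 0"
  proof (rule ccontr)
    assume "\<not> k \<le> 0"
    then obtain e where e: "e > 0" "\<And>h. 0 < h \<Longrightarrow> h < e \<Longrightarrow> f' 0 < f' (0 + h)"
      using DERIV_pos_inc_right[OF f'] by force
    define t where "t = min d e / 2"
    have t: "0 < t" "t < d" "t < e" using d(1) e(1) by (auto simp: t_def)
    obtain z where z: "0 < z" "z < t" "f t - f 0 = (t - 0) * f' z"
      using MVT2[of 0 t f f'] t f by auto
    have "f' z > 0" using e(2)[of z] z t 0 by simp
    then have "f t > f 0" using z t by (smt (verit) mult_pos_pos)
    then show False using d(2)[of t] t by simp
  qed
qed

text \<open>As for \<open>hess\<close>, the entry \<open>G x $ i $ j\<close> is the derivative of \<open>g $ j\<close> in direction \<open>i\<close>, so that \<open>G x\<close>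
  acts on increments by multiplication from the left.\<close>

definition C2_with :: "(real^'d::finite \<Rightarrow> real) \<Rightarrow> (real^'d \<Rightarrow> real^'d) \<Rightarrow> (real^'d \<Rightarrow> real^'d^'d) \<Rightarrow> bool"
  where "C2_with w g G \<longleftrightarrow>
    (\<forall>x. (w has_derivative (\<lambda>h. g x \<bullet> h)) (at x)) \<and>
    (\<forall>x. (g has_derivative (\<lambda>h. h v* G x)) (at x)) \<and> continuous_on UNIV G"

lemma C2_withI:
  assumes "\<And>x. (w has_derivative (\<lambda>h. g x \<bullet> h)) (at x)"
    "\<And>x. (g has_derivative (\<lambda>h. h v* G x)) (at x)" "continuous_on UNIV G"
  shows "C2_with w g G"
  using assms by (simp add: C2_with_def)

lemma C2_with_deriv:
  assumes "C2_with w g G"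
  shows "(w has_derivative (\<lambda>h. g x \<bullet> h)) (at x)" "(g has_derivative (\<lambda>h. h v* G x)) (at x)"
    "continuous_on UNIV w" "continuous_on UNIV g" "continuous_on UNIV G"
  using assms by (auto simp: C2_with_def continuous_on_eq_continuous_at intro: has_derivative_continuous)

lemma C2_with_diff:
  assumes "C2_with w g G" "C2_with w' g' G'"
  shows "C2_with (\<lambda>x. w x - w' x) (\<lambda>x. g x - g' x) (\<lambda>x. G x - G' x)"
  using assms unfolding C2_with_def
  by (auto intro!: derivative_eq_intros continuous_intros
      simp: inner_diff_left fun_eq_iff vector_matrix_mult_def
        vec_eq_iff right_diff_distrib left_diff_distrib sum_subtractf)

lemma C2_with_scaleR:
  assumes "C2_with w g G"
  shows "C2_with (\<lambda>x. c * w x) (\<lambda>x. c *\<^sub>R g x) (\<lambda>x. c *\<^sub>R G x)"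
  using assms unfolding C2_with_def
  by (auto intro!: derivative_eq_intros continuous_intros
      simp: fun_eq_iff vector_matrix_mult_def vec_eq_iff sum_distrib_left mult_ac)

lemma C2_with_add:
  assumes "C2_with w g G" "C2_with w' g' G'"
  shows "C2_with (\<lambda>x. w x + w' x) (\<lambda>x. g x + g' x) (\<lambda>x. G x + G' x)"
  using C2_with_diff[OF assms(1) C2_with_scaleR[OF assms(2), of "-1"]] by simp

lemma C2_with_const: "C2_with (\<lambda>x. c) (\<lambda>x. 0) (\<lambda>x. 0)"
  unfolding C2_with_def
  by (auto intro!: derivative_eq_intros simp: fun_eq_iff vector_matrix_mult_def vec_eq_iff)

lemma C2_with_linear: "C2_with (\<lambda>x. a \<bullet> x) (\<lambda>x. a) (\<lambda>x. 0)"
  unfolding C2_with_def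
  by (auto intro!: derivative_eq_intros simp: fun_eq_iff vector_matrix_mult_def vec_eq_iff)

lemma C2_with_quadratic:
  assumes "transpose Q = Q"
  shows "C2_with (\<lambda>x. x \<bullet> (Q *v x)) (\<lambda>x. 2 *\<^sub>R (Q *v x)) (\<lambda>x. 2 *\<^sub>R Q)"
proof -
  have s: "y \<bullet> (Q *v x) = x \<bullet> (Q *v y)" for x y
    by (metis assms dot_lmul_matrix inner_commute transpose_matrix_vector)
  have "((\<lambda>x. x \<bullet> (Q *v x)) has_derivative (\<lambda>h. (2 *\<^sub>R (Q *v x)) \<bullet> h)) (at x)" for x
    by (auto intro!: derivative_eq_intros matrix_vector_mul_bounded_linear[THEN bounded_linear.has_derivative]
        simp: fun_eq_iff s[of x] inner_commute)
  moreover have "((\<lambda>x. 2 *\<^sub>R (Q *v x)) has_derivative (\<lambda>h. h v* (2 *\<^sub>R Q))) (at x)" for x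
  proof -
    have "h v* (2 *\<^sub>R Q) = 2 *\<^sub>R (Q *v h)" for h
      by (metis assms transpose_matrix_vector transpose_scalar matrix_vector_mult_scaleR scaleR_matrix_vector_assoc)
    then show ?thesis
      by (auto intro!: derivative_eq_intros matrix_vector_mul_bounded_linear[THEN bounded_linear.has_derivative])
  qed
  ultimately show ?thesis by (intro C2_withI) auto
qed

lemma C2_with_affine:
  assumes "C2_with w g G"
  shows "C2_with (\<lambda>z. w (x + c *\<^sub>R z)) (\<lambda>z. c *\<^sub>R g (x + c *\<^sub>R z)) (\<lambda>z. c\<^sup>2 *\<^sub>R G (x + c *\<^sub>R z))"
proof (rule C2_withI)
  note d = C2_with_deriv[OF assms]
  have a: "((\<lambda>z. x + c *\<^sub>R z) has_derivative (\<lambda>h. c *\<^sub>R h)) (at z)" for z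
    by (auto intro!: derivative_eq_intros)
  show "((\<lambda>z. w (x + c *\<^sub>R z)) has_derivative (\<lambda>h. (c *\<^sub>R g (x + c *\<^sub>R z)) \<bullet> h)) (at z)" for z
    using has_derivative_compose[OF a d(1)] by simp
  have "((\<lambda>z. c *\<^sub>R g (x + c *\<^sub>R z)) has_derivative (\<lambda>h. c *\<^sub>R ((c *\<^sub>R h) v* G (x + c *\<^sub>R z)))) (at z)" for z
    using has_derivative_scaleR_right[OF has_derivative_compose[OF a d(2)]] by simp
  moreover have "c *\<^sub>R ((c *\<^sub>R h) v* M) = h v* (c\<^sup>2 *\<^sub>R M)" for h and M :: "real^'a^'a"
    by (simp add: vector_matrix_mult_def vec_eq_iff sum_distrib_left power2_eq_square mult_ac)
  ultimately show "((\<lambda>z. c *\<^sub>R g (x + c *\<^sub>R z)) has_derivative (\<lambda>h. h v* (c\<^sup>2 *\<^sub>R G (x + c *\<^sub>R z)))) (at z)" for z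
    by simp
  show "continuous_on UNIV (\<lambda>z. c\<^sup>2 *\<^sub>R G (x + c *\<^sub>R z))"
    by (intro continuous_intros continuous_on_compose2[OF d(5)]) auto
qed

lemma C2_with_shift:
  assumes "C2_with w g G"
  shows "C2_with (\<lambda>z. w (z + a)) (\<lambda>z. g (z + a)) (\<lambda>z. G (z + a))"
  using C2_with_affine[OF assms, of a 1] by (simp add: add.commute)

lemma C2_with_line:
  assumes "C2_with w g G"
  shows "((\<lambda>t. w (x + t *\<^sub>R e)) has_real_derivative g (x + t *\<^sub>R e) \<bullet> e) (at t)"
    "((\<lambda>t. g (x + t *\<^sub>R e) \<bullet> a) has_real_derivative e \<bullet> (G (x + t *\<^sub>R e) *v a)) (at t)"
proof -
  note d = C2_with_deriv[OF assms]
  have a: "((\<lambda>t. x + t *\<^sub>R e) has_derivative (\<lambda>h. h *\<^sub>R e)) (at t)" for t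
    by (auto intro!: derivative_eq_intros)
  show "((\<lambda>t. w (x + t *\<^sub>R e)) has_real_derivative g (x + t *\<^sub>R e) \<bullet> e) (at t)"
    unfolding has_field_derivative_def
    using has_derivative_compose[OF a d(1)] by (simp add: mult.commute[of _ "_ \<bullet> _"])
  have "((\<lambda>t. g (x + t *\<^sub>R e) \<bullet> a) has_derivative (\<lambda>h. ((h *\<^sub>R e) v* G (x + t *\<^sub>R e)) \<bullet> a)) (at t)"
    using has_derivative_inner_left[OF has_derivative_compose[OF a d(2)]] .
  then show "((\<lambda>t. g (x + t *\<^sub>R e) \<bullet> a) has_real_derivative e \<bullet> (G (x + t *\<^sub>R e) *v a)) (at t)"
    unfolding has_field_derivative_def by (simp add: dot_lmul_matrix mult.commute[of _ "_ \<bullet> _"])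
qed

text \<open>The one-dimensional conditions are applied on the lines through \<open>x\<close>; the
  direction \<open>g x\<close> itself gives \<open>g x \<bullet> g x = 0\<close>.\<close>

lemma C2_with_at_max:
  assumes "C2_with w g G" and max: "\<forall>\<^sub>F y in nhds x. w y \<le> w x"
  shows "g x = 0" "e \<bullet> (G x *v e) \<le> 0"
proof -
  have "\<forall>\<^sub>F t in nhds 0. w (x + t *\<^sub>R e) \<le> w (x + 0 *\<^sub>R e)" for e
  proof -
    have "isCont (\<lambda>t. x + t *\<^sub>R e) 0"
      by (intro continuous_intros)
    then have "((\<lambda>t. x + t *\<^sub>R e) \<longlongrightarrow> x) (nhds 0)"
      using tendsto_at_iff_tendsto_nhds[of "\<lambda>t. x + t *\<^sub>R e" 0] by (simp add: isCont_def)
    then show ?thesis using max by (auto simp: filterlim_iff)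
  qed
  note * = second_derivative_at_max[OF C2_with_line(1)[OF assms(1)] C2_with_line(2)[OF assms(1)] this]
  show "e \<bullet> (G x *v e) \<le> 0" using *(2)[of e] by simp
  have "g x \<bullet> g x = 0" using *(1)[of "g x"] by simp
  then show "g x = 0" by simp
qed

text \<open>Identifies the gradients and Hessians of different subsequential limits as soon as the
  limit functions agree.\<close>

lemma C2_with_unique:
  assumes "C2_with w g G" "C2_with w g' G'"
  shows "g = g'" "G = G'"
proof -
  show g: "g = g'"
  proof
    fix x
    have "(\<lambda>h. g x \<bullet> h) = (\<lambda>h. g' x \<bullet> h)"
      using C2_with_deriv(1)[OF assms(1)] C2_with_deriv(1)[OF assms(2)] has_derivative_unique by blast
    then show "g x = g' x" by (metis vector_eq_rdot)
  qed
  show "G = G'"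
  proof
    fix x
    have "(\<lambda>h. h v* G x) = (\<lambda>h. h v* G' x)"
      using C2_with_deriv(2)[OF assms(1)] C2_with_deriv(2)[OF assms(2)] has_derivative_unique g by blast
    then show "G x = G' x"
      by (simp add: vec_eq_iff) (metis axis_quadratic dot_lmul_matrix)
  qed
qed

text \<open>The mean value theorem is used twice: in direction \<open>a\<close> for the increment of
  \<open>w\<close> along \<open>b\<close>, then in direction \<open>b\<close> for the derivative so
  obtained. The formula yields the symmetry of Hessians and the bound on third differences in the
  Liouville theorem.\<close>

lemma C2_with_second_difference:
  assumes "C2_with w g G" "t > 0"
  obtains s s' where "0 < s" "s < t" "0 < s'" "s' < t"
    "w (x + t *\<^sub>R a + t *\<^sub>R b) - w (x + t *\<^sub>R b) - w (x + t *\<^sub>R a) + w x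
      = t * (t * (b \<bullet> (G (x + s *\<^sub>R a + s' *\<^sub>R b) *v a)))"
proof -
  have "((\<lambda>s. w ((x + t *\<^sub>R b) + s *\<^sub>R a) - w (x + s *\<^sub>R a)) has_real_derivative
      (g ((x + t *\<^sub>R b) + s *\<^sub>R a) \<bullet> a - g (x + s *\<^sub>R a) \<bullet> a)) (at s)" for s
    by (intro derivative_intros C2_with_line(1)[OF assms(1)])
  from MVT2[OF assms(2) this]
  obtain s where s: "0 < s" "s < t" "w ((x + t *\<^sub>R b) + t *\<^sub>R a) - w (x + t *\<^sub>R a) - (w (x + t *\<^sub>R b) - w x)
      = t * (g ((x + t *\<^sub>R b) + s *\<^sub>R a) \<bullet> a - g (x + s *\<^sub>R a) \<bullet> a)"
    by auto
  from MVT2[OF assms(2) C2_with_line(2)[OF assms(1)]]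
  obtain s' where s': "0 < s'" "s' < t" "g (x + s *\<^sub>R a + t *\<^sub>R b) \<bullet> a - g (x + s *\<^sub>R a + 0 *\<^sub>R b) \<bullet> a
      = (t - 0) * (b \<bullet> (G (x + s *\<^sub>R a + s' *\<^sub>R b) *v a))"
    by blast
  have "w (x + t *\<^sub>R a + t *\<^sub>R b) - w (x + t *\<^sub>R b) - w (x + t *\<^sub>R a) + w x
      = t * (t * (b \<bullet> (G (x + s *\<^sub>R a + s' *\<^sub>R b) *v a)))"
    using s(3) s'(3) by (simp add: algebra_simps)
  with s(1,2) s'(1,2) that show ?thesis by blast
qed

text \<open>The second difference over a small parallelogram is symmetric in its two sides, and
  divided by \<open>t\<^sup>2\<close> it is close to either of the two mixed forms.\<close>

lemma C2_with_symmetric: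
  assumes "C2_with w g G"
  shows "transpose (G x) = G x"
proof -
  have ab: "b \<bullet> (G x *v a) = a \<bullet> (G x *v b)" for a b
  proof (rule ccontr)
    assume n: "b \<bullet> (G x *v a) \<noteq> a \<bullet> (G x *v b)"
    define f where "f = (\<lambda>a b (s, s'). b \<bullet> (G (x + s *\<^sub>R a + s' *\<^sub>R b) *v a))"
    have cont: "isCont (f a b) 0" for a b
    proof -
      have "continuous_on UNIV (\<lambda>p. G (x + fst p *\<^sub>R a + snd p *\<^sub>R b))"
        by (intro continuous_on_compose2[OF C2_with_deriv(5)[OF assms]] continuous_intros) auto
      then have "continuous_on UNIV (f a b)"
        unfolding f_def case_prod_beta quadratic_form_sum by (intro continuous_intros)
      then show ?thesis by (metis UNIV_I continuous_on_eq_continuous_at open_UNIV)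
    qed
    define e where "e = \<bar>b \<bullet> (G x *v a) - a \<bullet> (G x *v b)\<bar> / 2"
    have e: "e > 0" using n by (simp add: e_def)
    have near: "\<exists>d>0. \<forall>s s'. \<bar>s\<bar> < d \<and> \<bar>s'\<bar> < d \<longrightarrow> \<bar>f a b (s, s') - f a b 0\<bar> < e" for a b
    proof -
      obtain d where d: "d > 0" "\<And>p. dist p 0 < d \<Longrightarrow> dist (f a b p) (f a b 0) < e"
        using cont[of a b] e unfolding continuous_at_eps_delta by metis
      have "\<bar>f a b (s, s') - f a b 0\<bar> < e" if "\<bar>s\<bar> < d/2" "\<bar>s'\<bar> < d/2" for s s'
      proof -
        have "norm (s, s') \<le> norm s + norm s'" by (rule norm_Pair_le)
        then have "dist (s, s') 0 < d" using that by simp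
        then show ?thesis using d(2)[of "(s,s')"] by (simp add: dist_real_def)
      qed
      then show ?thesis using d(1) by (intro exI[of _ "d/2"]) auto
    qed
    obtain d1 where d1: "d1 > 0" "\<And>s s'. \<bar>s\<bar> < d1 \<Longrightarrow> \<bar>s'\<bar> < d1 \<Longrightarrow> \<bar>f a b (s, s') - f a b 0\<bar> < e"
      using near by blast
    obtain d2 where d2: "d2 > 0" "\<And>s s'. \<bar>s\<bar> < d2 \<Longrightarrow> \<bar>s'\<bar> < d2 \<Longrightarrow> \<bar>f b a (s, s') - f b a 0\<bar> < e"
      using near by blast
    define t where "t = min d1 d2"
    have t: "t > 0" using d1 d2 by (simp add: t_def)
    obtain s s' where 1: "0 < s" "s < t" "0 < s'" "s' < t"
      "w (x + t *\<^sub>R a + t *\<^sub>R b) - w (x + t *\<^sub>R b) - w (x + t *\<^sub>R a) + w x = t * (t * f a b (s, s'))"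
      using C2_with_second_difference[OF assms t, of x a b] unfolding f_def by auto
    obtain u u' where 2: "0 < u" "u < t" "0 < u'" "u' < t"
      "w (x + t *\<^sub>R b + t *\<^sub>R a) - w (x + t *\<^sub>R a) - w (x + t *\<^sub>R b) + w x = t * (t * f b a (u, u'))"
      using C2_with_second_difference[OF assms t, of x b a] unfolding f_def by auto
    have "t * (t * f a b (s, s')) = t * (t * f b a (u, u'))"
      using 1(5) 2(5) by (simp add: algebra_simps)
    then have "f a b (s, s') = f b a (u, u')" using t by simp
    moreover have "\<bar>f a b (s, s') - f a b 0\<bar> < e" "\<bar>f b a (u, u') - f b a 0\<bar> < e"
      using 1 2 by (intro d1 d2; simp add: t_def)+
    moreover have "f a b 0 = b \<bullet> (G x *v a)" "f b a 0 = a \<bullet> (G x *v b)"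
      by (simp_all add: f_def zero_prod_def)
    ultimately have "\<bar>b \<bullet> (G x *v a) - a \<bullet> (G x *v b)\<bar> < e + e" by linarith
    then show False by (simp add: e_def)
  qed
  have "G x $ i $ j = G x $ j $ i" for i j
    using ab[of "axis i 1" "axis j 1"] by (simp add: axis_quadratic)
  then show ?thesis by (simp add: transpose_def vec_eq_iff)
qed

section \<open>Liouville theorems\<close>

lemma inner_mat_1: "A \<bullet> mat 1 = trace A" for A :: "real^'n::finite^'n"
  by (simp add: inner_matrix_sum mat_def trace_def if_distrib[of "\<lambda>x. _ * x"] cong: if_cong)

lemma quadratic_mat: "x \<bullet> ((k *\<^sub>R mat 1) *v x) = k * (x \<bullet> x)" for x :: "real^'n::finite"
  by (metis inner_scaleR_right matrix_vector_mul_lid scaleR_matrix_vector_assoc)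

lemma C2_with_sqnorm: "C2_with (\<lambda>x::real^'d::finite. k * (x \<bullet> x)) (\<lambda>x. (2 * k) *\<^sub>R x) (\<lambda>x. (2 * k) *\<^sub>R mat 1)"
  using C2_with_scaleR[OF C2_with_quadratic[of "mat 1"], of k] by (simp add: mult.commute)

definition rank1 :: "real^'n::finite \<Rightarrow> real^'n^'n"
  where "rank1 e = (\<chi> i j. e$i * e$j)"

lemma transpose_rank1: "transpose (rank1 e) = rank1 e"
  by (simp add: rank1_def transpose_def vec_eq_iff mult.commute)

lemma rank1_inner: "rank1 e \<bullet> Z = e \<bullet> (Z *v e)"
  by (simp add: rank1_def inner_matrix_sum quadratic_form_sum mult_ac)

lemma quadratic_rank1: "x \<bullet> (rank1 e *v x) = (x \<bullet> e)\<^sup>2"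
  unfolding quadratic_form_sum by (simp add: rank1_def inner_vec_def power2_eq_square sum_product algebra_simps)

text \<open>Reflection coupling: \<open>u x - u y\<close> is compared with a concave function \<open>\<phi>\<close> of \<open>norm (x - y)\<close>.
  At a maximum of the difference the direction \<open>(e, -e)\<close> with \<open>e\<close> parallel to \<open>x - y\<close> sees \<open>\<phi>''\<close>,
  while the directions \<open>(s, s)\<close> do not see \<open>\<phi>\<close> at all.\<close>

lemma bounded_solution_modulus:
  fixes u :: "real^'d::finite \<Rightarrow> real" and A :: "real^'d^'d"
  assumes u: "C2_with u g G" and bd: "\<And>x. \<bar>u x\<bar> \<le> M" and M: "M > 0"
    and sym: "transpose A = A" and c: "c > 0" and ell: "\<And>\<xi>. c * (\<xi> \<bullet> \<xi>) \<le> \<xi> \<bullet> (A *v \<xi>)"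
    and eq: "\<And>x. A \<bullet> G x = 0" and R: "R > 0" "norm (y0 - x0) \<le> R"
  shows "u x0 - u y0 \<le> 4 * M * norm (y0 - x0) / R"
proof (rule ccontr)
  \<comment> \<open>A parabola with maximum at \<open>R\<close>, where its value
    \<open>2 * M\<close> exceeds every possible difference of values of \<open>u\<close> minus a
    positive amount. Its second derivative is -4M/R^2.\<close>
  define \<phi> where "\<phi> r = 2 * M * (2 * r / R - r\<^sup>2 / R\<^sup>2)" for r
  have \<phi>_le: "\<phi> r \<le> 4 * M * r / R" for r
  proof -
    have "2 * M * (r\<^sup>2 / R\<^sup>2) \<ge> 0" using M by simp
    then show ?thesis by (simp add: \<phi>_def right_diff_distrib mult_ac)
  qed
  have \<phi>_0: "\<phi> 0 = 0" and \<phi>_R: "\<phi> R = 2 * M" using R by (simp_all add: \<phi>_def)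
  have \<phi>_nonneg: "\<phi> r \<ge> 0" if "0 \<le> r" "r \<le> R" for r
  proof -
    have "r / R * (2 - r / R) \<ge> 0" using that R by (intro mult_nonneg_nonneg) (auto simp: field_simps)
    moreover have "\<phi> r = 2 * M * (r / R * (2 - r / R))"
      by (simp add: \<phi>_def power2_eq_square right_diff_distrib)
    ultimately show ?thesis using M by (metis less_imp_le mult_nonneg_nonneg zero_le_numeral)
  qed
  assume "\<not> ?thesis"
  then have gap: "u x0 - u y0 - \<phi> (norm (y0 - x0)) > 0" (is "?gap > 0")
    using \<phi>_le[of "norm (y0 - x0)"] by linarith
  define \<tau> where "\<tau> = trace A"
  \<comment> \<open>The first bound keeps the penalised gap at the given pair positive; the second
    makes the penalty too small to compensate the concavity of \<phi> at the end.\<close>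
  define \<delta> where "\<delta> = min (?gap / (2 * (x0 \<bullet> x0 + 1))) (4 * M * c / (R\<^sup>2 * (\<bar>\<tau>\<bar> + 1)))"
  have x0p: "x0 \<bullet> x0 + 1 > 0" by (simp add: add_nonneg_pos)
  have \<delta>: "\<delta> > 0" using gap x0p M c R by (simp add: \<delta>_def)
  have \<delta>1: "\<delta> * (x0 \<bullet> x0) < ?gap"
  proof -
    have "\<delta> * (x0 \<bullet> x0) \<le> \<delta> * (x0 \<bullet> x0 + 1)" using \<delta> by simp
    also have "\<dots> \<le> ?gap / (2 * (x0 \<bullet> x0 + 1)) * (x0 \<bullet> x0 + 1)"
      using x0p by (intro mult_right_mono) (auto simp: \<delta>_def)
    also have "\<dots> = ?gap / 2" using x0p by (simp add: field_simps)
    also have "\<dots> < ?gap" using gap by simp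
    finally show ?thesis .
  qed
  have \<delta>2: "2 * \<delta> * \<tau> < 16 * M * c / R\<^sup>2"
  proof -
    have cancel: "a / (b * (\<bar>\<tau>\<bar> + 1)) * (\<bar>\<tau>\<bar> + 1) = a / b" for a b :: real
    proof -
      have "\<bar>\<tau>\<bar> + 1 \<noteq> 0" by linarith
      then show ?thesis using nonzero_mult_divide_mult_cancel_right[of "\<bar>\<tau>\<bar> + 1" a b] by simp
    qed
    have "\<delta> * \<tau> \<le> \<delta> * (\<bar>\<tau>\<bar> + 1)" using \<delta> by (intro mult_left_mono) auto
    also have "\<dots> \<le> 4 * M * c / (R\<^sup>2 * (\<bar>\<tau>\<bar> + 1)) * (\<bar>\<tau>\<bar> + 1)"
      by (intro mult_right_mono) (auto simp: \<delta>_def)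
    also have "\<dots> = 4 * M * c / R\<^sup>2" by (rule cancel)
    finally have "\<delta> * \<tau> \<le> 4 * M * c / R\<^sup>2" .
    moreover have "M * c / R\<^sup>2 > 0" using M c R by simp
    ultimately show ?thesis by simp
  qed
  \<comment> \<open>In the variables \<open>x\<close> and \<open>z = y - x\<close> the synchronous
    shift leaves \<open>z\<close> fixed, and the domain is unbounded only in \<open>x\<close>, where
    the penalty acts.\<close>
  define \<Psi> where "\<Psi> x z = u x - u (x + z) - \<phi> (norm z) - \<delta> * (x \<bullet> x)" for x z
  have u_le: "u x - u y \<le> 2 * M" for x y
    using bd[of x] bd[of y] by linarith
  define \<rho> where "\<rho> = sqrt (2 * M / \<delta>) + norm x0"
  have \<rho>: "\<rho> \<ge> 0" "norm x0 \<le> \<rho>" using M \<delta> by (simp_all add: \<rho>_def)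
  have \<Psi>_out: "\<Psi> x z \<le> 0" if "norm x > \<rho>" "norm z \<le> R" for x z
  proof -
    have "sqrt (2 * M / \<delta>) \<le> norm x" using that norm_ge_zero[of x0] unfolding \<rho>_def by linarith
    then have "2 * M / \<delta> \<le> (norm x)\<^sup>2" by (rule sqrt_le_D)
    then have "2 * M \<le> \<delta> * (x \<bullet> x)"
      using \<delta> by (simp add: power2_norm_eq_inner field_simps)
    then show ?thesis using u_le[of x "x+z"] \<phi>_nonneg[of "norm z"] that(2) by (simp add: \<Psi>_def)
  qed
  have "continuous_on (cball 0 \<rho> \<times> cball 0 R) (\<lambda>p. \<Psi> (fst p) (snd p))"
    unfolding \<Psi>_def \<phi>_def using R
    by (intro continuous_intros continuous_on_compose2[OF C2_with_deriv(3)[OF u]]) auto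
  moreover have "compact (cball 0 \<rho> \<times> cball 0 R :: ((real^'d) \<times> (real^'d)) set)"
    by (intro compact_Times compact_cball)
  moreover have "(x0, y0 - x0) \<in> cball 0 \<rho> \<times> cball 0 R"
    using \<rho> R by simp
  ultimately obtain p where p: "p \<in> cball 0 \<rho> \<times> cball 0 R"
      "\<forall>q\<in>cball 0 \<rho> \<times> cball 0 R. \<Psi> (fst q) (snd q) \<le> \<Psi> (fst p) (snd p)"
    using continuous_attains_sup[of "cball 0 \<rho> \<times> cball 0 R" "\<lambda>p. \<Psi> (fst p) (snd p)"] by blast
  obtain x z where xz: "p = (x, z)" by (cases p)
  have pos: "\<Psi> x z > 0"
  proof -
    have "\<Psi> x0 (y0 - x0) > 0" using \<delta>1 by (simp add: \<Psi>_def)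
    moreover have "\<Psi> x0 (y0 - x0) \<le> \<Psi> x z"
      using p(2) \<rho> R unfolding xz by force
    ultimately show ?thesis by linarith
  qed
  have zR': "norm z \<le> R" using p(1) xz by simp
  have max: "\<Psi> x' z' \<le> \<Psi> x z" if "norm z' \<le> R" for x' z'
  proof (cases "norm x' \<le> \<rho>")
    case True
    then show ?thesis using p(2) that unfolding xz by force
  next
    case False
    then show ?thesis using \<Psi>_out[of x' z'] that pos by simp
  qed
  have \<delta>x: "\<delta> * (x \<bullet> x) \<ge> 0" using \<delta> by simp
  have z0: "z \<noteq> 0"
    using pos \<phi>_0 \<delta>x by (auto simp: \<Psi>_def)
  have zR: "norm z < R"
    using pos \<phi>_R zR' \<delta>x u_le[of x "x+z"] by (cases "norm z = R") (auto simp: \<Psi>_def)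
  define Z where "Z = G x - G (x + z)"
  \<comment> \<open>For fixed \<open>z\<close> the function \<open>x \<mapsto> \<Psi> x z\<close> is
    maximal, which controls all directions (s, s) at once.\<close>
  have sync: "s \<bullet> ((Z - (2 * \<delta>) *\<^sub>R mat 1) *v s) \<le> 0" for s
  proof -
    have "C2_with (\<lambda>x. u x - u (x + z) - \<delta> * (x \<bullet> x)) (\<lambda>x. g x - g (x + z) - (2 * \<delta>) *\<^sub>R x)
      (\<lambda>x. G x - G (x + z) - (2 * \<delta>) *\<^sub>R mat 1)"
      by (intro C2_with_diff C2_with_shift C2_with_sqnorm u)
    then show ?thesis unfolding Z_def
      by (rule C2_with_at_max) (use max[OF zR'] in \<open>auto intro!: always_eventually simp: \<Psi>_def algebra_simps\<close>)
  qed
  \<comment> \<open>With this sign, moving \<open>x\<close> by \<open>t e\<close> and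
    \<open>x + z\<close> by \<open>- t e\<close> lengthens the distance to
    \<open>norm z + 2 * t\<close>. The factor 2 enters squared, turning -4M/R^2 into the term
    16M/R^2 below.\<close>
  define e where "e = - z /\<^sub>R norm z"
  have ze: "z = - (norm z) *\<^sub>R e" using z0 by (simp add: e_def)
  have e1: "e \<bullet> e = 1" using z0 by (simp add: e_def flip: power2_norm_eq_inner)
  have refl: "e \<bullet> (Z *v e) + 16 * M / R\<^sup>2 - 2 * \<delta> \<le> 0"
  proof -
    define f where "f t = u (x + t *\<^sub>R e) - u ((x + z) + t *\<^sub>R (- e)) - \<phi> (norm z + 2 * t)
      - \<delta> * (x \<bullet> x + 2 * t * (x \<bullet> e) + t\<^sup>2)" for t
    define f' where "f' t = g (x + t *\<^sub>R e) \<bullet> e - g ((x + z) + t *\<^sub>R (- e)) \<bullet> (- e)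
      - 4 * M * (1 / R - (norm z + 2 * t) / R\<^sup>2) * 2 - \<delta> * (2 * (x \<bullet> e) + 2 * t)" for t
    have "(\<phi> has_real_derivative 4 * M * (1 / R - r / R\<^sup>2)) (at r)" for r
      unfolding \<phi>_def using R
      by (auto intro!: derivative_eq_intros simp: field_simps power2_eq_square)
    note \<phi>' = DERIV_chain2[OF this]
    have "((\<lambda>t. \<phi> (norm z + 2 * t)) has_real_derivative 4 * M * (1 / R - (norm z + 2 * t) / R\<^sup>2) * 2) (at t)" for t
      by (rule \<phi>') (auto intro!: derivative_eq_intros)
    moreover have "((\<lambda>t. \<delta> * (x \<bullet> x + 2 * t * (x \<bullet> e) + t\<^sup>2)) has_real_derivative \<delta> * (2 * (x \<bullet> e) + 2 * t)) (at t)" for t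
      by (auto intro!: derivative_eq_intros simp: algebra_simps)
    ultimately have "(f has_real_derivative g (x + t *\<^sub>R e) \<bullet> e - g ((x + z) + t *\<^sub>R (- e)) \<bullet> (- e)
      - 4 * M * (1 / R - (norm z + 2 * t) / R\<^sup>2) * 2 - \<delta> * (2 * (x \<bullet> e) + 2 * t)) (at t)" for t
      unfolding f_def by (intro DERIV_diff C2_with_line(1)[OF u])
    then have 1: "(f has_real_derivative f' t) (at t)" for t
      unfolding f'_def .
    have 2: "(f' has_real_derivative (e \<bullet> (Z *v e) + 16 * M / R\<^sup>2 - 2 * \<delta>)) (at 0)"
    proof -
      have "((\<lambda>t. 4 * M * (1 / R - (norm z + 2 * t) / R\<^sup>2) * 2) has_real_derivative - (16 * M / R\<^sup>2)) (at 0)"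
        using R by (auto intro!: derivative_eq_intros simp: field_simps)
      moreover have "((\<lambda>t. \<delta> * (2 * (x \<bullet> e) + 2 * t)) has_real_derivative 2 * \<delta>) (at 0)"
        by (auto intro!: derivative_eq_intros)
      ultimately have "(f' has_real_derivative (e \<bullet> (G (x + 0 *\<^sub>R e) *v e) - (- e) \<bullet> (G ((x + z) + 0 *\<^sub>R (- e)) *v (- e))
          - - (16 * M / R\<^sup>2) - 2 * \<delta>)) (at 0)"
        unfolding f'_def by (intro DERIV_diff C2_with_line(2)[OF u])
      moreover have "e \<bullet> (G (x + z) *v (- e)) = - (e \<bullet> (G (x + z) *v e))"
        by (simp add: quadratic_form_sum sum_negf)
      ultimately show ?thesis
        by (simp add: Z_def matrix_vector_mult_diff_rdistrib inner_diff_right)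
    qed
    have f_eq: "f t = \<Psi> (x + t *\<^sub>R e) (z - (2 * t) *\<^sub>R e)" if "\<bar>2 * t\<bar> < norm z" for t
    proof -
      have "z - (2 * t) *\<^sub>R e = - (norm z + 2 * t) *\<^sub>R e"
        by (subst ze) (simp add: algebra_simps)
      moreover have "norm e = 1" using e1 by (simp add: norm_eq_1)
      ultimately have "norm (z - (2 * t) *\<^sub>R e) = norm z + 2 * t"
        using that by simp
      moreover have "(x + t *\<^sub>R e) \<bullet> (x + t *\<^sub>R e) = x \<bullet> x + 2 * t * (x \<bullet> e) + t\<^sup>2"
        using e1 by (simp add: inner_add_left inner_add_right inner_commute power2_eq_square)
      moreover have "(x + t *\<^sub>R e) + (z - (2 * t) *\<^sub>R e) = (x + z) + t *\<^sub>R (- e)"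
        unfolding mult_2 scaleR_add_left scaleR_minus_right by simp
      ultimately show ?thesis by (simp only: f_def \<Psi>_def)
    qed
    have "\<forall>\<^sub>F t in nhds 0. f t \<le> f 0"
    proof -
      define d where "d = min (norm z) (R - norm z) / 2"
      have d: "d > 0" using z0 zR by (simp add: d_def)
      have "f t \<le> f 0" if "dist t 0 < d" for t
      proof -
        have t: "\<bar>2 * t\<bar> < norm z" "\<bar>2 * t\<bar> < R - norm z" using that by (auto simp: d_def dist_real_def)
        have "norm e = 1" using e1 by (simp add: norm_eq_1)
        then have "norm (z - (2 * t) *\<^sub>R e) \<le> R"
          using norm_triangle_ineq4[of z "(2 * t) *\<^sub>R e"] t by simp
        from max[OF this, of "x + t *\<^sub>R e"] show ?thesis
          using f_eq[OF t(1)] f_eq[of 0] z0 by simp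
      qed
      then show ?thesis using d by (auto simp: eventually_nhds_metric)
    qed
    from second_derivative_at_max(2)[OF 1 2 this] show ?thesis .
  qed
  \<comment> \<open>Splits \<open>A\<close> into a positive semidefinite part, which is coupled
    synchronously, and the multiple \<open>c\<close> of the projection onto \<open>e\<close>, which
    is coupled by reflection. Adding the two inequalities gives 16Mc/R^2 \<le> 2\<delta>\<tau>,
    against the choice of \<delta>.\<close>
  define B where "B = A - c *\<^sub>R rank1 e"
  have "B \<bullet> (Z - (2 * \<delta>) *\<^sub>R mat 1) \<le> 0"
  proof (rule psd_inner_nonpos[OF _ _ sync])
    show "transpose B = B"
      using sym transpose_rank1[of e] by (simp add: B_def transpose_def vec_eq_iff)
    show "0 \<le> \<xi> \<bullet> (B *v \<xi>)" for \<xi>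
    proof -
      have "(\<xi> \<bullet> e)\<^sup>2 \<le> \<xi> \<bullet> \<xi>"
        using Cauchy_Schwarz_ineq[of \<xi> e] e1 by simp
      then have "c * (\<xi> \<bullet> e)\<^sup>2 \<le> c * (\<xi> \<bullet> \<xi>)" using c by (intro mult_left_mono) auto
      then show ?thesis using ell[of \<xi>]
        by (simp add: B_def matrix_vector_mult_diff_rdistrib inner_diff_right quadratic_rank1
            flip: scaleR_matrix_vector_assoc)
    qed
  qed
  moreover have "A \<bullet> Z = 0" using eq by (simp add: Z_def inner_diff_right)
  moreover have "B \<bullet> mat 1 = \<tau> - c"
    using e1 by (simp add: B_def \<tau>_def inner_diff_left rank1_inner flip: inner_mat_1)
  ultimately have "- c * (e \<bullet> (Z *v e)) - 2 * \<delta> * (\<tau> - c) \<le> 0"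
    by (simp add: inner_diff_right) (simp add: B_def inner_diff_left rank1_inner)
  moreover have "c * (e \<bullet> (Z *v e) + 16 * M / R\<^sup>2 - 2 * \<delta>) \<le> 0"
    using refl c by (simp add: mult_nonneg_nonpos)
  ultimately show False using \<delta>2 by (simp add: algebra_simps)
qed

text \<open>On the whole space the radius \<open>R\<close> in the modulus of continuity is free, and
  the bound is of order 1/R; \<open>R\<close> is taken so large that it falls below a positive
  difference of values.\<close>

lemma bounded_solution_constant:
  fixes u :: "real^'d::finite \<Rightarrow> real" and A :: "real^'d^'d"
  assumes u: "C2_with u g G" and bd: "\<And>x. \<bar>u x\<bar> \<le> M"
    and sym: "transpose A = A" and c: "c > 0" and ell: "\<And>\<xi>. c * (\<xi> \<bullet> \<xi>) \<le> \<xi> \<bullet> (A *v \<xi>)"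
    and eq: "\<And>x. A \<bullet> G x = 0"
  shows "u x = u y"
proof -
  have "u x - u y \<le> 0" for x y
  proof (rule ccontr)
    assume n: "\<not> u x - u y \<le> 0"
    define M' where "M' = \<bar>M\<bar> + 1"
    have M': "M' > 0" by (simp add: M'_def)
    have bd': "\<bar>u x\<bar> \<le> M'" for x using bd[of x] by (simp add: M'_def)
    define d where "d = norm (y - x)"
    define R where "R = d + 4 * M' * d / (u x - u y) + 1"
    have R: "R > 0" "d \<le> R" "4 * M' * d / (u x - u y) < R" using n M' by (auto simp: R_def d_def add_nonneg_pos)
    have "u x - u y \<le> 4 * M' * d / R"
      unfolding d_def using R unfolding d_def
      by (intro bounded_solution_modulus[OF u bd' M' sym c ell eq]) auto
    then show False using R(1,3) n by (simp add: field_simps)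
  qed
  from this[of x y] this[of y x] show ?thesis by linarith
qed

lemma norm_matrix_vector_le: "norm (H *v a) \<le> norm H * norm a" for H :: "real^'n::finite^'m::finite"
proof -
  have "norm (H *v a) = L2_set (\<lambda>i. norm (H $ i \<bullet> a)) UNIV"
    by (simp add: norm_vec_def matrix_vector_mult_def inner_vec_def)
  also have "\<dots> \<le> L2_set (\<lambda>i. norm (H $ i) * norm a) UNIV"
    by (rule L2_set_mono) (auto simp: Cauchy_Schwarz_ineq2)
  also have "\<dots> = norm H * norm a"
    by (simp add: L2_set_left_distrib norm_vec_def[of H])
  finally show ?thesis .
qed

lemma norm_transpose: "norm (transpose H) = norm H" for H :: "real^'n::finite^'m::finite"
  unfolding norm_eq_sqrt_inner inner_matrix_sum transpose_def by (simp, rule sum.swap)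

lemma norm_vector_matrix_le: "norm (a v* H) \<le> norm H * norm a" for H :: "real^'n::finite^'m::finite"
  by (metis norm_matrix_vector_le norm_transpose transpose_matrix_vector transpose_transpose)

lemma quadratic_form_le: "\<bar>b \<bullet> (H *v a)\<bar> \<le> norm b * norm a * norm H" for H :: "real^'n::finite^'m::finite"
proof -
  have "\<bar>b \<bullet> (H *v a)\<bar> \<le> norm b * norm (H *v a)" by (rule Cauchy_Schwarz_ineq2)
  also have "\<dots> \<le> norm b * (norm H * norm a)"
    by (intro mult_left_mono norm_matrix_vector_le) auto
  finally show ?thesis by (simp add: mult_ac)
qed

text \<open>Otherwise n^(1-\<alpha>) would stay below C/|k|; beyond the threshold \<open>y\<close>
  it exceeds C/|k| + 1.\<close>

lemma linear_le_powr_imp_zero: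
  fixes k C \<alpha> :: real
  assumes "\<alpha> < 1" and le: "\<And>n::nat. n > 0 \<Longrightarrow> real n * \<bar>k\<bar> \<le> C * real n powr \<alpha>"
  shows "k = 0"
proof (rule ccontr)
  assume k: "k \<noteq> 0"
  have C: "C \<ge> 0" using le[of 1] by (simp add: order_trans[OF abs_ge_zero])
  define y where "y = (C / \<bar>k\<bar> + 1) powr (1 / (1 - \<alpha>))"
  have b: "C / \<bar>k\<bar> + 1 > 0" using C k by (simp add: add_nonneg_pos)
  have y: "y > 0" using b by (simp add: y_def)
  obtain n where n: "y < real n" using reals_Archimedean2 by blast
  then have n0: "n > 0" using y by (cases n) auto
  have "C / \<bar>k\<bar> + 1 = y powr (1 - \<alpha>)" using b assms(1) by (simp add: y_def powr_powr)
  also have "\<dots> \<le> real n powr (1 - \<alpha>)" using n y assms(1) by (intro powr_mono2) auto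
  also have "\<dots> = real n / real n powr \<alpha>" using n0 by (simp add: powr_diff)
  finally have "(C + \<bar>k\<bar>) * real n powr \<alpha> \<le> real n * \<bar>k\<bar>" using k n0 by (simp add: field_simps)
  with le[OF n0] have "\<bar>k\<bar> * real n powr \<alpha> \<le> 0" by (simp add: algebra_simps)
  then show False using k n0 by (simp add: mult_le_0_iff)
qed

text \<open>Third differences of a solution with Hoelder continuous Hessian are bounded solutions, hence
  constant; being additive in the third increment while growing sublinearly in it, they vanish.\<close>

theorem Liouville_Hoelder_Hessian:
  fixes W :: "real^'d::finite \<Rightarrow> real" and A :: "real^'d^'d"
  assumes W: "C2_with W g G" and \<alpha>: "\<alpha> < 1"
    and hoelder: "\<And>x y. norm (G x - G y) \<le> M * norm (x - y) powr \<alpha>"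
    and sym: "transpose A = A" and c: "c > 0" and ell: "\<And>\<xi>. c * (\<xi> \<bullet> \<xi>) \<le> \<xi> \<bullet> (A *v \<xi>)"
    and eq: "\<And>x. A \<bullet> G x = 0"
  shows "G (x + e) = G x"
proof -
  define f where "f = (\<lambda>e x. W (x + e) - W x)"
  define gf where "gf = (\<lambda>e x. g (x + e) - g x)"
  define Gf where "Gf = (\<lambda>e x. G (x + e) - G x)"
  have f: "C2_with (f e) (gf e) (Gf e)" for e
    unfolding f_def gf_def Gf_def by (intro C2_with_diff C2_with_shift W)
  \<comment> \<open>Neither \<open>W\<close> nor its Hessian is bounded, but the Hessian of the
    increment \<open>f e\<close> is, by the Hoelder condition. A second difference of
    \<open>f e\<close> is therefore a bounded solution.\<close>
  define T where "T = (\<lambda>a b e x. f e (x + a + b) - f e (x + b) - f e (x + a) + f e x)"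
  have T_bound: "\<bar>T a b e x\<bar> \<le> norm a * norm b * (M * norm e powr \<alpha>)" for a b e x
  proof -
    obtain s s' where "f e (x + 1 *\<^sub>R a + 1 *\<^sub>R b) - f e (x + 1 *\<^sub>R b) - f e (x + 1 *\<^sub>R a) + f e x
        = 1 * (1 * (b \<bullet> (Gf e (x + s *\<^sub>R a + s' *\<^sub>R b) *v a)))"
      using C2_with_second_difference[OF f zero_less_one] by blast
    then have "\<bar>T a b e x\<bar> = \<bar>b \<bullet> (Gf e (x + s *\<^sub>R a + s' *\<^sub>R b) *v a)\<bar>"
      by (simp add: T_def)
    also have "\<dots> \<le> norm b * norm a * norm (Gf e (x + s *\<^sub>R a + s' *\<^sub>R b))"
      by (rule quadratic_form_le)
    also have "\<dots> \<le> norm b * norm a * (M * norm e powr \<alpha>)"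
      using hoelder[of "x + s *\<^sub>R a + s' *\<^sub>R b + e" "x + s *\<^sub>R a + s' *\<^sub>R b"]
      by (intro mult_left_mono) (auto simp: Gf_def)
    finally show ?thesis by (simp add: mult_ac)
  qed
  have T_const: "T a b e x = T a b e y" for a b e x y
  proof -
    let ?H = "\<lambda>x. Gf e (x + (a + b)) - Gf e (x + b) - Gf e (x + a) + Gf e x"
    have "C2_with (T a b e) (\<lambda>x. gf e (x + (a + b)) - gf e (x + b) - gf e (x + a) + gf e x) ?H"
      unfolding T_def add.assoc[of _ a b] by (intro C2_with_diff C2_with_add C2_with_shift f)
    moreover have "A \<bullet> ?H x = 0" for x
      by (simp add: Gf_def inner_diff_right inner_add_right eq)
    ultimately show ?thesis
      by (rule bounded_solution_constant[OF _ T_bound sym c ell])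
  qed
  have T_0: "T a b e x = 0" for a b e x
  proof (rule linear_le_powr_imp_zero[OF \<alpha>])
    fix n :: nat assume n: "n > 0"
    \<comment> \<open>The increment over \<open>n e\<close> telescopes into \<open>n\<close>
      increments over \<open>e\<close> at shifted points, and by \<open>T_const\<close> the shifts
      do not matter.\<close>
    have "T a b (real n *\<^sub>R e) y = real n * T a b e x" for n :: nat and y
    proof (induction n arbitrary: y)
      case 0
      show ?case by (simp add: T_def f_def)
    next
      case (Suc n)
      have "f (real (Suc n) *\<^sub>R e) z = f (real n *\<^sub>R e) (z + e) + f e z" for z
        by (simp add: f_def algebra_simps)
      then have "T a b (real (Suc n) *\<^sub>R e) y = T a b (real n *\<^sub>R e) (y + e) + T a b e y"
        by (simp add: T_def add.assoc add.left_commute add.commute)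
      then show ?case using Suc.IH[of "y+e"] T_const[of a b e y x] by (simp add: algebra_simps)
    qed
    then have "real n * \<bar>T a b e x\<bar> = \<bar>T a b (real n *\<^sub>R e) x\<bar>"
      by (simp add: abs_mult)
    also have "\<dots> \<le> norm a * norm b * (M * norm (real n *\<^sub>R e) powr \<alpha>)"
      by (rule T_bound)
    also have "\<dots> = (norm a * norm b * M * norm e powr \<alpha>) * real n powr \<alpha>"
      by (simp add: powr_mult)
    finally show "real n * \<bar>T a b e x\<bar> \<le> (norm a * norm b * M * norm e powr \<alpha>) * real n powr \<alpha>" .
  qed
  \<comment> \<open>With one of the increments read as the base point, \<open>T_0\<close> says that
    differences of \<open>f e\<close> do not depend on the base point. Hence \<open>gf e\<close> is
    constant and its derivative \<open>Gf e\<close> vanishes.\<close>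
  have "gf e (x + a) - gf e x = 0" for a x
  proof -
    have "f e (x + a) - f e x = f e a - f e 0" for x
      using T_0[of a x e 0] by (simp add: T_def add.commute)
    then have "C2_with (\<lambda>x. f e (x + a) - f e x) (\<lambda>x. 0) (\<lambda>x. 0)"
      using C2_with_const[of "f e a - f e 0"] by simp
    moreover have "C2_with (\<lambda>x. f e (x + a) - f e x) (\<lambda>x. gf e (x + a) - gf e x) (\<lambda>x. Gf e (x + a) - Gf e x)"
      by (intro C2_with_diff C2_with_shift f)
    ultimately show ?thesis by (drule_tac C2_with_unique(1)) (auto dest: fun_cong[of _ _ x])
  qed
  from this[of 0] have gf_const: "gf e = (\<lambda>x. gf e 0)" by (auto simp: fun_eq_iff)
  have "C2_with (f e) (gf e) (\<lambda>x. 0)"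
  proof (rule C2_withI)
    show "(gf e has_derivative (\<lambda>h. h v* 0)) (at x)" for x
      by (subst gf_const) (auto intro!: derivative_eq_intros simp: vector_matrix_mult_def vec_eq_iff)
  qed (use C2_with_deriv[OF f] in auto)
  from C2_with_unique(2)[OF this f] have "Gf e x = 0" by (metis (no_types))
  then show ?thesis by (simp add: Gf_def)
qed

section \<open>Compactness and blow-up\<close>

lemma continuous_on_UNIV_cballI:
  fixes f :: "'a::real_normed_vector \<Rightarrow> 'b::topological_space"
  assumes "\<And>R. continuous_on (cball 0 R) f"
  shows "continuous_on UNIV f"
proof -
  have "isCont f x" for x
  proof (rule continuous_on_interior)
    show "continuous_on (cball 0 (norm x + 1)) f" by (rule assms)
    show "x \<in> interior (cball 0 (norm x + 1))"
      by (rule interiorI[of "ball 0 (norm x + 1)"]) auto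
  qed
  then show ?thesis by (simp add: continuous_on_eq_continuous_at)
qed

text \<open>A diagonal sequence over the balls of integer radius. The limits on different balls
  agree because all of them are pointwise limits.\<close>

lemma Arzela_Ascoli_UNIV:
  fixes F :: "nat \<Rightarrow> 'a::euclidean_space \<Rightarrow> 'b::{real_normed_vector,heine_borel}"
  assumes bd: "\<And>R. \<exists>M. \<forall>n x. norm x \<le> R \<longrightarrow> norm (F n x) \<le> M"
    and equi: "\<And>x e. e > 0 \<Longrightarrow> \<exists>d>0. \<forall>n y. norm (x - y) < d \<longrightarrow> norm (F n x - F n y) < e"
  obtains f k where "continuous_on UNIV f" "strict_mono k"
    "\<And>R. uniform_limit (cball 0 R) (\<lambda>n. F (k n)) f sequentially"
proof -
  define P where "P = (\<lambda>(i::nat) (r::nat \<Rightarrow> nat). \<exists>g. \<forall>e>0. \<exists>N. \<forall>n\<ge>N. \<forall>x\<in>cball 0 (real i). norm (F (r n) x - g x) < e)"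
  have ex: "\<exists>k. strict_mono (k :: nat \<Rightarrow> nat) \<and> P i (r \<circ> k)" for i r
  proof -
    obtain M where M: "\<And>n x. norm x \<le> real i \<Longrightarrow> norm (F n x) \<le> M"
      using bd[of "real i"] by blast
    have equi': "\<exists>d. 0 < d \<and> (\<forall>n y. y \<in> cball 0 (real i) \<and> norm (x - y) < d \<longrightarrow> norm (F (r n) x - F (r n) y) < e)"
      if "0 < e" for x e
      using equi[OF that, of x] by blast
    obtain g k where "strict_mono (k :: nat \<Rightarrow> nat)"
      "\<And>e. 0 < e \<Longrightarrow> \<exists>N. \<forall>n x. n \<ge> N \<and> x \<in> cball 0 (real i) \<longrightarrow> norm (F (r (k n)) x - g x) < e"
      by (rule Arzela_Ascoli[of "cball 0 (real i)" "\<lambda>n. F (r n)" M])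
        (use M equi' in \<open>auto simp: \<close>)
    then show ?thesis unfolding P_def o_def by blast
  qed
  \<comment> \<open>Uniform convergence on a ball survives passing to a sequence that is a
    subsequence only from some index on, as the diagonal sequence is.\<close>
  have sub: "P i (r \<circ> k2)" if P1: "P i (r \<circ> k1)" and k12: "\<And>j. N \<le> j \<Longrightarrow> \<exists>j'. j \<le> j' \<and> k2 j = k1 j'"
    for i N and r k1 k2 :: "nat \<Rightarrow> nat"
  proof -
    obtain g where g: "\<And>e. e > 0 \<Longrightarrow> \<exists>N. \<forall>n\<ge>N. \<forall>x\<in>cball 0 (real i). norm (F (r (k1 n)) x - g x) < e"
      using P1 unfolding P_def o_def by blast
    have "\<exists>N. \<forall>n\<ge>N. \<forall>x\<in>cball 0 (real i). norm (F (r (k2 n)) x - g x) < e" if e: "e > 0" for e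
    proof -
      obtain N' where N': "\<And>n x. n \<ge> N' \<Longrightarrow> x\<in>cball 0 (real i) \<Longrightarrow> norm (F (r (k1 n)) x - g x) < e"
        using g[OF e] by blast
      show ?thesis
      proof (intro exI[of _ "max N N'"] allI impI ballI)
        fix n and x :: 'a assume n: "max N N' \<le> n" and x: "x \<in> cball 0 (real i)"
        obtain j' where "n \<le> j'" "k2 n = k1 j'" using k12[of n] n by auto
        then show "norm (F (r (k2 n)) x - g x) < e" using N'[OF _ x, of j'] n by simp
      qed
    qed
    then show ?thesis unfolding P_def o_def by blast
  qed
  have "\<exists>k. strict_mono (k :: nat \<Rightarrow> nat) \<and> (\<forall>i. P i (id \<circ> k))"
  proof (rule subsequence_diagonalization_lemma[where P=P and r=id])
    show "P i (r \<circ> k2)" if "P i (r \<circ> k1)" "\<And>j. N \<le> j \<Longrightarrow> \<exists>j'\<ge>j. k2 j = k1 j'"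
      for i N and r k1 k2 :: "nat \<Rightarrow> nat"
      using that by (rule sub)
  qed (use ex in auto)
  then obtain k where k: "strict_mono (k :: nat \<Rightarrow> nat)" "\<And>i. P i (id \<circ> k)"
    by blast
  then obtain g where g: "\<And>i e. e > 0 \<Longrightarrow> \<exists>N. \<forall>n\<ge>N. \<forall>x\<in>cball 0 (real i). norm (F (k n) x - g i x) < e"
    unfolding P_def by (simp add: o_def) metis
  have ul: "uniform_limit (cball 0 (real i)) (\<lambda>n. F (k n)) (g i) sequentially" for i
    unfolding uniform_limit_iff eventually_sequentially dist_norm using g by blast
  define f where "f x = lim (\<lambda>n. F (k n) x)" for x
  have fg: "f x = g i x" if "x \<in> cball 0 (real i)" for x i
    using tendsto_uniform_limitI[OF ul that] by (simp add: f_def limI)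
  have ulf: "uniform_limit (cball 0 R) (\<lambda>n. F (k n)) f sequentially" for R
  proof -
    obtain i where i: "R \<le> real i" using real_arch_simple by blast
    have "uniform_limit (cball 0 (real i)) (\<lambda>n. F (k n)) f sequentially"
      using ul[of i] by (rule uniform_limit_cong'[THEN iffD1, rotated 2]) (use fg in auto)
    then show ?thesis
      by (rule uniform_limit_on_subset) (use i in auto)
  qed
  have contF: "continuous_on UNIV (F n)" for n
    unfolding continuous_on_iff dist_norm
  proof (intro ballI allI impI)
    fix x and e :: real assume "e > 0"
    from equi[OF this, of x] obtain d where "d > 0" "\<And>n y. norm (x - y) < d \<Longrightarrow> norm (F n x - F n y) < e"
      by blast
    then show "\<exists>d>0. \<forall>y\<in>UNIV. norm (y - x) < d \<longrightarrow> norm (F n y - F n x) < e"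
      by (auto simp: norm_minus_commute intro!: exI[of _ d])
  qed
  have "\<forall>\<^sub>F n in sequentially. continuous_on (cball 0 R) (F (k n))" for R
    by (intro always_eventually allI continuous_on_subset[OF contF subset_UNIV])
  then have "continuous_on (cball 0 R) f" for R
    by (rule uniform_limit_theorem[OF _ ulf]) simp
  then have "continuous_on UNIV f"
    by (rule continuous_on_UNIV_cballI)
  then show ?thesis using k(1) ulf by (rule that)
qed

lemma has_derivative_locally_uniform_limit:
  fixes f :: "nat \<Rightarrow> 'a::euclidean_space \<Rightarrow> 'b::banach"
  assumes der: "\<And>n x. (f n has_derivative f' n x) (at x)"
    and lim: "\<And>x. (\<lambda>n. f n x) \<longlonglongrightarrow> g x"
    and unif: "\<And>R e. e > 0 \<Longrightarrow> \<forall>\<^sub>F n in sequentially. \<forall>x\<in>cball 0 R. \<forall>h. norm (f' n x h - g' x h) \<le> e * norm h"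
  shows "(g has_derivative g' x) (at x)"
proof -
  define R where "R = norm x + 1"
  have "\<exists>G. \<forall>y\<in>cball 0 R. (\<lambda>n. f n y) \<longlonglongrightarrow> G y \<and> (G has_derivative g' y) (at y within cball 0 R)"
    by (rule has_derivative_sequence[where f=f and f'=f' and ?x0.0=x and l="g x"])
      (use unif lim der in \<open>auto simp: R_def intro: has_derivative_at_withinI\<close>)
  then obtain G where G: "\<And>y. y \<in> cball 0 R \<Longrightarrow> (\<lambda>n. f n y) \<longlonglongrightarrow> G y"
    "\<And>y. y \<in> cball 0 R \<Longrightarrow> (G has_derivative g' y) (at y within cball 0 R)"
    by blast
  have eq: "G y = g y" if "y \<in> cball 0 R" for y
    using LIMSEQ_unique[OF G(1)[OF that] lim] .
  have x: "x \<in> interior (cball 0 R)" by (simp add: R_def)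
  have "(G has_derivative g' x) (at x)"
    using G(2)[of x] at_within_interior[OF x] by (simp add: R_def)
  then show ?thesis
    by (rule has_derivative_transform_within_open[of _ _ _ _ "interior (cball 0 R)"])
      (use x eq interior_subset in auto)
qed

lemma C2_with_limit:
  fixes w :: "nat \<Rightarrow> real^'d::finite \<Rightarrow> real"
  assumes C2: "\<And>n. C2_with (w n) (g n) (G n)"
    and w: "\<And>x. (\<lambda>n. w n x) \<longlonglongrightarrow> w' x"
    and g: "\<And>R. uniform_limit (cball 0 R) g g' sequentially"
    and G: "\<And>R. uniform_limit (cball 0 R) G G' sequentially"
  shows "C2_with w' g' G'"
proof (rule C2_withI)
  note d = C2_with_deriv[OF C2]
  have pt: "(\<lambda>n. g n x) \<longlonglongrightarrow> g' x" for x
    using tendsto_uniform_limitI[OF g[of "norm x"]] by simp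
  show "(w' has_derivative (\<lambda>h. g' x \<bullet> h)) (at x)" for x
  proof (rule has_derivative_locally_uniform_limit[OF d(1) w])
    fix R e :: real assume e: "e > 0"
    show "\<forall>\<^sub>F n in sequentially. \<forall>x\<in>cball 0 R. \<forall>h. norm (g n x \<bullet> h - g' x \<bullet> h) \<le> e * norm h"
      using uniform_limitD[OF g e, of R]
    proof eventually_elim
      case (elim n)
      have "norm (g n x \<bullet> h - g' x \<bullet> h) \<le> e * norm h" if "x \<in> cball 0 R" for x h
      proof -
        have "norm (g n x \<bullet> h - g' x \<bullet> h) \<le> norm (g n x - g' x) * norm h"
          by (metis Cauchy_Schwarz_ineq2 inner_diff_left real_norm_def)
        also have "\<dots> \<le> e * norm h"
          using elim that by (intro mult_right_mono) (auto simp: dist_norm intro: less_imp_le)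
        finally show ?thesis .
      qed
      then show ?case by blast
    qed
  qed
  show "(g' has_derivative (\<lambda>h. h v* G' x)) (at x)" for x
  proof (rule has_derivative_locally_uniform_limit[OF d(2) pt])
    fix R e :: real assume e: "e > 0"
    show "\<forall>\<^sub>F n in sequentially. \<forall>x\<in>cball 0 R. \<forall>h. norm (h v* G n x - h v* G' x) \<le> e * norm h"
      using uniform_limitD[OF G e, of R]
    proof eventually_elim
      case (elim n)
      have "norm (h v* G n x - h v* G' x) \<le> e * norm h" if "x \<in> cball 0 R" for x h
      proof -
        have "h v* G n x - h v* G' x = h v* (G n x - G' x)"
          by (simp add: vector_matrix_mult_def vec_eq_iff algebra_simps sum_subtractf)
        then have "norm (h v* G n x - h v* G' x) \<le> norm (G n x - G' x) * norm h"
          by (metis norm_vector_matrix_le)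
        also have "\<dots> \<le> e * norm h"
          using elim that by (intro mult_right_mono) (auto simp: dist_norm intro: less_imp_le)
        finally show ?thesis .
      qed
      then show ?case by blast
    qed
  qed
  have "continuous_on (cball 0 R) G'" for R
    by (intro uniform_limit_theorem[OF _ G] always_eventually allI continuous_on_subset[OF d(5)]) auto
  then show "continuous_on UNIV G'"
    by (rule continuous_on_UNIV_cballI)
qed

lemma equicontinuous_of_derivative_bound:
  fixes f :: "'i \<Rightarrow> 'a::euclidean_space \<Rightarrow> 'b::real_normed_vector"
  assumes der: "\<And>n x. (f n has_derivative f' n x) (at x)"
    and bd: "\<And>R. \<exists>M. \<forall>n x. norm x \<le> R \<longrightarrow> (\<forall>h. norm (f' n x h) \<le> M * norm h)"
    and 0: "\<And>n. norm (f n 0) \<le> M0"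
  shows "\<exists>M. \<forall>n x. norm x \<le> R \<longrightarrow> norm (f n x) \<le> M"
    "e > 0 \<Longrightarrow> \<exists>d>0. \<forall>n y. norm (x - y) < d \<longrightarrow> norm (f n x - f n y) < e"
proof -
  have lip: "\<exists>M>0. \<forall>n. \<forall>x\<in>cball 0 R. \<forall>y\<in>cball 0 R. norm (f n x - f n y) \<le> M * norm (x - y)" for R
  proof -
    obtain M where M: "\<And>n x h. norm x \<le> R \<Longrightarrow> norm (f' n x h) \<le> M * norm h" using bd by blast
    have M': "norm (f' n x h) \<le> (\<bar>M\<bar> + 1) * norm h" if "norm x \<le> R" for n x h
      using M[OF that, of n h] mult_right_mono[of M "\<bar>M\<bar> + 1" "norm h"] by (auto intro: order_trans)
    have "norm (f n x - f n y) \<le> (\<bar>M\<bar> + 1) * norm (x - y)" if "x \<in> cball 0 R" "y \<in> cball 0 R" for n x y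
    proof (rule differentiable_bound[of "cball 0 R" "f n" "f' n"])
      show "(f n has_derivative f' n z) (at z within cball 0 R)" for z
        using der by (rule has_derivative_at_withinI)
      show "onorm (f' n z) \<le> \<bar>M\<bar> + 1" if "z \<in> cball 0 R" for z
        using M' that by (intro onorm_bound) auto
    qed (use that in auto)
    then show ?thesis by (intro exI[of _ "\<bar>M\<bar> + 1"]) auto
  qed
  show "\<exists>M. \<forall>n x. norm x \<le> R \<longrightarrow> norm (f n x) \<le> M"
  proof (cases "R \<ge> 0")
    case True
    obtain M where M: "M > 0" "\<And>n x y. x \<in> cball 0 R \<Longrightarrow> y \<in> cball 0 R \<Longrightarrow> norm (f n x - f n y) \<le> M * norm (x - y)"
      using lip[of R] by blast
    have "norm (f n x) \<le> M * R + M0" if "norm x \<le> R" for n x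
    proof -
      have "norm (f n x) \<le> norm (f n x - f n 0) + norm (f n 0)"
        by (metis add.commute norm_triangle_sub)
      moreover have "norm (f n x - f n 0) \<le> M * norm x" using M(2)[of x 0 n] that True by simp
      moreover have "M * norm x \<le> M * R" using M(1) that by simp
      ultimately show ?thesis using 0[of n] by linarith
    qed
    then show ?thesis by blast
  next
    case False
    then show ?thesis by (meson norm_ge_zero order_trans)
  qed
  show "\<exists>d>0. \<forall>n y. norm (x - y) < d \<longrightarrow> norm (f n x - f n y) < e" if e: "e > 0"
  proof -
    obtain M where M: "M > 0" "\<And>n y z. y \<in> cball 0 (norm x + 1) \<Longrightarrow> z \<in> cball 0 (norm x + 1) \<Longrightarrow> norm (f n y - f n z) \<le> M * norm (y - z)"
      using lip[of "norm x + 1"] by blast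
    have "norm (f n x - f n y) < e" if "norm (x - y) < min 1 (e / M)" for n y
    proof -
      have "norm y \<le> norm x + norm (x - y)" by (metis norm_minus_commute norm_triangle_sub)
      then have "norm (f n x - f n y) \<le> M * norm (x - y)" using that by (intro M(2)) auto
      also have "\<dots> < e" using that M(1) by (simp add: field_simps)
      finally show ?thesis .
    qed
    then show ?thesis using M(1) e by (intro exI[of _ "min 1 (e/M)"]) auto
  qed
qed

text \<open>Functions and gradients are controlled at the origin only; the rest follows by
  integrating the Hessian. This suits the rescaled functions, which vanish with their gradients at 0
  but have no bound uniform on the whole space.\<close>

theorem C2_with_compactness:
  fixes w :: "nat \<Rightarrow> real^'d::finite \<Rightarrow> real"
  assumes C2: "\<And>n. C2_with (w n) (g n) (G n)"
    and w0: "\<And>n. \<bar>w n 0\<bar> \<le> M0" and g0: "\<And>n. norm (g n 0) \<le> M0"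
    and bd: "\<And>R. \<exists>M. \<forall>n x. norm x \<le> R \<longrightarrow> norm (G n x) \<le> M"
    and equi: "\<And>x e. e > 0 \<Longrightarrow> \<exists>d>0. \<forall>n y. norm (x - y) < d \<longrightarrow> norm (G n x - G n y) < e"
  obtains k w' g' G' where "strict_mono k" "C2_with w' g' G'"
    "\<And>R. uniform_limit (cball 0 R) (\<lambda>n. w (k n)) w' sequentially"
    "\<And>R. uniform_limit (cball 0 R) (\<lambda>n. g (k n)) g' sequentially"
    "\<And>R. uniform_limit (cball 0 R) (\<lambda>n. G (k n)) G' sequentially"
proof -
  note d = C2_with_deriv[OF C2]
  have "\<exists>M. \<forall>n x. norm x \<le> R \<longrightarrow> (\<forall>h. norm (h v* G n x) \<le> M * norm h)" for R
  proof -
    obtain M where "\<And>n x. norm x \<le> R \<Longrightarrow> norm (G n x) \<le> M" using bd by blast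
    then show ?thesis
      by (meson norm_vector_matrix_le mult_right_mono norm_ge_zero order_trans)
  qed
  note eg = equicontinuous_of_derivative_bound[OF d(2) this g0]
  have "\<exists>M. \<forall>n x. norm x \<le> R \<longrightarrow> (\<forall>h. norm (g n x \<bullet> h) \<le> M * norm h)" for R
  proof -
    obtain M where M: "\<And>n x. norm x \<le> R \<Longrightarrow> norm (g n x) \<le> M" using eg(1) by blast
    have "norm (g n x \<bullet> h) \<le> M * norm h" if "norm x \<le> R" for n x h
      using M[OF that, of n] mult_right_mono[of "norm (g n x)" M "norm h"] Cauchy_Schwarz_ineq2[of "g n x" h]
      by simp
    then show ?thesis by blast
  qed
  note ew = equicontinuous_of_derivative_bound[OF d(1) this, of M0] 
  \<comment> \<open>Bundling function, gradient and Hessian yields a single subsequence for all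
    three.\<close>
  define F where "F = (\<lambda>n x. (w n x, g n x, G n x))"
  have bdF: "\<exists>M. \<forall>n x. norm x \<le> R \<longrightarrow> norm (F n x) \<le> M" for R
  proof -
    obtain M1 where M1: "\<And>n x. norm x \<le> R \<Longrightarrow> norm (w n x) \<le> M1" using ew(1) w0 by (metis real_norm_def)
    obtain M2 where M2: "\<And>n x. norm x \<le> R \<Longrightarrow> norm (g n x) \<le> M2" using eg(1) by blast
    obtain M3 where M3: "\<And>n x. norm x \<le> R \<Longrightarrow> norm (G n x) \<le> M3" using bd by blast
    have "norm (F n x) \<le> M1 + (M2 + M3)" if "norm x \<le> R" for n x
      unfolding F_def using M1[OF that, of n] M2[OF that, of n] M3[OF that, of n]
      by (intro order_trans[OF norm_Pair_le] add_mono) auto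
    then show ?thesis by blast
  qed
  have equiF: "\<exists>d>0. \<forall>n y. norm (x - y) < d \<longrightarrow> norm (F n x - F n y) < e" if "e > 0" for x e
  proof -
    have e3: "e/3 > 0" using that by simp
    obtain d1 where d1: "d1 > 0" "\<And>n y. norm (x - y) < d1 \<Longrightarrow> norm (w n x - w n y) < e/3"
      using ew(2)[OF _ e3] w0 by (metis real_norm_def)
    obtain d2 where d2: "d2 > 0" "\<And>n y. norm (x - y) < d2 \<Longrightarrow> norm (g n x - g n y) < e/3"
      using eg(2)[OF e3] by blast
    obtain d3 where d3: "d3 > 0" "\<And>n y. norm (x - y) < d3 \<Longrightarrow> norm (G n x - G n y) < e/3"
      using equi[OF e3] by blast
    have "norm (F n x - F n y) < e" if "norm (x - y) < min d1 (min d2 d3)" for n y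
    proof -
      have "norm (F n x - F n y) \<le> norm (w n x - w n y) + (norm (g n x - g n y) + norm (G n x - G n y))"
        unfolding F_def by (auto intro!: order_trans[OF norm_Pair_le])
      then show ?thesis using d1(2)[of y n] d2(2)[of y n] d3(2)[of y n] that by linarith
    qed
    then show ?thesis using d1(1) d2(1) d3(1) by (intro exI[of _ "min d1 (min d2 d3)"]) auto
  qed
  obtain f k where "continuous_on UNIV f" and k: "strict_mono (k :: nat \<Rightarrow> nat)" and f: "\<And>R. uniform_limit (cball 0 R) (\<lambda>n. F (k n)) f sequentially"
    by (rule Arzela_Ascoli_UNIV[of F, OF bdF equiF], assumption, rule that)
  have 1: "uniform_limit (cball 0 R) (\<lambda>n. w (k n)) (\<lambda>x. fst (f x)) sequentially" for R
    using bounded_linear.uniform_limit[OF bounded_linear_fst f] by (simp add: F_def)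
  have 2: "uniform_limit (cball 0 R) (\<lambda>n. g (k n)) (\<lambda>x. fst (snd (f x))) sequentially" for R
    using bounded_linear.uniform_limit[OF bounded_linear_fst bounded_linear.uniform_limit[OF bounded_linear_snd f]]
    by (simp add: F_def)
  have 3: "uniform_limit (cball 0 R) (\<lambda>n. G (k n)) (\<lambda>x. snd (snd (f x))) sequentially" for R
    using bounded_linear.uniform_limit[OF bounded_linear_snd bounded_linear.uniform_limit[OF bounded_linear_snd f]]
    by (simp add: F_def)
  have "(\<lambda>n. w (k n) x) \<longlonglongrightarrow> fst (f x)" for x
    using tendsto_uniform_limitI[OF 1[of "norm x"]] by simp
  from C2_with_limit[OF C2 this 2 3] k 1 2 3 that show ?thesis by blast
qed

lemma ex_powr_less:
  fixes \<alpha> C e :: real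
  assumes "\<alpha> > 0" "e > 0"
  shows "\<exists>d>0. \<forall>t. 0 \<le> t \<and> t < d \<longrightarrow> C * t powr \<alpha> < e"
proof -
  define d where "d = (e / (\<bar>C\<bar> + 1)) powr (1 / \<alpha>)"
  have q: "e / (\<bar>C\<bar> + 1) > 0" using assms by simp
  have "C * t powr \<alpha> < e" if "0 \<le> t" "t < d" for t
  proof -
    have "t powr \<alpha> < d powr \<alpha>" using that assms by (intro powr_less_mono2) auto
    also have "d powr \<alpha> = e / (\<bar>C\<bar> + 1)" using q assms by (simp add: d_def powr_powr)
    finally have "(\<bar>C\<bar> + 1) * t powr \<alpha> < e" by (simp add: field_simps)
    moreover have "C * t powr \<alpha> \<le> (\<bar>C\<bar> + 1) * t powr \<alpha>" by (intro mult_right_mono) auto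
    ultimately show ?thesis by linarith
  qed
  moreover have "d > 0" unfolding d_def powr_gt_zero using q by linarith
  ultimately show ?thesis by blast
qed

lemma equicontinuous_of_Hoelder:
  fixes F :: "nat \<Rightarrow> 'a::real_normed_vector \<Rightarrow> 'b::real_normed_vector"
  assumes "\<alpha> > 0" "\<And>n x y. norm (F n x - F n y) \<le> B * norm (x - y) powr \<alpha>" "e > 0"
  shows "\<exists>d>0. \<forall>n y. norm (x - y) < d \<longrightarrow> norm (F n x - F n y) < e"
  using ex_powr_less[OF assms(1,3), of B] assms(2) by (meson le_less_trans norm_ge_zero)

text \<open>Every subsequence has a further one converging in C^2. Its limit function is prescribed
  by \<open>lim\<close>, and so are gradient and Hessian by \<open>C2_with_unique\<close>; therefore
  the full sequence converges.\<close>

lemma C2_with_convergence: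
  fixes w :: "nat \<Rightarrow> real^'d::finite \<Rightarrow> real"
  assumes C2: "\<And>n. C2_with (w n) (g n) (G n)"
    and w0: "\<And>n. \<bar>w n 0\<bar> \<le> M0" and g0: "\<And>n. norm (g n 0) \<le> M0"
    and bd: "\<And>n x. norm (G n x) \<le> M0"
    and equi: "\<And>x e. e > 0 \<Longrightarrow> \<exists>d>0. \<forall>n y. norm (x - y) < d \<longrightarrow> norm (G n x - G n y) < e"
    and lim: "\<And>x. (\<lambda>n. w n x) \<longlonglongrightarrow> w' x"
  obtains g' G' where "C2_with w' g' G'"
    "\<And>R. uniform_limit (cball 0 R) w w' sequentially"
    "\<And>R. uniform_limit (cball 0 R) g g' sequentially"
    "\<And>R. uniform_limit (cball 0 R) G G' sequentially"
proof -
  have sub: "\<exists>k g' G'. strict_mono (k :: nat \<Rightarrow> nat) \<and> C2_with w' g' G' \<and>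
      (\<forall>R. uniform_limit (cball 0 R) (\<lambda>n. w (m (k n))) w' sequentially \<and>
           uniform_limit (cball 0 R) (\<lambda>n. g (m (k n))) g' sequentially \<and>
           uniform_limit (cball 0 R) (\<lambda>n. G (m (k n))) G' sequentially)"
    if m: "\<And>i. i \<le> m i" for m :: "nat \<Rightarrow> nat"
  proof -
    have bd': "\<exists>M. \<forall>n x. norm x \<le> R \<longrightarrow> norm (G (m n) x) \<le> M" for R using bd by blast
    have equi': "\<exists>d>0. \<forall>n y. norm (x - y) < d \<longrightarrow> norm (G (m n) x - G (m n) y) < e" if "e > 0" for x e
      using equi[OF that, of x] by blast
    obtain k w'' g'' G'' where k: "strict_mono (k :: nat \<Rightarrow> nat)" "C2_with w'' g'' G''"
      "\<And>R. uniform_limit (cball 0 R) (\<lambda>n. w (m (k n))) w'' sequentially"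
      "\<And>R. uniform_limit (cball 0 R) (\<lambda>n. g (m (k n))) g'' sequentially"
      "\<And>R. uniform_limit (cball 0 R) (\<lambda>n. G (m (k n))) G'' sequentially"
      by (rule C2_with_compactness[of "\<lambda>n. w (m n)" "\<lambda>n. g (m n)" "\<lambda>n. G (m n)" M0,
            OF C2 w0 g0 bd' equi'], assumption, rule that)
    have "filterlim (\<lambda>n. m (k n)) at_top sequentially"
      by (rule filterlim_at_top_mono[OF filterlim_ident])
        (auto intro!: always_eventually order_trans[OF seq_suble[OF k(1)] m])
    then have "(\<lambda>n. w (m (k n)) x) \<longlonglongrightarrow> w' x" for x
      using lim filterlim_compose by blast
    moreover have "(\<lambda>n. w (m (k n)) x) \<longlonglongrightarrow> w'' x" for x
      using tendsto_uniform_limitI[OF k(3)[of "norm x"]] by simp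
    ultimately have "w'' = w'" using LIMSEQ_unique by blast
    then show ?thesis using k by blast
  qed
  obtain g' G' where C2': "C2_with w' g' G'" using sub[of id] by auto
  have "\<exists>N. \<forall>n\<ge>N. \<forall>x\<in>cball 0 R. norm (w n x - w' x) < e \<and> norm (g n x - g' x) < e \<and> norm (G n x - G' x) < e"
    if e: "e > 0" for R e
  proof (rule ccontr)
    assume "\<not> ?thesis"
    then have "\<forall>N. \<exists>n\<ge>N. \<exists>x\<in>cball 0 R. \<not> (norm (w n x - w' x) < e \<and> norm (g n x - g' x) < e \<and> norm (G n x - G' x) < e)"
      by blast
    then obtain m where m: "\<And>N. N \<le> m N" "\<And>N. \<exists>x\<in>cball 0 R.
        \<not> (norm (w (m N) x - w' x) < e \<and> norm (g (m N) x - g' x) < e \<and> norm (G (m N) x - G' x) < e)"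
      by metis
    obtain k g'' G'' where k: "C2_with w' g'' G''"
      "\<And>R. uniform_limit (cball 0 R) (\<lambda>n. w (m (k n))) w' sequentially"
      "\<And>R. uniform_limit (cball 0 R) (\<lambda>n. g (m (k n))) g'' sequentially"
      "\<And>R. uniform_limit (cball 0 R) (\<lambda>n. G (m (k n))) G'' sequentially"
      using sub[OF m(1)] by blast
    have eq: "g'' = g'" "G'' = G'" using C2_with_unique[OF k(1) C2'] .
    have "\<forall>\<^sub>F n in sequentially. \<forall>x\<in>cball 0 R. norm (w (m (k n)) x - w' x) < e
        \<and> norm (g (m (k n)) x - g' x) < e \<and> norm (G (m (k n)) x - G' x) < e"
      using uniform_limitD[OF k(2) e, of R] uniform_limitD[OF k(3) e, of R] uniform_limitD[OF k(4) e, of R]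
      by eventually_elim (auto simp: eq dist_norm)
    then obtain n where "\<forall>x\<in>cball 0 R. norm (w (m (k n)) x - w' x) < e
        \<and> norm (g (m (k n)) x - g' x) < e \<and> norm (G (m (k n)) x - G' x) < e"
      by (auto simp: eventually_sequentially)
    then show False using m(2)[of "k n"] by blast
  qed
  note conv = this
  show ?thesis
    by (rule that[OF C2']; unfold uniform_limit_iff eventually_sequentially dist_norm; use conv in meson)
qed

text \<open>The rescaled functions \<open>z \<mapsto> h\<^sup>-\<^sup>2\<^sup>-\<^sup>\<alpha> (w (x + h z) - T (h z))\<close>, with \<open>T\<close> the second order Taylor
  polynomial of \<open>w\<close> at \<open>x\<close>, converge along a subsequence to a function
  whose Hessian is constant by the Liouville theorem.\<close>

lemma Hoelder_blow_up:
  fixes w :: "nat \<Rightarrow> real^'d::finite \<Rightarrow> real" and A :: "real^'d^'d"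
  assumes C2: "\<And>k. C2_with (w k) (\<gamma> k) (D k)"
    and \<alpha>: "0 < \<alpha>" "\<alpha> < 1"
    and hoelder: "\<And>k x y. norm (D k x - D k y) \<le> B * norm (x - y) powr \<alpha>"
    and h: "\<And>k. h k > 0" and e: "e \<longlonglongrightarrow> e'" and \<epsilon>: "\<epsilon> > 0"
    and large: "\<And>k. \<epsilon> * h k powr \<alpha> \<le> norm (D k (x k + h k *\<^sub>R e k) - D k (x k))"
    and sym: "transpose A = A" and c: "c > 0" and ell: "\<And>\<xi>. c * (\<xi> \<bullet> \<xi>) \<le> \<xi> \<bullet> (A *v \<xi>)"
    and eq: "\<And>z. (\<lambda>k. A \<bullet> (h k powr - \<alpha> *\<^sub>R (D k (x k + h k *\<^sub>R z) - D k (x k)))) \<longlonglongrightarrow> 0"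
  shows False
proof -
  define Q where "Q k = D k (x k)" for k
  define H where "H k z = h k powr - \<alpha> *\<^sub>R (D k (x k + h k *\<^sub>R z) - D k (x k))" for k z
  \<comment> \<open>Two derivatives in \<open>z\<close> contribute \<open>(h k)\<^sup>2\<close>,
    which leaves the factor \<open>h k powr - \<alpha>\<close> on the Hessian. Under this scaling
    the Hoelder constant \<open>B\<close> of the Hessian is invariant.\<close>
  define \<kappa> where "\<kappa> k = h k powr (- 2 - \<alpha>)" for k
  define W where "W k z = \<kappa> k * (w k (x k + h k *\<^sub>R z) - w k (x k) - (h k *\<^sub>R \<gamma> k (x k)) \<bullet> z
    - (h k)\<^sup>2 / 2 * (z \<bullet> (Q k *v z)))" for k z
  define P where "P k z = \<kappa> k *\<^sub>R (h k *\<^sub>R \<gamma> k (x k + h k *\<^sub>R z) - 0 - h k *\<^sub>R \<gamma> k (x k)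
    - ((h k)\<^sup>2 / 2) *\<^sub>R 2 *\<^sub>R (Q k *v z))" for k z
  have WPH: "C2_with (W k) (P k) (H k)" for k
  proof -
    have "C2_with (W k) (P k) (\<lambda>z. \<kappa> k *\<^sub>R ((h k)\<^sup>2 *\<^sub>R D k (x k + h k *\<^sub>R z) - 0 - 0 - ((h k)\<^sup>2 / 2) *\<^sub>R 2 *\<^sub>R Q k))"
      unfolding W_def P_def
      by (intro C2_with_scaleR C2_with_diff C2_with_affine C2 C2_with_const C2_with_linear C2_with_quadratic)
        (simp add: Q_def C2_with_symmetric[OF C2])
    moreover have "\<kappa> k * (h k)\<^sup>2 = h k powr - \<alpha>"
      using h[of k] by (simp add: \<kappa>_def powr_diff powr_minus powr_realpow field_simps)
    then have "\<kappa> k *\<^sub>R ((h k)\<^sup>2 *\<^sub>R D k (x k + h k *\<^sub>R z) - 0 - 0 - ((h k)\<^sup>2 / 2) *\<^sub>R 2 *\<^sub>R Q k) = H k z" for z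
      by (simp add: H_def Q_def scaleR_diff_right)
    ultimately show ?thesis by (simp add: H_def[abs_def])
  qed
  have H_hoelder: "norm (H k z - H k z') \<le> B * norm (z - z') powr \<alpha>" for k z z'
  proof -
    have "norm (H k z - H k z') = h k powr - \<alpha> * norm (D k (x k + h k *\<^sub>R z) - D k (x k + h k *\<^sub>R z'))"
      by (simp add: H_def flip: scaleR_diff_right)
    also have "\<dots> \<le> h k powr - \<alpha> * (B * norm (h k *\<^sub>R (z - z')) powr \<alpha>)"
      using hoelder[of k "x k + h k *\<^sub>R z" "x k + h k *\<^sub>R z'"]
      by (intro mult_left_mono) (auto simp: scaleR_diff_right)
    also have "\<dots> = (h k powr - \<alpha> * h k powr \<alpha>) * (B * norm (z - z') powr \<alpha>)"
      using h[of k] by (simp add: powr_mult)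
    also have "h k powr - \<alpha> * h k powr \<alpha> = 1"
      using h[of k] by (simp flip: powr_add)
    finally show ?thesis by simp
  qed
  have H0: "H k 0 = 0" for k by (simp add: H_def)
  have W0: "W k 0 = 0" and P0: "P k 0 = 0" for k by (simp_all add: W_def P_def)
  have bd: "\<exists>M. \<forall>k z. norm z \<le> R \<longrightarrow> norm (H k z) \<le> M" for R
  proof -
    have "norm (H k z) \<le> \<bar>B\<bar> * R powr \<alpha>" if "norm z \<le> R" for k z
    proof -
      have "norm (H k z) \<le> B * norm z powr \<alpha>" using H_hoelder[of k z 0] by (simp add: H0)
      also have "\<dots> \<le> \<bar>B\<bar> * R powr \<alpha>" using that \<alpha> by (intro mult_mono powr_mono2) auto
      finally show ?thesis .
    qed
    then show ?thesis by blast
  qed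
  obtain l W' P' H' where l: "strict_mono (l :: nat \<Rightarrow> nat)" and C2': "C2_with W' P' H'"
    and "\<And>R. uniform_limit (cball 0 R) (\<lambda>n. W (l n)) W' sequentially"
      "\<And>R. uniform_limit (cball 0 R) (\<lambda>n. P (l n)) P' sequentially"
    and lim: "\<And>R. uniform_limit (cball 0 R) (\<lambda>n. H (l n)) H' sequentially"
    by (rule C2_with_compactness[of W P H 0, OF WPH _ _ bd equicontinuous_of_Hoelder[OF \<alpha>(1) H_hoelder]])
      (simp add: W0, simp add: P0, assumption, rule that)
  have pt: "(\<lambda>n. H (l n) z) \<longlonglongrightarrow> H' z" for z
    using tendsto_uniform_limitI[OF lim[of "norm z"]] by simp
  have H'_hoelder: "norm (H' z - H' z') \<le> B * norm (z - z') powr \<alpha>" for z z'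
    by (rule tendsto_upperbound[OF tendsto_norm[OF tendsto_diff[OF pt pt]]])
      (intro always_eventually allI H_hoelder, simp)
  have "A \<bullet> H' z = 0" for z
  proof -
    have "(\<lambda>n. A \<bullet> H (l n) z) \<longlonglongrightarrow> A \<bullet> H' z" by (intro tendsto_intros pt)
    moreover have "(\<lambda>n. A \<bullet> H (l n) z) \<longlonglongrightarrow> 0"
      using LIMSEQ_subseq_LIMSEQ[OF eq l] by (simp add: o_def H_def)
    ultimately show ?thesis using LIMSEQ_unique by blast
  qed
  then have "H' (0 + e') = H' 0"
    by (intro Liouville_Hoelder_Hessian[OF C2' \<alpha>(2) H'_hoelder sym c ell])
  moreover have "H' 0 = 0" using LIMSEQ_unique[OF pt[of 0]] by (simp add: H0)
  ultimately have "(\<lambda>n. H (l n) e') \<longlonglongrightarrow> 0" using pt[of e'] by simp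
  \<comment> \<open>The lower bound \<open>large\<close> holds in the moving directions
    \<open>e k\<close>, the Liouville theorem speaks of the limit direction; the uniform Hoelder
    bound bridges the two.\<close>
  moreover have "(\<lambda>n. H (l n) (e (l n)) - H (l n) e') \<longlonglongrightarrow> 0"
  proof (rule Lim_null_comparison)
    show "\<forall>\<^sub>F n in sequentially. norm (H (l n) (e (l n)) - H (l n) e') \<le> B * norm (e (l n) - e') powr \<alpha>"
      by (auto intro: always_eventually H_hoelder)
    have "(\<lambda>n. norm (e (l n) - e')) \<longlonglongrightarrow> 0"
      using LIMSEQ_subseq_LIMSEQ[OF e l] by (intro tendsto_norm_zero) (simp add: LIM_zero o_def)
    then have "(\<lambda>n. norm (e (l n) - e') powr \<alpha>) \<longlonglongrightarrow> 0"
      using \<alpha>(1) by (intro tendsto_zero_powrI[OF _ tendsto_const]) auto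
    then show "(\<lambda>n. B * norm (e (l n) - e') powr \<alpha>) \<longlonglongrightarrow> 0"
      using tendsto_mult_right_zero by blast
  qed
  ultimately have "(\<lambda>n. H (l n) (e (l n))) \<longlonglongrightarrow> 0"
    using tendsto_add[of "\<lambda>n. H (l n) (e (l n)) - H (l n) e'" 0 sequentially "\<lambda>n. H (l n) e'" 0] by simp
  then have "(\<lambda>n. norm (H (l n) (e (l n)))) \<longlonglongrightarrow> 0" by (rule tendsto_norm_zero)
  moreover have "\<epsilon> \<le> norm (H (l n) (e (l n)))" for n
  proof -
    have "h (l n) powr - \<alpha> * (\<epsilon> * h (l n) powr \<alpha>) \<le> norm (H (l n) (e (l n)))"
      using mult_left_mono[OF large[of "l n"], of "h (l n) powr - \<alpha>"] by (simp add: H_def)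
    moreover have "h (l n) powr - \<alpha> * h (l n) powr \<alpha> = 1"
      using h[of "l n"] by (simp flip: powr_add)
    ultimately show ?thesis by (simp add: mult.left_commute)
  qed
  ultimately have "\<epsilon> \<le> 0" by (intro tendsto_lowerbound) auto
  then show False using \<epsilon> by simp
qed

section \<open>Penalised maxima\<close>

text \<open>Outside the radius sqrt(2B/\<delta>) the penalty outweighs the oscillation of
  \<open>f\<close>, so a maximum exists. The second claim says that the gradient of the penalty at
  the maximum is of order sqrt \<delta>.\<close>

lemma penalised_max:
  fixes f :: "'a::euclidean_space \<Rightarrow> real"
  assumes f: "continuous_on UNIV f" "\<And>x. \<bar>f x\<bar> \<le> B" and \<delta>: "\<delta> > 0"
  obtains x where "\<And>y. f y - \<delta> * (y \<bullet> y) \<le> f x - \<delta> * (x \<bullet> x)" "\<delta> * norm x \<le> sqrt (2 * B * \<delta>)"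
proof -
  define R where "R = sqrt (2 * B / \<delta>)"
  have B: "B \<ge> 0" using f(2)[of 0] by linarith
  have R: "R \<ge> 0" using B \<delta> by (simp add: R_def)
  have "continuous_on (cball 0 R) (\<lambda>y. f y - \<delta> * (y \<bullet> y))"
    by (intro continuous_intros continuous_on_subset[OF f(1)]) auto
  moreover have "cball 0 R \<noteq> ({} :: 'a set)" using R by simp
  ultimately obtain x where x: "x \<in> cball 0 R" "\<And>y. y \<in> cball 0 R \<Longrightarrow> f y - \<delta> * (y \<bullet> y) \<le> f x - \<delta> * (x \<bullet> x)"
    using continuous_attains_sup[of "cball 0 R" "\<lambda>y. f y - \<delta> * (y \<bullet> y)"] by auto
  have max: "f y - \<delta> * (y \<bullet> y) \<le> f x - \<delta> * (x \<bullet> x)" for y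
  proof (cases "norm y \<le> R")
    case True
    then show ?thesis using x(2) by simp
  next
    case False
    then have "2 * B / \<delta> \<le> (norm y)\<^sup>2" unfolding R_def by (intro sqrt_le_D) simp
    then have "2 * B \<le> \<delta> * (y \<bullet> y)" using \<delta> by (simp add: power2_norm_eq_inner field_simps)
    then show ?thesis using x(2)[of 0] R f(2)[of y] f(2)[of 0] by (simp add: abs_le_iff)
  qed
  have "\<delta> * (x \<bullet> x) \<le> 2 * B" using max[of 0] f(2)[of x] f(2)[of 0] by (simp add: abs_le_iff)
  then have "(\<delta> * norm x)\<^sup>2 \<le> 2 * B * \<delta>"
    using \<delta> mult_left_mono[of "\<delta> * (x \<bullet> x)" "2 * B" \<delta>]
    by (simp add: power_mult_distrib power2_norm_eq_inner power2_eq_square[of \<delta>] mult_ac)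
  then have "\<delta> * norm x \<le> sqrt (2 * B * \<delta>)" by (rule real_le_rsqrt)
  with max that show ?thesis by blast
qed

text \<open>The maximum principle on an unbounded domain: \<open>\<delta>\<close> and
  \<open>\<delta> * norm x\<close> are the contributions of Hessian and gradient of the penalty, and
  both vanish in the limit \<delta> \<rightarrow> 0.\<close>

lemma nonpos_of_penalised_max:
  fixes f :: "'a::euclidean_space \<Rightarrow> real"
  assumes f: "continuous_on UNIV f" "\<And>x. \<bar>f x\<bar> \<le> B" and \<rho>: "\<rho> > 0" and C: "C \<ge> 0"
    and max: "\<And>\<delta> x. \<delta> > 0 \<Longrightarrow> (\<And>y. f y - \<delta> * (y \<bullet> y) \<le> f x - \<delta> * (x \<bullet> x)) \<Longrightarrow> \<rho> * f x \<le> C * (\<delta> + \<delta> * norm x)"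
  shows "f y \<le> 0"
proof -
  have le: "f y \<le> C / \<rho> * (\<delta> + sqrt (2 * B * \<delta>)) + \<delta> * (y \<bullet> y)" if \<delta>: "\<delta> > 0" for \<delta>
  proof -
    obtain x where x: "\<And>y. f y - \<delta> * (y \<bullet> y) \<le> f x - \<delta> * (x \<bullet> x)" "\<delta> * norm x \<le> sqrt (2 * B * \<delta>)"
      using penalised_max[OF f \<delta>] by blast
    have "\<rho> * f x \<le> C * (\<delta> + \<delta> * norm x)" by (rule max[OF \<delta> x(1)])
    also have "\<dots> \<le> C * (\<delta> + sqrt (2 * B * \<delta>))" using x(2) C by (intro mult_left_mono) auto
    finally have "f x \<le> C / \<rho> * (\<delta> + sqrt (2 * B * \<delta>))" using \<rho> by (simp add: field_simps)
    moreover have "0 \<le> \<delta> * (x \<bullet> x)" using \<delta> by simp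
    ultimately show ?thesis using x(1)[of y] by linarith
  qed
  define d where "d n = inverse (real (Suc n))" for n
  have d: "d \<longlonglongrightarrow> 0" unfolding d_def by (rule LIMSEQ_inverse_real_of_nat)
  have "(\<lambda>n. C / \<rho> * (d n + sqrt (2 * B * d n)) + d n * (y \<bullet> y)) \<longlonglongrightarrow> C / \<rho> * (0 + sqrt (2 * B * 0)) + 0 * (y \<bullet> y)"
    by (intro tendsto_intros d)
  moreover have "f y \<le> C / \<rho> * (d n + sqrt (2 * B * d n)) + d n * (y \<bullet> y)" for n
    by (rule le) (simp add: d_def)
  ultimately have "f y \<le> C / \<rho> * (0 + sqrt (2 * B * 0)) + 0 * (y \<bullet> y)"
    by (rule tendsto_lowerbound[OF _ always_eventually[OF allI] sequentially_bot])
  then show ?thesis by simp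
qed

section \<open>Hoelder norms of functions of class \<open>C\<^sup>2\<close>\<close>

lemma has_derivative_cart:
  fixes w :: "real^'d::finite \<Rightarrow> 'b::real_normed_vector"
  assumes "w differentiable (at x)"
  shows "(w has_derivative (\<lambda>h. \<Sum>i\<in>UNIV. h $ i *\<^sub>R partial i w x)) (at x)"
proof -
  have d: "(w has_derivative frechet_derivative w (at x)) (at x)"
    using assms frechet_derivative_works by blast
  then have lin: "linear (frechet_derivative w (at x))"
    by (simp add: has_derivative_linear)
  have "frechet_derivative w (at x) h = (\<Sum>i\<in>UNIV. h $ i *\<^sub>R partial i w x)" for h
  proof -
    have "frechet_derivative w (at x) h = frechet_derivative w (at x) (\<Sum>i\<in>UNIV. h $ i *\<^sub>R axis i 1)"
      by (simp add: basis_expansion flip: scalar_mult_eq_scaleR)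
    then show ?thesis
      by (simp add: linear_sum[OF lin] linear_scale[OF lin] partial_def)
  qed
  then have "frechet_derivative w (at x) = (\<lambda>h. \<Sum>i\<in>UNIV. h $ i *\<^sub>R partial i w x)" by (rule ext)
  with d show ?thesis by simp
qed

lemma has_derivative_vec_iff:
  fixes f :: "'a::real_normed_vector \<Rightarrow> real^'n::finite"
  shows "(f has_derivative f') (at x) \<longleftrightarrow> (\<forall>i. ((\<lambda>x. f x $ i) has_derivative (\<lambda>h. f' h $ i)) (at x))"
  by (subst has_derivative_componentwise_within) (auto simp: Basis_vec_def inner_axis)

text \<open>Passes from iterated partial derivatives to total derivatives. In
  \<open>partials [i, j]\<close> the direction \<open>j\<close> is differentiated first, in
  accordance with the row convention \<open>h v* G x\<close>.\<close>

lemma Ck_on_2_imp_C2_with: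
  assumes "Ck_on 2 UNIV w"
  shows "C2_with w (grad w) (hess w)"
proof (rule C2_withI)
  have d: "partials is w differentiable (at x)" if "length is < 2" for "is" x
    using assms that by (auto simp: Ck_on_def)
  have c: "continuous_on UNIV (partials is w)" if "length is \<le> 2" for "is"
    using assms that by (auto simp: Ck_on_def)
  show "(w has_derivative (\<lambda>h. grad w x \<bullet> h)) (at x)" for x
    using has_derivative_cart[of w x] d[of "[]" x]
    by (simp add: grad_def inner_vec_def mult.commute)
  show "(grad w has_derivative (\<lambda>h. h v* hess w x)) (at x)" for x
  proof -
    have "((\<lambda>x. grad w x $ j) has_derivative (\<lambda>h. (h v* hess w x) $ j)) (at x)" for j
      using has_derivative_cart[of "partials [j] w" x] d[of "[j]" x]
      by (simp add: grad_def hess_def vector_matrix_mult_def mult.commute)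
    then show ?thesis by (simp add: has_derivative_vec_iff)
  qed
  show "continuous_on UNIV (hess w)"
    unfolding hess_def by (intro continuous_on_vec_lambda c) auto
qed

lemma C2_with_partials:
  assumes "C2_with w g G"
  shows "partials [i] w = (\<lambda>x. g x $ i)" "partials [i, j] w = (\<lambda>x. G x $ i $ j)"
proof -
  note d = C2_with_deriv[OF assms]
  have g: "partial i w x = g x $ i" for i x
    using fun_cong[OF frechet_derivative_at[OF d(1)[of x]], of "axis i 1"] by (simp add: partial_def inner_axis)
  then show "partials [i] w = (\<lambda>x. g x $ i)" for i by auto
  have "partial i (\<lambda>x. g x $ j) x = G x $ i $ j" for x
  proof -
    have "((\<lambda>x. g x $ j) has_derivative (\<lambda>h. (h v* G x) $ j)) (at x)"
      using d(2)[of x] unfolding has_derivative_vec_iff by blast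
    from fun_cong[OF frechet_derivative_at[OF this], of "axis i 1"]
    have "partial i (\<lambda>x. g x $ j) x = (axis i 1 v* G x) $ j" by (simp add: partial_def)
    then show ?thesis
      by (simp add: vector_matrix_mult_def axis_def if_distrib[of "\<lambda>x. x * _"] cong: if_cong)
  qed
  moreover have "partial j w = (\<lambda>x. g x $ j)" using g by auto
  ultimately show "partials [i, j] w = (\<lambda>x. G x $ i $ j)" by auto
qed

lemma list_length_le_2_cases:
  assumes "length xs \<le> 2"
  obtains "xs = []" | i where "xs = [i]" | i j where "xs = [i, j]"
proof -
  have "length xs = 0 \<or> length xs = 1 \<or> length xs = 2" using assms by linarith
  then show ?thesis using that by (auto simp: length_Suc_conv numeral_2_eq_2)
qed

lemma C2_with_imp_Ck_on:
  assumes "C2_with w g G"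
  shows "Ck_on 2 V w"
  unfolding Ck_on_def
proof (intro conjI allI impI ballI)
  note d = C2_with_deriv[OF assms]
  have V: "continuous_on V f" if "continuous_on UNIV f" for f :: "real^'a \<Rightarrow> 'c::topological_space"
    using that by (rule continuous_on_subset) simp
  show "continuous_on V (partials is w)" if "length is \<le> 2" for "is"
    using that
  proof (cases rule: list_length_le_2_cases)
    case 1
    then show ?thesis using V[OF d(3)] by auto
  next
    case (2 i)
    then show ?thesis using C2_with_partials(1)[OF assms] V[OF d(4)]
      by (auto simp del: partials.simps intro!: continuous_intros)
  next
    case (3 i j)
    then show ?thesis using C2_with_partials(2)[OF assms] V[OF d(5)]
      by (auto simp del: partials.simps intro!: continuous_intros)
  qed
  show "partials is w differentiable at x" if "length is < 2" for "is" x
  proof (cases "is = []")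
    case True
    then show ?thesis using d(1) by (auto simp: differentiable_def)
  next
    case False
    then obtain i ys where "is = i # ys" by (cases "is") auto
    with that have i: "is = [i]" by simp
    have "((\<lambda>x. g x $ i) has_derivative (\<lambda>h. (h v* G x) $ i)) (at x)"
      using d(2)[of x] unfolding has_derivative_vec_iff by blast
    then show ?thesis unfolding i C2_with_partials(1)[OF assms] by (auto simp: differentiable_def)
  qed
qed

lemma C2_with_grad_hess:
  assumes "C2_with w g G"
  shows "grad w = g" "hess w = G"
  by (auto simp: grad_def hess_def C2_with_partials[OF assms] vec_eq_iff simp del: partials.simps)

text \<open>By continuity the set where the bound fails is open; being null, it is empty.\<close>

lemma Linf_norm_leD:
  fixes f :: "real^'d::finite \<Rightarrow> 'b::euclidean_space"
  assumes "Linf_norm V f \<le> ennreal K" "0 \<le> K" "open V" "continuous_on V f" "x \<in> V"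
  shows "infnorm (f x) \<le> K"
proof (rule ccontr)
  assume n: "\<not> infnorm (f x) \<le> K"
  define S where "S = {y \<in> V. infnorm (f y) > K}"
  have "open S"
    using continuous_open_preimage[OF continuous_on_infnorm[OF assms(4)] assms(3), of "{K<..}"]
    by (simp add: S_def vimage_def Int_def)
  moreover have "x \<in> S" using n assms(5) by (simp add: S_def)
  ultimately have "\<not> negligible S" using open_not_negligible by blast
  moreover have "AE y in lebesgue_on V. ennreal (infnorm (f y)) \<le> ennreal K"
    using esssup_AE[of "\<lambda>x. ennreal (infnorm (f x))" "lebesgue_on V"] assms(1)
    unfolding Linf_norm_def by (auto elim: eventually_mono)
  then have "AE y in lebesgue. y \<in> V \<longrightarrow> infnorm (f y) \<le> K"
    using assms(2,3) by (subst (asm) AE_restrict_space_iff) auto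
  then obtain N where "N \<in> null_sets lebesgue" "{y. \<not> (y \<in> V \<longrightarrow> infnorm (f y) \<le> K)} \<subseteq> N"
    by (auto elim!: eventually_ae_filter[THEN iffD1, THEN bexE])
  then have "negligible N" "S \<subseteq> N" by (auto simp: S_def negligible_iff_null_sets)
  then have "negligible S" by (rule negligible_subset)
  ultimately show False by blast
qed

text \<open>All terms of the norm are nonnegative, so each is bounded by the whole. Continuity
  enters the first claim because the supremum is an essential one.\<close>

lemma hoelder_norm_leD:
  fixes w :: "real^'d::finite \<Rightarrow> 'b::euclidean_space"
  assumes le: "hoelder_norm k \<alpha> V w \<le> ennreal K" and "0 \<le> K" "open V"
    and l: "length is \<le> k"
  shows "continuous_on V (partials is w) \<Longrightarrow> x \<in> V \<Longrightarrow> infnorm (partials is w x) \<le> K"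
    "x \<in> V \<Longrightarrow> y \<in> V \<Longrightarrow> dist x y \<le> 1 \<Longrightarrow> infnorm (partials is w x - partials is w y) \<le> K * dist x y powr \<alpha>"
proof -
  define j where "j = length is"
  let ?T = "\<lambda>j. (SUP is \<in> {is. length is = j}. Linf_norm V (partials is w)) + hoelder_seminorm j \<alpha> V w"
  have T: "?T j \<le> hoelder_norm k \<alpha> V w"
    unfolding hoelder_norm_def using l by (intro member_le_sum) (auto simp: j_def)
  have 1: "Linf_norm V (partials is w) \<le> ennreal K"
  proof -
    have "Linf_norm V (partials is w) \<le> (SUP is \<in> {is. length is = j}. Linf_norm V (partials is w))"
      by (rule SUP_upper) (simp add: j_def)
    also have "\<dots> \<le> ?T j" by simp
    finally show ?thesis using T le by order
  qed
  show "continuous_on V (partials is w) \<Longrightarrow> x \<in> V \<Longrightarrow> infnorm (partials is w x) \<le> K"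
    using Linf_norm_leD[OF 1] assms by blast
  assume xy: "x \<in> V" "y \<in> V" "dist x y \<le> 1"
  show "infnorm (partials is w x - partials is w y) \<le> K * dist x y powr \<alpha>"
  proof (cases "x = y")
    case True
    then show ?thesis by (simp add: infnorm_0)
  next
    case False
    let ?S = "{(x, y, is). x \<in> V \<and> y \<in> V \<and> 0 < dist x y \<and> dist x y \<le> 1 \<and> length is = j}"
    let ?f = "\<lambda>(x, y, is). ennreal (infnorm (partials is w x - partials is w y) / dist x y powr \<alpha>)"
    have "(x, y, is) \<in> ?S" using xy False by (simp add: j_def)
    then have "?f (x, y, is) \<le> hoelder_seminorm j \<alpha> V w"
      unfolding hoelder_seminorm_def by (rule SUP_upper)
    also have "\<dots> \<le> ?T j" by simp
    also note T
    also note le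
    finally have "ennreal (infnorm (partials is w x - partials is w y) / dist x y powr \<alpha>) \<le> ennreal K"
      by simp
    then show ?thesis using False assms(2) by (simp add: field_simps)
  qed
qed

lemma hoelder_norm_leI:
  fixes w :: "real^'d::finite \<Rightarrow> 'b::euclidean_space"
  assumes "open V" "0 \<le> \<epsilon>"
    and cont: "\<And>is. length is \<le> k \<Longrightarrow> continuous_on V (partials is w)"
    and sup: "\<And>is x. length is \<le> k \<Longrightarrow> x \<in> V \<Longrightarrow> norm (partials is w x) \<le> \<epsilon>"
    and hoel: "\<And>is x y. length is \<le> k \<Longrightarrow> x \<in> V \<Longrightarrow> y \<in> V \<Longrightarrow> dist x y \<le> 1 \<Longrightarrow>
      norm (partials is w x - partials is w y) \<le> \<epsilon> * dist x y powr \<alpha>"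
  shows "hoelder_norm k \<alpha> V w \<le> ennreal (2 * real (Suc k) * \<epsilon>)"
proof -
  have "(SUP is \<in> {is. length is = j}. Linf_norm V (partials is w)) + hoelder_seminorm j \<alpha> V w
      \<le> ennreal (2 * \<epsilon>)" if "j \<le> k" for j
  proof -
    have "Linf_norm V (partials is w) \<le> ennreal \<epsilon>" if "length is = j" for "is"
      unfolding Linf_norm_def
    proof (rule esssup_I)
      have "continuous_on V (\<lambda>x. infnorm (partials is w x))"
        using cont \<open>j \<le> k\<close> that by (intro continuous_on_infnorm) auto
      then have "(\<lambda>x. infnorm (partials is w x)) \<in> borel_measurable (lebesgue_on V)"
        using \<open>open V\<close> by (intro continuous_imp_measurable_on_sets_lebesgue) auto
      then show "(\<lambda>x. ennreal (infnorm (partials is w x))) \<in> borel_measurable (lebesgue_on V)"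
        by measurable
      have "infnorm (partials is w x) \<le> \<epsilon>" if "x \<in> V" for x
        using sup[of "is" x] infnorm_le_norm[of "partials is w x"] \<open>j \<le> k\<close> \<open>length is = j\<close> that by auto
      then show "AE x in lebesgue_on V. ennreal (infnorm (partials is w x)) \<le> ennreal \<epsilon>"
        by (intro AE_I2 ennreal_leI) auto
    qed
    moreover have "hoelder_seminorm j \<alpha> V w \<le> ennreal \<epsilon>"
      unfolding hoelder_seminorm_def
    proof (rule SUP_least, clarify, rule ennreal_leI)
      fix x y and "is" :: "'d list"
      assume *: "x \<in> V" "y \<in> V" "0 < dist x y" "dist x y \<le> 1" "j = length is"
      have "infnorm (partials is w x - partials is w y) \<le> \<epsilon> * dist x y powr \<alpha>"
        using hoel[of "is" x y] infnorm_le_norm[of "partials is w x - partials is w y"] * \<open>j \<le> k\<close> by auto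
      then show "infnorm (partials is w x - partials is w y) / dist x y powr \<alpha> \<le> \<epsilon>"
        using *(3) by (simp add: field_simps)
    qed
    ultimately have "(SUP is \<in> {is. length is = j}. Linf_norm V (partials is w)) + hoelder_seminorm j \<alpha> V w
      \<le> ennreal \<epsilon> + ennreal \<epsilon>"
      by (intro add_mono SUP_least) auto
    then show ?thesis using assms(2) by (simp flip: ennreal_plus)
  qed
  then have "hoelder_norm k \<alpha> V w \<le> (\<Sum>j\<le>k. ennreal (2 * \<epsilon>))"
    unfolding hoelder_norm_def by (intro sum_mono) auto
  also have "\<dots> = ennreal (\<Sum>j\<le>k. 2 * \<epsilon>)"
    using assms(2) by (intro sum_ennreal) auto
  also have "(\<Sum>j\<le>k. 2 * \<epsilon>) = 2 * real (Suc k) * \<epsilon>"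
    by simp
  finally show ?thesis .
qed

section \<open>Hoelder estimates from bounds on derivatives, and constants for Euclidean
  norms\<close>

lemma C2_with_lipschitz:
  assumes "C2_with w g G" "convex S" "\<And>x. x \<in> S \<Longrightarrow> norm (g x) \<le> B" "x \<in> S" "y \<in> S"
  shows "\<bar>w x - w y\<bar> \<le> B * norm (x - y)"
proof -
  have "norm (w x - w y) \<le> B * norm (x - y)"
  proof (rule differentiable_bound[of S w "\<lambda>x h. g x \<bullet> h"])
    show "(w has_derivative (\<lambda>h. g x \<bullet> h)) (at x within S)" for x
      using C2_with_deriv(1)[OF assms(1)] by (rule has_derivative_at_withinI)
    show "onorm (\<lambda>h. g x \<bullet> h) \<le> B" if "x \<in> S" for x
    proof (rule onorm_bound)
      show "norm (g x \<bullet> h) \<le> B * norm h" for h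
        using Cauchy_Schwarz_ineq2[of "g x" h] mult_right_mono[OF assms(3)[OF that] norm_ge_zero[of h]] by simp
      show "0 \<le> B" using assms(3)[OF that] norm_ge_zero[of "g x"] by linarith
    qed
  qed (use assms in auto)
  then show ?thesis by simp
qed

lemma C2_with_grad_lipschitz:
  assumes "C2_with w g G" "convex S" "\<And>x. x \<in> S \<Longrightarrow> norm (G x) \<le> B" "x \<in> S" "y \<in> S"
  shows "norm (g x - g y) \<le> B * norm (x - y)"
proof (rule differentiable_bound[of S g "\<lambda>x h. h v* G x"])
  show "(g has_derivative (\<lambda>h. h v* G x)) (at x within S)" for x
    using C2_with_deriv(2)[OF assms(1)] by (rule has_derivative_at_withinI)
  show "onorm (\<lambda>h. h v* G x) \<le> B" if "x \<in> S" for x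
  proof (rule onorm_bound)
    show "norm (h v* G x) \<le> B * norm h" for h
      using norm_vector_matrix_le[of h "G x"] mult_right_mono[OF assms(3)[OF that] norm_ge_zero[of h]] by linarith
    show "0 \<le> B" using assms(3)[OF that] norm_ge_zero[of "G x"] by linarith
  qed
qed (use assms in auto)

lemma norm_le_powr: "norm (x - y) \<le> norm (x - y) powr \<alpha>" if "norm (x - y) \<le> 1" "\<alpha> < 1"
  for x y :: "'a::real_normed_vector"
proof (cases "x = y")
  case False
  then show ?thesis using powr_mono'[of \<alpha> 1 "norm (x - y)"] that by simp
qed simp

text \<open>The seminorm tests only distances up to 1. Beyond that, the difference is at most
  \<open>2 * k\<close> while the power of the distance is at least 1.\<close>

lemma Hoelder_global:
  fixes f :: "'a::real_normed_vector \<Rightarrow> 'b::real_normed_vector"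
  assumes "0 < \<alpha>" and bd: "\<And>x. norm (f x) \<le> k"
    and loc: "norm (x - y) \<le> 1 \<Longrightarrow> norm (f x - f y) \<le> k * norm (x - y) powr \<alpha>"
  shows "norm (f x - f y) \<le> 2 * k * norm (x - y) powr \<alpha>"
proof -
  have k: "k \<ge> 0" using bd[of x] norm_ge_zero[of "f x"] by linarith
  show ?thesis
  proof (cases "norm (x - y) \<le> 1")
    case True
    have "k * norm (x - y) powr \<alpha> \<le> 2 * k * norm (x - y) powr \<alpha>"
      using k by (intro mult_right_mono) auto
    then show ?thesis using loc[OF True] by linarith
  next
    case False
    then have "1 \<le> norm (x - y) powr \<alpha>" using assms(1) by (intro ge_one_powr_ge_zero) auto
    then have "2 * k * 1 \<le> 2 * k * norm (x - y) powr \<alpha>" using k by (intro mult_left_mono) auto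
    moreover have "norm (f x - f y) \<le> k + k"
      using norm_triangle_ineq4[of "f x" "f y"] bd[of x] bd[of y] by linarith
    ultimately show ?thesis by linarith
  qed
qed

lemma Hoelder_of_Lipschitz:
  assumes "0 < \<alpha>" "\<alpha> < 1" "\<And>x. norm (f x) \<le> B" "norm (f x - f y) \<le> B * norm (x - y)"
  shows "norm (f x - f y) \<le> 2 * B * norm (x - y) powr \<alpha>"
proof (rule Hoelder_global[OF assms(1,3)])
  assume "norm (x - y) \<le> 1"
  moreover have "B \<ge> 0" using assms(3)[of x] norm_ge_zero[of "f x"] by linarith
  ultimately have "B * norm (x - y) \<le> B * norm (x - y) powr \<alpha>"
    using assms(2) by (intro mult_left_mono norm_le_powr)
  then show "norm (f x - f y) \<le> B * norm (x - y) powr \<alpha>" using assms(4) by linarith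
qed

lemma uniform_limit_moving_points:
  fixes f :: "'a \<Rightarrow> 'b::real_normed_vector"
  assumes "uniform_limit S F f sequentially" "filterlim m at_top sequentially" "\<And>k. x k \<in> S"
  shows "(\<lambda>k. norm (F (m k) (x k) - f (x k))) \<longlonglongrightarrow> 0"
proof (rule LIMSEQ_I)
  fix e :: real assume e: "e > 0"
  have "\<forall>\<^sub>F n in sequentially. \<forall>x\<in>S. dist (F n x) (f x) < e" by (rule uniform_limitD[OF assms(1) e])
  then have "\<forall>\<^sub>F k in sequentially. \<forall>x\<in>S. dist (F (m k) x) (f x) < e"
    using assms(2) by (rule eventually_compose_filterlim)
  then show "\<exists>N. \<forall>k\<ge>N. norm (norm (F (m k) (x k) - f (x k)) - 0) < e"
    using assms(3) by (auto simp: eventually_sequentially dist_norm)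
qed

lemma norm_matrix_le_entries:
  fixes X :: "real^'n::finite^'m::finite"
  assumes "\<And>i j. \<bar>X $ i $ j\<bar> \<le> k"
  shows "norm X \<le> real CARD('m) * real CARD('n) * k"
proof -
  have "norm (X $ i) \<le> real CARD('n) * k" for i
  proof -
    have "norm (X $ i) \<le> (\<Sum>j\<in>UNIV. \<bar>X $ i $ j\<bar>)" by (rule norm_le_l1_cart)
    also have "\<dots> \<le> (\<Sum>j\<in>(UNIV :: 'n set). k)" by (intro sum_mono assms)
    finally show ?thesis by simp
  qed
  then have "(\<Sum>i\<in>UNIV. norm (X $ i)) \<le> (\<Sum>i\<in>(UNIV :: 'm set). real CARD('n) * k)"
    by (intro sum_mono)
  moreover have "norm X \<le> (\<Sum>i\<in>UNIV. norm (X $ i))"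
    unfolding norm_vec_def by (rule L2_set_le_sum) simp
  ultimately show ?thesis by (simp add: mult.assoc)
qed

lemma hoelder_norm_0_bounds:
  fixes f :: "real^'d::finite \<Rightarrow> 'b::euclidean_space"
  assumes le: "hoelder_norm 0 \<alpha> UNIV f \<le> ennreal k" and k: "0 \<le> k" and \<alpha>: "0 < \<alpha>"
  shows "norm (f x) \<le> sqrt DIM('b) * k"
    "norm (f x - f y) \<le> 2 * (sqrt DIM('b) * k) * norm (x - y) powr \<alpha>"
proof -
  define s where "s = sqrt DIM('b)"
  have s: "s \<ge> 0" by (simp add: s_def)
  have loc: "norm (f x - f y) \<le> s * k * norm (x - y) powr \<alpha>" if "norm (x - y) \<le> 1" for x y
  proof -
    have "infnorm (f x - f y) \<le> k * norm (x - y) powr \<alpha>"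
      using hoelder_norm_leD(2)[OF le k, of "[]" x y] that by (simp add: dist_norm)
    then have "s * infnorm (f x - f y) \<le> s * (k * norm (x - y) powr \<alpha>)" using s by (rule mult_left_mono)
    then show ?thesis using norm_le_infnorm[of "f x - f y", folded s_def] by (simp add: mult.assoc)
  qed
  \<comment> \<open>Continuity has to be derived from the Hoelder estimate itself: the coefficients
    come with a finite norm only, and without continuity an essential supremum gives no pointwise
    bound.\<close>
  have "continuous_on UNIV f"
    unfolding continuous_on_iff
  proof (intro ballI allI impI)
    fix x :: "real^'d" and e :: real assume "e > 0"
    then obtain d where d: "d > 0" "\<And>t. 0 \<le> t \<Longrightarrow> t < d \<Longrightarrow> s * k * t powr \<alpha> < e"
      using ex_powr_less[OF \<alpha>] by blast
    have "dist (f y) (f x) < e" if "dist y x < min d 1" for y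
      using loc[of y x] d(2)[of "norm (y - x)"] that by (simp add: dist_norm)
    then show "\<exists>d>0. \<forall>y\<in>UNIV. dist y x < d \<longrightarrow> dist (f y) (f x) < e"
      using d(1) by (intro exI[of _ "min d 1"]) auto
  qed
  then have "infnorm (f x) \<le> k" for x
    using hoelder_norm_leD(1)[OF le k, of "[]" x] by simp
  then have "s * infnorm (f x) \<le> s * k" for x using s by (rule mult_left_mono)
  then have bd: "norm (f x) \<le> s * k" for x using norm_le_infnorm[of "f x", folded s_def] order_trans by blast
  show "norm (f x) \<le> sqrt DIM('b) * k" using bd by (simp add: s_def)
  have "norm (f x - f y) \<le> 2 * (s * k) * norm (x - y) powr \<alpha>"
    by (rule Hoelder_global[OF \<alpha> bd loc])
  then show "norm (f x - f y) \<le> 2 * (sqrt DIM('b) * k) * norm (x - y) powr \<alpha>"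
    by (simp add: s_def)
qed

lemma infnorm_real: "infnorm x = \<bar>x\<bar>" for x :: real
  by (simp add: infnorm_def)

text \<open>The square of the dimension passes from entries to the norm of a matrix, the factor 2
  from distances up to 1 to all distances. One constant serves all four estimates.\<close>

lemma hoelder_norm_2_bounds:
  fixes w :: "real^'d::finite \<Rightarrow> real"
  assumes C2: "C2_with w g G" and le: "hoelder_norm 2 \<alpha> UNIV w \<le> ennreal k" and k: "0 \<le> k" and \<alpha>: "0 < \<alpha>"
  defines "B \<equiv> 2 * (real CARD('d) * real CARD('d) * k)"
  shows "\<bar>w x\<bar> \<le> B" "norm (g x) \<le> B" "norm (G x) \<le> B" "norm (G x - G y) \<le> B * norm (x - y) powr \<alpha>"
proof -
  have cont: "continuous_on UNIV (partials is w)" if "length is \<le> 2" for "is"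
    using C2_with_imp_Ck_on[OF C2] that by (simp add: Ck_on_def)
  define d where "d = real CARD('d)"
  have d: "d \<ge> 1" by (simp add: d_def Suc_leI)
  have d1: "1 \<le> d * d" using mult_mono[of 1 d 1 d] d by simp
  have kd: "k \<le> 2 * (d * d * k)" "d * k \<le> 2 * (d * d * k)" "d * d * k \<le> 2 * (d * d * k)"
  proof -
    have "0 \<le> d * k" using d k by simp
    then have "1 * k \<le> d * d * k" "1 * (d * k) \<le> d * (d * k)"
      using mult_right_mono[OF d1 k] mult_right_mono[OF d] by auto
    then show "k \<le> 2 * (d * d * k)" "d * k \<le> 2 * (d * d * k)" "d * d * k \<le> 2 * (d * d * k)"
      using k d by (auto simp: mult.assoc)
  qed
  note bds = hoelder_norm_leD(1)[OF le k open_UNIV]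
  have "\<bar>w x\<bar> \<le> k" using bds[of "[]" x] cont[of "[]"] by (simp add: infnorm_real)
  then show "\<bar>w x\<bar> \<le> B" using kd(1) by (simp add: B_def d_def)
  have g: "\<bar>g x $ i\<bar> \<le> k" for i
    using bds[of "[i]" x] cont[of "[i]"] unfolding C2_with_partials[OF C2] by (simp add: infnorm_real)
  have "norm (g x) \<le> (\<Sum>i\<in>UNIV. \<bar>g x $ i\<bar>)" by (rule norm_le_l1_cart)
  also have "\<dots> \<le> (\<Sum>i\<in>(UNIV :: 'd set). k)" by (intro sum_mono g)
  finally have "norm (g x) \<le> d * k" by (simp add: d_def)
  then show "norm (g x) \<le> B" using kd(2) unfolding B_def d_def[symmetric] by (rule order_trans)
  have "\<bar>G x $ i $ j\<bar> \<le> k" for i j x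
    using bds[of "[i, j]" x] cont[of "[i, j]"] unfolding C2_with_partials[OF C2] by (simp add: infnorm_real)
  from this have Gb: "norm (G x) \<le> d * d * k" for x
    unfolding d_def by (rule norm_matrix_le_entries)
  show "norm (G x) \<le> B" using order_trans[OF Gb kd(3)] by (simp only: B_def d_def)
  have loc: "norm (G x - G y) \<le> d * d * k * norm (x - y) powr \<alpha>" if "norm (x - y) \<le> 1" for x y
  proof -
    have "\<bar>(G x - G y) $ i $ j\<bar> \<le> k * norm (x - y) powr \<alpha>" for i j
      using hoelder_norm_leD(2)[OF le k open_UNIV, of "[i, j]" x y] that unfolding C2_with_partials[OF C2]
      by (simp add: infnorm_real dist_norm)
    then show ?thesis using norm_matrix_le_entries[of "G x - G y"] by (simp add: d_def mult.assoc)
  qed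
  have "norm (G x - G y) \<le> 2 * (d * d * k) * norm (x - y) powr \<alpha>"
    by (rule Hoelder_global[OF \<alpha> Gb loc])
  then show "norm (G x - G y) \<le> B * norm (x - y) powr \<alpha>"
    by (simp only: B_def d_def)
qed

text \<open>On a convex set the seminorms of order 0 and 1 follow from the mean value inequality, so
  only the Hessian needs a Hoelder hypothesis. The 6 counts a supremum and a seminorm for each of
  three orders.\<close>

lemma C2_with_hoelder_norm_le:
  fixes w :: "real^'d::finite \<Rightarrow> real"
  assumes C2: "C2_with w g G" and V: "open V" "convex V" and \<epsilon>: "0 \<le> \<epsilon>" and \<alpha>: "\<alpha> < 1"
    and w: "\<And>x. x \<in> V \<Longrightarrow> \<bar>w x\<bar> \<le> \<epsilon>" and g: "\<And>x. x \<in> V \<Longrightarrow> norm (g x) \<le> \<epsilon>"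
    and G: "\<And>x. x \<in> V \<Longrightarrow> norm (G x) \<le> \<epsilon>"
    and hoelder: "\<And>x y. x \<in> V \<Longrightarrow> y \<in> V \<Longrightarrow> norm (G x - G y) \<le> \<epsilon> * norm (x - y) powr \<alpha>"
  shows "hoelder_norm 2 \<alpha> V w \<le> ennreal (6 * \<epsilon>)"
proof -
  have "hoelder_norm 2 \<alpha> V w \<le> ennreal (2 * real (Suc 2) * \<epsilon>)"
  proof (rule hoelder_norm_leI[OF V(1) \<epsilon>])
    show "continuous_on V (partials is w)" if "length is \<le> 2" for "is"
      using C2_with_imp_Ck_on[OF C2, of V] that by (simp add: Ck_on_def)
    have entry: "\<bar>X $ i $ j\<bar> \<le> norm X" for X :: "real^'d^'d" and i j
      using component_le_norm_cart[of "X $ i" j] Finite_Cartesian_Product.norm_nth_le[of X i] by linarith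
    show "norm (partials is w x) \<le> \<epsilon>" if "length is \<le> 2" "x \<in> V" for "is" x
      using that(1)
    proof (cases rule: list_length_le_2_cases)
      case 1
      then show ?thesis using w[OF that(2)] by simp
    next
      case (2 i)
      then show ?thesis using g[OF that(2)] component_le_norm_cart[of "g x" i]
        unfolding 2 C2_with_partials[OF C2] by simp
    next
      case (3 i j)
      then show ?thesis using G[OF that(2)] entry[of "G x" i j]
        unfolding 3 C2_with_partials[OF C2] by simp
    qed
    show "norm (partials is w x - partials is w y) \<le> \<epsilon> * dist x y powr \<alpha>"
      if "length is \<le> 2" "x \<in> V" "y \<in> V" "dist x y \<le> 1" for "is" x y
    proof -
      have "\<epsilon> * norm (x - y) \<le> \<epsilon> * norm (x - y) powr \<alpha>"
        using norm_le_powr[of x y \<alpha>] that \<alpha> \<epsilon> by (intro mult_left_mono) (auto simp: dist_norm)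
      then have le: "a \<le> \<epsilon> * dist x y powr \<alpha>" if "a \<le> \<epsilon> * norm (x - y)" for a :: real
        using that by (simp add: dist_norm)
      show ?thesis using that(1)
      proof (cases rule: list_length_le_2_cases)
        case 1
        have "\<bar>w x - w y\<bar> \<le> \<epsilon> * norm (x - y)"
          by (rule C2_with_lipschitz[OF C2 V(2)]) (use g that in auto)
        from le[OF this] show ?thesis using 1 by simp
      next
        case (2 i)
        have "norm (g x $ i - g y $ i) \<le> norm (g x - g y)"
          using component_le_norm_cart[of "g x - g y" i] by simp
        also have "norm (g x - g y) \<le> \<epsilon> * dist x y powr \<alpha>"
          by (rule le, rule C2_with_grad_lipschitz[OF C2 V(2)]) (use G that in auto)
        finally show ?thesis unfolding 2 C2_with_partials[OF C2] .
      next
        case (3 i j)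
        have "norm (G x $ i $ j - G y $ i $ j) \<le> norm (G x - G y)"
          using entry[of "G x - G y" i j] by simp
        also have "\<dots> \<le> \<epsilon> * dist x y powr \<alpha>"
          using hoelder[OF that(2,3)] by (simp add: dist_norm)
        finally show ?thesis unfolding 3 C2_with_partials[OF C2] .
      qed
    qed
  qed
  then show ?thesis by simp
qed

lemma tendsto_0_ennrealI:
  fixes f :: "nat \<Rightarrow> ennreal"
  assumes "\<And>\<epsilon>. \<epsilon> > 0 \<Longrightarrow> \<forall>\<^sub>F n in sequentially. f n \<le> ennreal \<epsilon>"
  shows "f \<longlonglongrightarrow> 0"
proof (rule order_tendstoI)
  fix a :: ennreal assume "0 < a"
  then obtain z where z: "0 < z" "z < a" using dense by blast
  then obtain \<epsilon> where \<epsilon>: "z = ennreal \<epsilon>" "\<epsilon> \<ge> 0" by (cases z) (auto simp: top_unique)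
  then have "\<epsilon> > 0" using z(1) by simp
  from assms[OF this] show "\<forall>\<^sub>F n in sequentially. f n < a"
    by eventually_elim (use z \<epsilon> in auto)
qed simp

section \<open>Gibbs densities\<close>

context prob_space
begin

definition partition_fun :: "('a \<Rightarrow> real) \<Rightarrow> real"
  where "partition_fun \<theta> = (\<integral>u. exp (\<theta> u) \<partial>M)"

definition gibbs :: "('a \<Rightarrow> real) \<Rightarrow> 'a \<Rightarrow> real"
  where "gibbs \<theta> u = exp (\<theta> u) / partition_fun \<theta>"

text \<open>On a probability space this class is contained in the integrable functions, and it is
  closed under differences, products and exponentials; it thus settles all integrability conditions
  on Gibbs densities. The bound holds everywhere on the space, not only almost everywhere.\<close>

definition bdd_meas :: "('a \<Rightarrow> 'b::{banach, second_countable_topology}) \<Rightarrow> bool"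
  where "bdd_meas f \<longleftrightarrow> f \<in> borel_measurable M \<and> (\<exists>H. \<forall>u\<in>space M. norm (f u) \<le> H)"

lemma bdd_measI: "f \<in> borel_measurable M \<Longrightarrow> (\<And>u. u \<in> space M \<Longrightarrow> norm (f u) \<le> H) \<Longrightarrow> bdd_meas f"
  by (auto simp: bdd_meas_def)

lemma bdd_meas_measurable [measurable_dest]: "bdd_meas f \<Longrightarrow> f \<in> borel_measurable M"
  by (simp add: bdd_meas_def)

lemma bdd_meas_integrable: "bdd_meas f \<Longrightarrow> integrable M f"
  unfolding bdd_meas_def using integrable_const_bound[of f] by (auto intro!: AE_I2)

lemma bdd_meas_exp: "bdd_meas \<theta> \<Longrightarrow> bdd_meas (\<lambda>u. exp (\<theta> u))" for \<theta> :: "'a \<Rightarrow> real"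
proof -
  assume "bdd_meas \<theta>"
  then obtain H where "\<theta> \<in> borel_measurable M" and "\<And>u. u \<in> space M \<Longrightarrow> norm (\<theta> u) \<le> H"
    by (auto simp: bdd_meas_def)
  then show ?thesis by (intro bdd_measI[where H="exp H"]) force+
qed

lemma bdd_meas_diff: "bdd_meas f \<Longrightarrow> bdd_meas g \<Longrightarrow> bdd_meas (\<lambda>u. f u - g u)"
proof -
  assume *: "bdd_meas f" "bdd_meas g"
  then obtain H K where "\<And>u. u \<in> space M \<Longrightarrow> norm (f u) \<le> H" "\<And>u. u \<in> space M \<Longrightarrow> norm (g u) \<le> K"
    by (auto simp: bdd_meas_def)
  then show ?thesis using *
    by (intro bdd_measI[where H="H+K"]) (auto intro!: borel_measurable_diff norm_triangle_le_diff add_mono simp: bdd_meas_measurable)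
qed

lemma bdd_meas_scaleR: "bdd_meas f \<Longrightarrow> bdd_meas g \<Longrightarrow> bdd_meas (\<lambda>u. f u *\<^sub>R g u)"
proof -
  assume *: "bdd_meas f" "bdd_meas g"
  then obtain H K where "\<And>u. u \<in> space M \<Longrightarrow> norm (f u) \<le> H" "\<And>u. u \<in> space M \<Longrightarrow> norm (g u) \<le> K"
    by (auto simp: bdd_meas_def)
  then have "norm (f u) * norm (g u) \<le> H * K" if "u \<in> space M" for u
    using that by (intro mult_mono) (auto intro: order_trans[OF norm_ge_zero[of "f u"]])
  then show ?thesis using *
    by (intro bdd_measI[where H="H*K"]) (auto intro!: borel_measurable_scaleR simp: bdd_meas_measurable)
qed

lemma bdd_meas_mult: "bdd_meas f \<Longrightarrow> bdd_meas g \<Longrightarrow> bdd_meas (\<lambda>u. f u * g u)" for f g :: "'a \<Rightarrow> real"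
  using bdd_meas_scaleR[of f g] by simp

lemma bdd_meas_const: "bdd_meas (\<lambda>u. c)"
  by (auto simp: bdd_meas_def)

lemma partition_fun_pos:
  assumes "bdd_meas \<theta>"
  shows "partition_fun \<theta> > 0"
proof -
  obtain H where H: "\<And>u. u \<in> space M \<Longrightarrow> norm (\<theta> u) \<le> H" using assms by (auto simp: bdd_meas_def)
  have "exp (- H) = (\<integral>u. exp (- H) \<partial>M)" by (simp add: prob_space)
  also have "\<dots> \<le> partition_fun \<theta>" unfolding partition_fun_def
    using H by (intro integral_mono bdd_meas_integrable bdd_meas_exp bdd_meas_const assms) force
  finally show ?thesis by (rule less_le_trans[OF exp_gt_zero])
qed

lemma bdd_meas_gibbs: "bdd_meas \<theta> \<Longrightarrow> bdd_meas (gibbs \<theta>)"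
  using bdd_meas_mult[OF bdd_meas_exp bdd_meas_const[of "1 / partition_fun \<theta>"]]
  by (simp add: gibbs_def[abs_def])

lemma gibbs_pos: "bdd_meas \<theta> \<Longrightarrow> gibbs \<theta> u > 0"
  by (simp add: gibbs_def partition_fun_pos)

lemma gibbs_integral: "bdd_meas \<theta> \<Longrightarrow> (\<integral>u. gibbs \<theta> u \<partial>M) = 1"
  using partition_fun_pos[of \<theta>] by (simp add: gibbs_def[abs_def] partition_fun_def)

lemma ln_gibbs: "bdd_meas \<theta> \<Longrightarrow> ln (gibbs \<theta> u) = \<theta> u - ln (partition_fun \<theta>)"
  using partition_fun_pos[of \<theta>] by (simp add: gibbs_def ln_div)

section \<open>Dependence of Gibbs densities on the exponent\<close>

lemma partition_fun_ratio:
  assumes \<theta>: "bdd_meas \<theta>" "bdd_meas \<theta>'" and le: "\<And>u. u \<in> space M \<Longrightarrow> \<theta> u \<le> \<theta>' u + \<epsilon>"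
  shows "partition_fun \<theta> \<le> exp \<epsilon> * partition_fun \<theta>'"
proof -
  have "partition_fun \<theta> \<le> (\<integral>u. exp \<epsilon> * exp (\<theta>' u) \<partial>M)"
    unfolding partition_fun_def using le
    by (intro integral_mono bdd_meas_integrable bdd_meas_exp bdd_meas_mult bdd_meas_const \<theta>)
      (auto simp flip: exp_add simp: add.commute)
  then show ?thesis by (simp add: partition_fun_def)
qed

lemma ln_partition_fun_le:
  assumes \<theta>: "bdd_meas \<theta>" "bdd_meas \<theta>'" and le: "\<And>u. u \<in> space M \<Longrightarrow> \<theta> u \<le> \<theta>' u + \<epsilon>"
  shows "ln (partition_fun \<theta>) \<le> ln (partition_fun \<theta>') + \<epsilon>"
proof -
  have "ln (partition_fun \<theta>) \<le> ln (exp \<epsilon> * partition_fun \<theta>')"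
    using partition_fun_ratio[OF assms] partition_fun_pos[OF \<theta>(1)] partition_fun_pos[OF \<theta>(2)]
    by (intro ln_mono) auto
  also have "\<dots> = ln (partition_fun \<theta>') + \<epsilon>"
    using partition_fun_pos[OF \<theta>(2)] by (simp add: ln_mult)
  finally show ?thesis .
qed

text \<open>Raising the exponent by a constant \<epsilon> multiplies the partition function by exp
  \<epsilon>, and the partition function is monotone in the exponent.\<close>

lemma ln_partition_fun_lipschitz:
  assumes "bdd_meas \<theta>" "bdd_meas \<theta>'" "\<And>u. u \<in> space M \<Longrightarrow> \<bar>\<theta> u - \<theta>' u\<bar> \<le> \<epsilon>"
  shows "\<bar>ln (partition_fun \<theta>) - ln (partition_fun \<theta>')\<bar> \<le> \<epsilon>"
proof -
  have "ln (partition_fun \<theta>) \<le> ln (partition_fun \<theta>') + \<epsilon>"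
    by (rule ln_partition_fun_le) (use assms(3) in \<open>auto simp: assms abs_le_iff algebra_simps\<close>)
  moreover have "ln (partition_fun \<theta>') \<le> ln (partition_fun \<theta>) + \<epsilon>"
    by (rule ln_partition_fun_le) (use assms(3) in \<open>auto simp: assms abs_le_iff algebra_simps\<close>)
  ultimately show ?thesis by linarith
qed

text \<open>The constant does not depend on the size of \<open>\<theta>\<close>: the quotient of the two densities lies between
  \<open>exp (-2\<epsilon>)\<close> and \<open>exp (2\<epsilon>)\<close>, while for large \<open>\<epsilon>\<close> the total mass is a sufficient bound.\<close>

lemma gibbs_L1_lipschitz:
  assumes \<theta>: "bdd_meas \<theta>" "bdd_meas \<theta>'" and le: "\<And>u. u \<in> space M \<Longrightarrow> \<bar>\<theta> u - \<theta>' u\<bar> \<le> \<epsilon>"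
  shows "(\<integral>u. \<bar>gibbs \<theta> u - gibbs \<theta>' u\<bar> \<partial>M) \<le> 16 * \<epsilon>"
proof -
  have \<epsilon>: "\<epsilon> \<ge> 0" using le not_empty by (meson abs_ge_zero ex_in_conv order_trans)
  have int: "integrable M (gibbs \<theta>)" "integrable M (gibbs \<theta>')"
    by (auto intro: bdd_meas_integrable bdd_meas_gibbs \<theta>)
  show ?thesis
  proof (cases "\<epsilon> \<le> 1")
    case False
    have "(\<integral>u. \<bar>gibbs \<theta> u - gibbs \<theta>' u\<bar> \<partial>M) \<le> (\<integral>u. gibbs \<theta> u + gibbs \<theta>' u \<partial>M)"
      using int gibbs_pos[OF \<theta>(1)] gibbs_pos[OF \<theta>(2)]
      by (intro integral_mono) (auto simp: abs_le_iff intro: less_imp_le)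
    also have "\<dots> = 2" using int \<theta> by (simp add: gibbs_integral)
    finally show ?thesis using False by simp
  next
    case True
    have Z: "partition_fun \<theta> > 0" "partition_fun \<theta>' > 0" using \<theta> by (auto intro: partition_fun_pos)
    have ratio: "gibbs \<theta> u \<le> exp (2 * \<epsilon>) * gibbs \<theta>' u"
      if "bdd_meas \<theta>" "bdd_meas \<theta>'" "\<And>u. u \<in> space M \<Longrightarrow> \<bar>\<theta> u - \<theta>' u\<bar> \<le> \<epsilon>" "u \<in> space M" for u \<theta> \<theta>'
    proof -
      note Z = partition_fun_pos[OF that(1)] partition_fun_pos[OF that(2)]
      have "partition_fun \<theta>' \<le> exp \<epsilon> * partition_fun \<theta>"
        using that by (intro partition_fun_ratio) (auto simp: abs_le_iff algebra_simps)
      moreover have "exp (\<theta> u) \<le> exp \<epsilon> * exp (\<theta>' u)"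
        using that(3)[OF that(4)] by (simp flip: exp_add add: abs_le_iff)
      ultimately have "exp (\<theta> u) * partition_fun \<theta>' \<le> (exp \<epsilon> * exp (\<theta>' u)) * (exp \<epsilon> * partition_fun \<theta>)"
        using Z by (intro mult_mono) auto
      also have "\<dots> = exp (2 * \<epsilon>) * exp (\<theta>' u) * partition_fun \<theta>"
        unfolding exp_double power2_eq_square by (simp add: mult_ac)
      finally show ?thesis using Z by (simp add: gibbs_def field_simps)
    qed
    define k where "k = exp (2 * \<epsilon>) - 1"
    have k: "k \<ge> 0" using \<epsilon> by (simp add: k_def)
    have "\<bar>gibbs \<theta> u - gibbs \<theta>' u\<bar> \<le> k * gibbs \<theta>' u" if u: "u \<in> space M" for u
    proof -
      have 1: "gibbs \<theta> u \<le> (1 + k) * gibbs \<theta>' u" using ratio[OF \<theta> le u] by (simp add: k_def)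
      have 2: "gibbs \<theta>' u \<le> (1 + k) * gibbs \<theta> u"
        using ratio[OF \<theta>(2,1) _ u] le by (simp add: k_def abs_minus_commute)
      show ?thesis
      proof (cases "gibbs \<theta> u \<le> gibbs \<theta>' u")
        case True
        then have "k * gibbs \<theta> u \<le> k * gibbs \<theta>' u" using k by (rule mult_left_mono)
        then show ?thesis using 2 True by (simp add: algebra_simps)
      next
        case False
        then show ?thesis using 1 by (simp add: algebra_simps)
      qed
    qed
    then have "(\<integral>u. \<bar>gibbs \<theta> u - gibbs \<theta>' u\<bar> \<partial>M) \<le> (\<integral>u. k * gibbs \<theta>' u \<partial>M)"
      using int by (intro integral_mono) auto
    also have "\<dots> = k" using \<theta> by (simp add: gibbs_integral)
    \<comment> \<open>Origin of the 16: k \<le> 2\<epsilon> exp(2\<epsilon>), and exp 2 < 8 for the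
      range \<epsilon> \<le> 1.\<close>
    also have "k \<le> 16 * \<epsilon>"
    proof -
      have "1 - 2 * \<epsilon> \<le> exp (- (2 * \<epsilon>))" using exp_ge_add_one_self[of "- (2 * \<epsilon>)"] by simp
      then have "exp (2 * \<epsilon>) * (1 - 2 * \<epsilon>) \<le> 1"
        using mult_left_mono[of "1 - 2 * \<epsilon>" "exp (- (2 * \<epsilon>))" "exp (2 * \<epsilon>)"] by (simp flip: exp_add)
      then have "k \<le> 2 * \<epsilon> * exp (2 * \<epsilon>)" by (simp add: k_def algebra_simps)
      also have "\<dots> \<le> 2 * \<epsilon> * 8"
      proof (rule mult_left_mono)
        have "exp (2 * \<epsilon>) \<le> exp (2::real)" using True by simp
        also have "exp (2::real) = exp 1 * exp 1" by (simp flip: exp_add)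
        also have "\<dots> \<le> 2.75 * 2.75" 
          by (rule mult_mono) (use e_less_272 in auto)
        finally show "exp (2 * \<epsilon>) \<le> 8" by simp
      qed (use \<epsilon> in auto)
      finally show ?thesis by simp
    qed
    finally show ?thesis .
  qed
qed

text \<open>Jensen's inequality: the quotient of the two partition functions is the mean of
  exp(\<theta> - \<theta>') under the Gibbs density of \<theta>', and \<open>m\<close> is the mean
  of \<theta> - \<theta>'.\<close>

lemma ln_partition_fun_convex:
  assumes \<theta>: "bdd_meas \<theta>" "bdd_meas \<theta>'"
  shows "ln (partition_fun \<theta>') + (\<integral>u. gibbs \<theta>' u * (\<theta> u - \<theta>' u) \<partial>M) \<le> ln (partition_fun \<theta>)"
proof -
  define m where "m = (\<integral>u. gibbs \<theta>' u * (\<theta> u - \<theta>' u) \<partial>M)"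
  have Z: "partition_fun \<theta> > 0" "partition_fun \<theta>' > 0" using \<theta> by (auto intro: partition_fun_pos)
  have int: "integrable M (gibbs \<theta>')" "integrable M (\<lambda>u. gibbs \<theta>' u * (\<theta> u - \<theta>' u))"
    by (intro bdd_meas_integrable bdd_meas_gibbs bdd_meas_mult bdd_meas_diff \<theta>)+
  \<comment> \<open>The integrand is the tangent of exp at \<open>m\<close>, evaluated at \<theta> -
    \<theta>' and weighted by the density; its linear part has mean zero.\<close>
  have "exp m = (\<integral>u. exp m * (gibbs \<theta>' u + gibbs \<theta>' u * (\<theta> u - \<theta>' u) - m * gibbs \<theta>' u) \<partial>M)"
    using int \<theta> by (simp add: gibbs_integral flip: m_def)
  also have "\<dots> \<le> (\<integral>u. exp (\<theta> u) / partition_fun \<theta>' \<partial>M)"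
  proof (intro integral_mono)
    fix u assume "u \<in> space M"
    have "exp m * (1 + (\<theta> u - \<theta>' u - m)) \<le> exp m * exp (\<theta> u - \<theta>' u - m)"
      by (intro mult_left_mono exp_ge_add_one_self) auto
    also have "\<dots> = exp (\<theta> u - \<theta>' u)" by (simp flip: exp_add)
    finally have "gibbs \<theta>' u * (exp m * (1 + (\<theta> u - \<theta>' u - m))) \<le> gibbs \<theta>' u * exp (\<theta> u - \<theta>' u)"
      using gibbs_pos[OF \<theta>(2), of u] by simp
    also have "\<dots> = exp (\<theta> u) / partition_fun \<theta>'" by (simp add: gibbs_def exp_diff)
    finally show "exp m * (gibbs \<theta>' u + gibbs \<theta>' u * (\<theta> u - \<theta>' u) - m * gibbs \<theta>' u) \<le> exp (\<theta> u) / partition_fun \<theta>'"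
      by (simp add: algebra_simps)
  next
    show "integrable M (\<lambda>u. exp (\<theta> u) / partition_fun \<theta>')"
      by (intro integrable_divide bdd_meas_integrable bdd_meas_exp \<theta>)
  qed (use int in auto)
  also have "\<dots> = partition_fun \<theta> / partition_fun \<theta>'" by (simp add: partition_fun_def)
  finally have "m \<le> ln (partition_fun \<theta> / partition_fun \<theta>')"
    using Z by (subst ln_ge_iff) auto
  then show ?thesis using Z by (simp add: ln_div m_def)
qed

lemma ext_integral_real: "integrable M f \<Longrightarrow> ext_integral M f = ereal (\<integral>u. f u \<partial>M)"
proof -
  assume f: "integrable M f"
  have fin: "(\<integral>\<^sup>+ u. ennreal (f u) \<partial>M) < \<infinity>" "(\<integral>\<^sup>+ u. ennreal (- f u) \<partial>M) < \<infinity>"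
    using f by (simp_all add: real_integrable_def top.not_eq_extremum)
  then obtain a c where ac: "(\<integral>\<^sup>+ u. ennreal (f u) \<partial>M) = ennreal a" "0 \<le> a"
     "(\<integral>\<^sup>+ u. ennreal (- f u) \<partial>M) = ennreal c" "0 \<le> c"
    by (metis ennreal_cases infinity_ennreal_def less_irrefl)
  then show ?thesis
    using real_lebesgue_integral_def[OF f] by (simp add: ext_integral_def)
qed

text \<open>Positive and negative part are compared separately, so the integrands may fail to be
  integrable. This allows densities of infinite entropy to be compared with an integrable
  majorant.\<close>

lemma ext_integral_mono:
  assumes "\<And>u. u \<in> space M \<Longrightarrow> f u \<le> g u"
  shows "ext_integral M f \<le> ext_integral M g"
  unfolding ext_integral_def
  by (intro ereal_minus_mono nn_integral_mono ennreal_leI less_eq_ennreal.rep_eq[THEN iffD1]) (use assms in auto)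

end

section \<open>The entropy-regularised Hamiltonian\<close>

lemma has_derivative_of_quadratic_remainder:
  fixes f :: "'a::real_inner \<Rightarrow> real"
  assumes "\<And>y. \<bar>f y - f x - D \<bullet> (y - x)\<bar> \<le> C * (norm (y - x))\<^sup>2"
  shows "(f has_derivative (\<lambda>h. D \<bullet> h)) (at x)"
  unfolding has_derivative_at_alt
proof (intro conjI allI impI)
  show "bounded_linear ((\<bullet>) D)" by (rule bounded_linear_inner_right)
  fix e :: real assume e: "e > 0"
  have "norm (f y - f x - D \<bullet> (y - x)) \<le> e * norm (y - x)" if "norm (y - x) < e / (\<bar>C\<bar> + 1)" for y
  proof -
    have "C * norm (y - x) \<le> (\<bar>C\<bar> + 1) * norm (y - x)" by (intro mult_right_mono) auto
    also have "\<dots> \<le> e" using that by (simp add: field_simps)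
    finally have "C * norm (y - x) * norm (y - x) \<le> e * norm (y - x)" by (intro mult_right_mono) auto
    then show ?thesis using assms[of y] by (simp add: power2_eq_square mult.assoc)
  qed
  then show "\<exists>d>0. \<forall>y. norm (y - x) < d \<longrightarrow> norm (f y - f x - D \<bullet> (y - x)) \<le> e * norm (y - x)"
    using e by (intro exI[of _ "e / (\<bar>C\<bar> + 1)"]) auto
qed

lemma norm_integral_le:
  fixes f :: "'a \<Rightarrow> 'b::{banach, second_countable_topology}"
  assumes "\<And>x. x \<in> space M \<Longrightarrow> norm (f x) \<le> g x" "integrable M f" "integrable M g"
  shows "norm (\<integral>x. f x \<partial>M) \<le> (\<integral>x. g x \<partial>M)"
proof -
  have "norm (\<integral>x. f x \<partial>M) \<le> (\<integral>x. norm (f x) \<partial>M)" by (rule integral_norm_bound)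
  also have "\<dots> \<le> (\<integral>x. g x \<partial>M)" by (intro integral_mono integrable_norm assms)
  finally show ?thesis .
qed

text \<open>The variable \<open>q\<close> introduced below plays the role of the jet (Dv, D^2 v).
  The estimates of this part use only that the exponent is affine in \<open>q\<close>; symmetry and
  ellipticity enter in \<open>elliptic_control\<close>.\<close>

locale entropy_control = prob_space M for M :: "'u measure" +
  fixes lam K \<alpha> :: real
    and r :: "'x::real_normed_vector \<Rightarrow> 'u \<Rightarrow> real"
    and a :: "'x \<Rightarrow> 'u \<Rightarrow> 'e::euclidean_space"
  assumes lam: "lam > 0" and K: "K \<ge> 0"
    and r_meas: "\<And>x. r x \<in> borel_measurable M" and a_meas: "\<And>x. a x \<in> borel_measurable M"
    and r_bound: "\<And>x u. u \<in> space M \<Longrightarrow> \<bar>r x u\<bar> \<le> K"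
    and a_bound: "\<And>x u. u \<in> space M \<Longrightarrow> norm (a x u) \<le> K"
    and r_hoelder: "\<And>x y u. u \<in> space M \<Longrightarrow> \<bar>r x u - r y u\<bar> \<le> K * norm (x - y) powr \<alpha>"
    and a_hoelder: "\<And>x y u. u \<in> space M \<Longrightarrow> norm (a x u - a y u) \<le> K * norm (x - y) powr \<alpha>"
begin

definition \<theta> :: "'x \<Rightarrow> 'e \<Rightarrow> 'u \<Rightarrow> real"
  where "\<theta> x q u = (r x u + a x u \<bullet> q) / lam"

definition L :: "'x \<Rightarrow> 'e \<Rightarrow> real"
  where "L x q = lam * ln (partition_fun (\<theta> x q))"

definition A :: "'x \<Rightarrow> 'e \<Rightarrow> 'e"
  where "A x q = (\<integral>u. gibbs (\<theta> x q) u *\<^sub>R a x u \<partial>M)"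

lemma bdd_meas_a: "bdd_meas (a x)" and bdd_meas_r: "bdd_meas (r x)"
  using a_meas r_meas a_bound r_bound by (auto intro!: bdd_measI[where H=K])

lemma bdd_meas_inner: "bdd_meas (\<lambda>u. a x u \<bullet> q)"
proof (rule bdd_measI)
  show "norm (a x u \<bullet> q) \<le> K * norm q" if "u \<in> space M" for u
  proof -
    have "norm (a x u \<bullet> q) \<le> norm (a x u) * norm q" by (simp add: Cauchy_Schwarz_ineq2)
    also have "\<dots> \<le> K * norm q" using a_bound[OF that] by (rule mult_right_mono) auto
    finally show ?thesis .
  qed
qed (use a_meas in measurable)

lemma bdd_meas_\<theta>: "bdd_meas (\<theta> x q)"
proof -
  have "bdd_meas (\<lambda>u. (1 / lam) * (r x u - a x u \<bullet> (- q)))"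
    by (intro bdd_meas_mult bdd_meas_const bdd_meas_diff bdd_meas_r bdd_meas_inner)
  then show ?thesis by (simp add: \<theta>_def[abs_def])
qed

lemma \<theta>_diff_q: "u \<in> space M \<Longrightarrow> \<bar>\<theta> x q u - \<theta> x q' u\<bar> \<le> K / lam * norm (q - q')"
proof -
  assume u: "u \<in> space M"
  have "\<bar>a x u \<bullet> (q - q')\<bar> \<le> norm (a x u) * norm (q - q')" by (rule Cauchy_Schwarz_ineq2)
  also have "\<dots> \<le> K * norm (q - q')" using a_bound[OF u] by (rule mult_right_mono) auto
  finally have "\<bar>a x u \<bullet> (q - q')\<bar> / lam \<le> K * norm (q - q') / lam"
    using lam by (intro divide_right_mono) auto
  moreover have "\<theta> x q u - \<theta> x q' u = a x u \<bullet> (q - q') / lam"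
    by (simp add: \<theta>_def inner_diff_right flip: diff_divide_distrib)
  ultimately show ?thesis using lam by simp
qed

lemma \<theta>_diff_x: "u \<in> space M \<Longrightarrow> \<bar>\<theta> x q u - \<theta> y q u\<bar> \<le> K / lam * (1 + norm q) * norm (x - y) powr \<alpha>"
proof -
  assume u: "u \<in> space M"
  have "\<bar>(a x u - a y u) \<bullet> q\<bar> \<le> norm (a x u - a y u) * norm q" by (rule Cauchy_Schwarz_ineq2)
  also have "\<dots> \<le> K * norm (x - y) powr \<alpha> * norm q" using a_hoelder[OF u] by (rule mult_right_mono) auto
  finally have "\<bar>(r x u - r y u) + (a x u - a y u) \<bullet> q\<bar> \<le> K * norm (x - y) powr \<alpha> + K * norm (x - y) powr \<alpha> * norm q"
    using r_hoelder[OF u, of x y] by linarith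
  then have "\<bar>(r x u - r y u) + (a x u - a y u) \<bullet> q\<bar> / lam
      \<le> (K * norm (x - y) powr \<alpha> + K * norm (x - y) powr \<alpha> * norm q) / lam"
    using lam by (intro divide_right_mono) auto
  moreover have "\<theta> x q u - \<theta> y q u = ((r x u - r y u) + (a x u - a y u) \<bullet> q) / lam"
    by (simp add: \<theta>_def inner_diff_left algebra_simps flip: diff_divide_distrib)
  ultimately show ?thesis using lam by (simp add: algebra_simps add_divide_distrib)
qed

lemma A_bound: "norm (A x q) \<le> K"
proof -
  have "norm (A x q) \<le> (\<integral>u. K * gibbs (\<theta> x q) u \<partial>M)"
    unfolding A_def
  proof (rule norm_integral_le)
    fix u assume u: "u \<in> space M"
    show "norm (gibbs (\<theta> x q) u *\<^sub>R a x u) \<le> K * gibbs (\<theta> x q) u"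
      using a_bound[OF u, of x] gibbs_pos[OF bdd_meas_\<theta>, of x q u] by (simp add: mult.commute)
  qed (intro bdd_meas_integrable bdd_meas_scaleR bdd_meas_mult bdd_meas_const bdd_meas_gibbs bdd_meas_\<theta> bdd_meas_a)+
  then show ?thesis by (simp add: gibbs_integral bdd_meas_\<theta>)
qed

lemma A_inner: "A x q \<bullet> e = (\<integral>u. gibbs (\<theta> x q) u * (a x u \<bullet> e) \<partial>M)"
  unfolding A_def
  by (subst integral_inner_left[symmetric])
    (auto intro!: bdd_meas_integrable bdd_meas_scaleR bdd_meas_gibbs bdd_meas_\<theta> bdd_meas_a)

text \<open>The difference of the exponents at \<open>q\<close> and \<open>q'\<close> is
  \<open>a x u \<bullet> (q - q') / lam\<close>, and its Gibbs mean is the pairing with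
  \<open>A x q'\<close>; Jensen's inequality then gives the tangent plane. This inequality makes
  each iterate a subsolution of the limit equation.\<close>

lemma L_tangent: "L x q' + A x q' \<bullet> (q - q') \<le> L x q"
proof -
  have "gibbs (\<theta> x q') u * (\<theta> x q u - \<theta> x q' u) = gibbs (\<theta> x q') u * (a x u \<bullet> (q - q')) / lam" for u
    by (simp add: \<theta>_def inner_diff_right right_diff_distrib distrib_left diff_divide_distrib add_divide_distrib)
  then have "ln (partition_fun (\<theta> x q')) + A x q' \<bullet> (q - q') / lam \<le> ln (partition_fun (\<theta> x q))"
    using ln_partition_fun_convex[OF bdd_meas_\<theta> bdd_meas_\<theta>, of x q' x q] by (simp add: A_inner)
  then have "lam * (ln (partition_fun (\<theta> x q')) + A x q' \<bullet> (q - q') / lam) \<le> lam * ln (partition_fun (\<theta> x q))"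
    using lam by (intro mult_left_mono) auto
  then show ?thesis using lam by (simp add: L_def distrib_left)
qed

lemma L_lipschitz: "\<bar>L x q - L x q'\<bar> \<le> K * norm (q - q')"
proof -
  have "\<bar>ln (partition_fun (\<theta> x q)) - ln (partition_fun (\<theta> x q'))\<bar> \<le> K / lam * norm (q - q')"
    by (intro ln_partition_fun_lipschitz bdd_meas_\<theta> \<theta>_diff_q)
  then have "lam * \<bar>ln (partition_fun (\<theta> x q)) - ln (partition_fun (\<theta> x q'))\<bar> \<le> lam * (K / lam * norm (q - q'))"
    using lam by (intro mult_left_mono) auto
  then show ?thesis using lam by (simp add: L_def abs_mult flip: right_diff_distrib)
qed

text \<open>The difference splits into the change of \<open>a\<close> under a fixed density of mass
  1 and the change of the density against \<open>a\<close>, which is bounded by \<open>K\<close>.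
  The latter is controlled by \<open>gibbs_L1_lipschitz\<close>, whence the 16.\<close>

lemma A_diff_le:
  assumes "\<And>u. u \<in> space M \<Longrightarrow> \<bar>\<theta> x q u - \<theta> y q' u\<bar> \<le> \<epsilon>"
    and "\<And>u. u \<in> space M \<Longrightarrow> norm (a x u - a y u) \<le> \<delta>"
  shows "norm (A x q - A y q') \<le> \<delta> + 16 * K * \<epsilon>"
proof -
  let ?g = "gibbs (\<theta> x q)" and ?g' = "gibbs (\<theta> y q')"
  note bm = bdd_meas_scaleR bdd_meas_mult bdd_meas_const bdd_meas_gibbs bdd_meas_\<theta> bdd_meas_a bdd_meas_diff
  have bm_abs: "bdd_meas (\<lambda>u. \<bar>f u\<bar>)" if "bdd_meas f" for f :: "'u \<Rightarrow> real"
    using that unfolding bdd_meas_def by auto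
  have diff: "A x q - A y q' = (\<integral>u. ?g u *\<^sub>R (a x u - a y u) + (?g u - ?g' u) *\<^sub>R a y u \<partial>M)"
    unfolding A_def
    by (subst Bochner_Integration.integral_diff[symmetric])
      (auto intro!: bdd_meas_integrable bm Bochner_Integration.integral_cong simp: algebra_simps)
  have "norm (A x q - A y q') \<le> (\<integral>u. \<delta> * ?g u + K * \<bar>?g u - ?g' u\<bar> \<partial>M)"
    unfolding diff
  proof (rule norm_integral_le)
    fix u assume u: "u \<in> space M"
    have "norm (?g u *\<^sub>R (a x u - a y u) + (?g u - ?g' u) *\<^sub>R a y u)
        \<le> norm (?g u *\<^sub>R (a x u - a y u)) + norm ((?g u - ?g' u) *\<^sub>R a y u)"
      by (rule norm_triangle_ineq)
    also have "\<dots> \<le> \<delta> * ?g u + K * \<bar>?g u - ?g' u\<bar>"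
      using assms(2)[OF u] a_bound[OF u, of y] gibbs_pos[OF bdd_meas_\<theta>, of x q u]
      by (intro add_mono) (auto simp: mult.commute intro: mult_right_mono)
    finally show "norm (?g u *\<^sub>R (a x u - a y u) + (?g u - ?g' u) *\<^sub>R a y u) \<le> \<delta> * ?g u + K * \<bar>?g u - ?g' u\<bar>" .
  next
    show "integrable M (\<lambda>u. ?g u *\<^sub>R (a x u - a y u) + (?g u - ?g' u) *\<^sub>R a y u)"
      by (intro Bochner_Integration.integrable_add bdd_meas_integrable bm)
    show "integrable M (\<lambda>u. \<delta> * ?g u + K * \<bar>?g u - ?g' u\<bar>)"
      by (intro Bochner_Integration.integrable_add bdd_meas_integrable bm bm_abs)
  qed
  moreover have "(\<integral>u. \<delta> * ?g u + K * \<bar>?g u - ?g' u\<bar> \<partial>M) = \<delta> * (\<integral>u. ?g u \<partial>M) + K * (\<integral>u. \<bar>?g u - ?g' u\<bar> \<partial>M)"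
    by (subst Bochner_Integration.integral_add) (auto intro!: bdd_meas_integrable bm bm_abs)
  moreover have "\<delta> * (\<integral>u. ?g u \<partial>M) + K * (\<integral>u. \<bar>?g u - ?g' u\<bar> \<partial>M) \<le> \<delta> * 1 + K * (16 * \<epsilon>)"
    using mult_left_mono[OF gibbs_L1_lipschitz[OF bdd_meas_\<theta> bdd_meas_\<theta> assms(1)] K]
    by (simp add: gibbs_integral bdd_meas_\<theta>)
  ultimately show ?thesis by linarith
qed

text \<open>The factor \<open>16 * K\<close> of \<open>A_diff_le\<close> times the Lipschitz
  constant \<open>K / lam\<close> of the exponent in \<open>q\<close>. In
  \<open>hoelder_const\<close> the same factor meets the Hoelder constant of the exponent in
  \<open>x\<close>, which grows with the size of the jet.\<close>

definition lip_const :: real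
  where "lip_const = 16 * K\<^sup>2 / lam"

definition hoelder_const :: "real \<Rightarrow> real"
  where "hoelder_const R = K + lip_const * (1 + R)"

lemma lip_const_nonneg: "lip_const \<ge> 0"
  using lam by (simp add: lip_const_def)

lemma hoelder_const_nonneg: "R \<ge> 0 \<Longrightarrow> hoelder_const R \<ge> 0"
  using K lip_const_nonneg by (simp add: hoelder_const_def)

lemma A_lipschitz: "norm (A x q - A x q') \<le> lip_const * norm (q - q')"
  using A_diff_le[of x q x q' "K / lam * norm (q - q')" 0, OF \<theta>_diff_q]
  by (simp add: lip_const_def power2_eq_square mult_ac)

lemma A_hoelder: "norm q \<le> R \<Longrightarrow> norm (A x q - A y q) \<le> hoelder_const R * norm (x - y) powr \<alpha>"
proof -
  assume R: "norm q \<le> R"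
  have "norm (A x q - A y q) \<le> (K + lip_const * (1 + norm q)) * norm (x - y) powr \<alpha>"
    using A_diff_le[OF \<theta>_diff_x a_hoelder, of x q y]
    by (simp add: lip_const_def power2_eq_square algebra_simps add_divide_distrib)
  also have "\<dots> \<le> hoelder_const R * norm (x - y) powr \<alpha>"
    using R lip_const_nonneg unfolding hoelder_const_def
    by (intro mult_right_mono add_left_mono mult_left_mono) auto
  finally show ?thesis .
qed

text \<open>Convexity and the Lipschitz continuity of \<open>A\<close> identify \<open>A x q\<close> as the derivative of \<open>L x\<close> at \<open>q\<close>
  without differentiation under the integral.\<close>

lemma L_quadratic: "\<bar>L x q - L x q' - A x q' \<bullet> (q - q')\<bar> \<le> lip_const * (norm (q - q'))\<^sup>2"
proof -
  have "0 \<le> L x q - L x q' - A x q' \<bullet> (q - q')" using L_tangent[of x q' q] by linarith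
  moreover have "L x q - L x q' - A x q' \<bullet> (q - q') \<le> (A x q - A x q') \<bullet> (q - q')"
    using L_tangent[of x q q'] by (simp add: inner_diff_left inner_diff_right)
  moreover have "(A x q - A x q') \<bullet> (q - q') \<le> norm (A x q - A x q') * norm (q - q')"
    by (rule norm_cauchy_schwarz)
  moreover have "\<dots> \<le> lip_const * norm (q - q') * norm (q - q')"
    by (intro mult_right_mono A_lipschitz) auto
  ultimately show ?thesis by (simp add: power2_eq_square mult.assoc)
qed

text \<open>The mean value inequality in \<open>q\<close> for \<open>L x - L y\<close>, whose
  derivative \<open>A x - A y\<close> is Hoelder small. The product of both increments is the point:
  a distance in \<open>q\<close> that tends to zero is gained on top of the power of
  \<open>norm (x - y)\<close>.\<close>

lemma L_mixed:
  assumes "norm q \<le> R" "norm q' \<le> R"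
  shows "\<bar>(L x q - L y q) - (L x q' - L y q')\<bar> \<le> hoelder_const R * norm (x - y) powr \<alpha> * norm (q - q')"
proof -
  have d: "((\<lambda>q. L x q) has_derivative (\<lambda>h. A x q \<bullet> h)) (at q)" for x and q :: 'e
    by (rule has_derivative_of_quadratic_remainder[OF L_quadratic])
  have R: "R \<ge> 0" using assms norm_ge_zero[of q] by linarith
  have "norm ((L x q - L y q) - (L x q' - L y q')) \<le> hoelder_const R * norm (x - y) powr \<alpha> * norm (q - q')"
  proof (rule differentiable_bound[where S="cball 0 R" and f'="\<lambda>q h. (A x q - A y q) \<bullet> h"])
    fix p :: 'e assume p: "p \<in> cball 0 R"
    show "((\<lambda>q. L x q - L y q) has_derivative (\<lambda>h. (A x p - A y p) \<bullet> h)) (at p within cball 0 R)"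
      by (rule has_derivative_at_withinI)
        (use has_derivative_diff[OF d[of x p] d[of y p]] in \<open>simp add: inner_diff_left\<close>)
    show "onorm (\<lambda>h. (A x p - A y p) \<bullet> h) \<le> hoelder_const R * norm (x - y) powr \<alpha>"
    proof (rule onorm_bound)
      show "0 \<le> hoelder_const R * norm (x - y) powr \<alpha>" using hoelder_const_nonneg[OF R] by simp
      fix h
      have "norm ((A x p - A y p) \<bullet> h) \<le> norm (A x p - A y p) * norm h"
        by (simp add: Cauchy_Schwarz_ineq2)
      also have "\<dots> \<le> hoelder_const R * norm (x - y) powr \<alpha> * norm h"
        using p by (intro mult_right_mono A_hoelder) auto
      finally show "norm ((A x p - A y p) \<bullet> h) \<le> hoelder_const R * norm (x - y) powr \<alpha> * norm h" .
    qed
  qed (use assms in auto)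
  then show ?thesis by simp
qed

lemma A_tendsto:
  assumes \<alpha>: "\<alpha> > 0" and X: "X \<longlonglongrightarrow> x" and q: "q \<longlonglongrightarrow> q'"
  shows "(\<lambda>k. A (X k) (q k)) \<longlonglongrightarrow> A x q'"
proof (rule LIM_zero_cancel, rule Lim_null_comparison)
  let ?b = "\<lambda>k. lip_const * norm (q k - q') + hoelder_const (norm q') * norm (X k - x) powr \<alpha>"
  show "\<forall>\<^sub>F k in sequentially. norm (A (X k) (q k) - A x q') \<le> ?b k"
  proof (intro always_eventually allI)
    fix k
    have "norm (A (X k) (q k) - A x q') \<le> norm (A (X k) (q k) - A (X k) q') + norm (A (X k) q' - A x q')"
      using norm_triangle_ineq[of "A (X k) (q k) - A (X k) q'" "A (X k) q' - A x q'"] by simp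
    then show "norm (A (X k) (q k) - A x q') \<le> ?b k"
      using A_lipschitz[of "X k" "q k" q'] A_hoelder[of q' "norm q'" "X k" x] by linarith
  qed
  have 1: "(\<lambda>k. norm (q k - q')) \<longlonglongrightarrow> 0" using q by (simp add: LIM_zero tendsto_norm_zero)
  have "(\<lambda>k. norm (X k - x)) \<longlonglongrightarrow> 0" using X by (simp add: LIM_zero tendsto_norm_zero)
  then have 2: "(\<lambda>k. norm (X k - x) powr \<alpha>) \<longlonglongrightarrow> 0"
    using \<alpha> by (intro tendsto_zero_powrI[OF _ tendsto_const]) auto
  show "?b \<longlonglongrightarrow> 0"
    using tendsto_add[OF tendsto_mult_right_zero[OF 1] tendsto_mult_right_zero[OF 2],
        of lip_const "hoelder_const (norm q')"] by simp
qed

section \<open>Oscillation of a policy step and of the linearised equation\<close>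

definition policy_op :: "'x \<Rightarrow> 'e \<Rightarrow> 'e \<Rightarrow> real"
  where "policy_op x q p = L x q + A x q \<bullet> (p - q)"

text \<open>The three summands are the coefficients of \<open>E1\<close>, \<open>E2\<close> and
  \<open>E3\<close> in the next estimate.\<close>

definition osc_const :: "real \<Rightarrow> real"
  where "osc_const R = lip_const * R\<^sup>2 + hoelder_const R * R * R
    + (lip_const * R + hoelder_const R * R) * (1 + 2 * R)"

lemma osc_const_nonneg: "R \<ge> 0 \<Longrightarrow> osc_const R \<ge> 0"
  unfolding osc_const_def using lip_const_nonneg hoelder_const_nonneg
  by (intro add_nonneg_nonneg mult_nonneg_nonneg) auto

text \<open>Unprimed jets belong to the point \<open>x\<close>, primed ones to \<open>y\<close>;
  \<open>q\<close> is the old jet, \<open>p\<close> the new one, and \<open>h\<close> represents the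
  power \<alpha> of the distance. After removal of the two principal terms the rest is
  \<open>h\<close> times a quantity that is small once \<open>h\<close> is small and consecutive
  jets are close.\<close>

lemma policy_step_oscillation:
  assumes h: "norm (x - y) powr \<alpha> \<le> R * h" "h \<ge> 0" and q: "norm q' \<le> R"
    "norm (q - q') \<le> R * h" "norm (p - p') \<le> R * h"
  shows "\<bar>policy_op x q p - policy_op y q' p' - A y q' \<bullet> (p - p') - (L x q' - L y q')\<bar>
    \<le> osc_const R * h * (h + norm (p' - q'))"
proof -
  define c where "c = lip_const"
  define d where "d = hoelder_const R * R"
  have R: "R \<ge> 0" using q(1) norm_ge_zero[of q'] by linarith
  have c: "c \<ge> 0" by (simp add: c_def lip_const_nonneg)
  have d: "d \<ge> 0" using R hoelder_const_nonneg by (simp add: d_def)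
  \<comment> \<open>\<open>E1\<close> is the Taylor remainder of \<open>L x\<close> in the old jet
    and \<open>E2\<close> a product of two increments. In \<open>E3\<close> the factor
    \<open>p - q\<close> is no increment, but it differs from \<open>p' - q'\<close> by at most
    2Rh.\<close>
  define E1 where "E1 = L x q - L x q' - A x q' \<bullet> (q - q')"
  define E2 where "E2 = (A x q' - A y q') \<bullet> (q - q')"
  define E3 where "E3 = (A x q - A y q') \<bullet> (p - q)"
  have split: "policy_op x q p - policy_op y q' p' - A y q' \<bullet> (p - p') - (L x q' - L y q') = E1 + E2 + E3"
    by (simp add: policy_op_def E1_def E2_def E3_def inner_diff_left inner_diff_right)
  have "\<bar>E1\<bar> \<le> c * (norm (q - q'))\<^sup>2" unfolding E1_def c_def by (rule L_quadratic)
  also have "\<dots> \<le> c * (R * h)\<^sup>2" using q(2) c by (intro mult_left_mono power_mono) auto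
  finally have 1: "\<bar>E1\<bar> \<le> c * R\<^sup>2 * h * h" by (simp add: power2_eq_square mult_ac)
  have Axy: "norm (A x q' - A y q') \<le> d * h"
  proof -
    have "norm (A x q' - A y q') \<le> hoelder_const R * norm (x - y) powr \<alpha>" by (rule A_hoelder[OF q(1)])
    also have "\<dots> \<le> hoelder_const R * (R * h)"
      using h hoelder_const_nonneg[OF R] by (intro mult_left_mono)
    finally show ?thesis by (simp add: d_def mult.assoc)
  qed
  have "\<bar>E2\<bar> \<le> norm (A x q' - A y q') * norm (q - q')" unfolding E2_def by (rule Cauchy_Schwarz_ineq2)
  also have "\<dots> \<le> (d * h) * (R * h)" using Axy q d h by (intro mult_mono) auto
  finally have 2: "\<bar>E2\<bar> \<le> d * R * h * h" by (simp add: mult_ac)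
  have "norm (A x q - A y q') \<le> norm (A x q - A x q') + norm (A x q' - A y q')"
    using norm_triangle_ineq[of "A x q - A x q'" "A x q' - A y q'"] by simp
  also have "\<dots> \<le> c * (R * h) + d * h"
  proof (rule add_mono[OF _ Axy])
    have "norm (A x q - A x q') \<le> c * norm (q - q')" unfolding c_def by (rule A_lipschitz)
    also have "\<dots> \<le> c * (R * h)" using c q by (intro mult_left_mono) auto
    finally show "norm (A x q - A x q') \<le> c * (R * h)" .
  qed
  finally have A3: "norm (A x q - A y q') \<le> (c * R + d) * h" by (simp add: algebra_simps)
  have "norm (p - q) = norm ((p' - q') + (p - p') - (q - q'))" by simp
  also have "\<dots> \<le> norm (p' - q') + norm (p - p') + norm (q - q')"
    using norm_triangle_ineq4[of "(p' - q') + (p - p')" "q - q'"] norm_triangle_ineq[of "p' - q'" "p - p'"]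
    by linarith
  finally have "norm (p - q) \<le> norm (p' - q') + norm (p - p') + norm (q - q')" .
  then have pq: "norm (p - q) \<le> norm (p' - q') + 2 * R * h" using q by linarith
  have "\<bar>E3\<bar> \<le> norm (A x q - A y q') * norm (p - q)" unfolding E3_def by (rule Cauchy_Schwarz_ineq2)
  also have "\<dots> \<le> ((c * R + d) * h) * (norm (p' - q') + 2 * R * h)"
    using A3 pq c d R h by (intro mult_mono) auto
  also have "\<dots> \<le> ((c * R + d) * h) * ((1 + 2 * R) * (h + norm (p' - q')))"
  proof (rule mult_left_mono)
    have "0 \<le> 2 * R * norm (p' - q') + h" using R h by simp
    then show "norm (p' - q') + 2 * R * h \<le> (1 + 2 * R) * (h + norm (p' - q'))"
      by (simp add: algebra_simps)
  qed (use c d R h in auto)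
  finally have 3: "\<bar>E3\<bar> \<le> (c * R + d) * (1 + 2 * R) * h * (h + norm (p' - q'))" by (simp add: mult_ac)
  have mono: "k * h * h \<le> k * h * (h + norm (p' - q'))" if "k \<ge> 0" for k
    using that h by (intro mult_left_mono) auto
  have "\<bar>E1 + E2 + E3\<bar> \<le> c * R\<^sup>2 * h * (h + norm (p' - q')) + d * R * h * (h + norm (p' - q'))
      + (c * R + d) * (1 + 2 * R) * h * (h + norm (p' - q'))"
  proof -
    have "c * R\<^sup>2 * h * h \<le> c * R\<^sup>2 * h * (h + norm (p' - q'))" "d * R * h * h \<le> d * R * h * (h + norm (p' - q'))"
      using c d R by (intro mono mult_nonneg_nonneg; simp)+
    moreover have "\<bar>E1 + E2 + E3\<bar> \<le> \<bar>E1\<bar> + \<bar>E2\<bar> + \<bar>E3\<bar>" by simp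
    ultimately show ?thesis using 1 2 3 by linarith
  qed
  also have "\<dots> = osc_const R * h * (h + norm (p' - q'))" by (simp add: osc_const_def c_def d_def algebra_simps)
  finally show ?thesis unfolding split .
qed

text \<open>Subtracting the oscillation of the limit equation \<open>\<rho> v = L x s\<close> from that of the policy step
  leaves the linearised operator at the limit, up to terms that are small compared with \<open>h\<close>.\<close>

lemma linearised_oscillation:
  assumes h: "norm (x - y) powr \<alpha> \<le> R * h" "h \<ge> 0" and q: "norm q' \<le> R" and s: "norm s' \<le> R"
    and qq: "norm (q - q') \<le> R * h" "norm (p - p') \<le> R * h" and ss: "norm (s - s') \<le> R * h"
  shows "\<bar>A y s' \<bullet> ((p - s) - (p' - s'))\<bar> \<le> \<bar>policy_op x q p - L x s - (policy_op y q' p' - L y s')\<bar>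
    + (2 * osc_const R + lip_const * R + hoelder_const R * R) * h * (h + norm (p' - q') + norm (q' - s'))"
proof -
  define C0 where "C0 = osc_const R"
  define c where "c = lip_const"
  define d where "d = hoelder_const R * R"
  have R: "R \<ge> 0" using q norm_ge_zero[of q'] by linarith
  have C0: "C0 \<ge> 0" using osc_const_nonneg[OF R] by (simp add: C0_def)
  have c: "c \<ge> 0" by (simp add: c_def lip_const_nonneg)
  have d: "d \<ge> 0" using R hoelder_const_nonneg by (simp add: d_def)
  \<comment> \<open>\<open>E1\<close> and \<open>E2\<close> are the remainders of the policy step
    and of the limit equation, \<open>E3\<close> compares their dependence on the point, and
    \<open>E4\<close> replaces the coefficient at the old jet by the one at the limit jet.\<close>
  define D where "D = policy_op x q p - L x s - (policy_op y q' p' - L y s')"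
  define E1 where "E1 = policy_op x q p - policy_op y q' p' - A y q' \<bullet> (p - p') - (L x q' - L y q')"
  define E2 where "E2 = L x s - L y s' - A y s' \<bullet> (s - s') - (L x s' - L y s')"
  define E3 where "E3 = (L x q' - L y q') - (L x s' - L y s')"
  define E4 where "E4 = (A y q' - A y s') \<bullet> (p - p')"
  have split: "A y s' \<bullet> ((p - s) - (p' - s')) = D - E1 + E2 - E3 - E4"
    by (simp add: D_def E1_def E2_def E3_def E4_def inner_diff_left inner_diff_right)
  have 1: "\<bar>E1\<bar> \<le> C0 * h * (h + norm (p' - q'))"
    unfolding E1_def C0_def by (intro policy_step_oscillation h q qq)
  \<comment> \<open>The limit equation is a policy step whose old and new jets coincide, so the gap
    between consecutive jets is zero here.\<close>
  have 2: "\<bar>E2\<bar> \<le> C0 * h * (h + 0)"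
    using policy_step_oscillation[OF h s ss ss] by (simp add: E2_def C0_def policy_op_def)
  have "\<bar>E3\<bar> \<le> hoelder_const R * norm (x - y) powr \<alpha> * norm (q' - s')"
    unfolding E3_def by (intro L_mixed q s)
  also have "\<dots> \<le> hoelder_const R * (R * h) * norm (q' - s')"
    using h hoelder_const_nonneg[OF R] by (intro mult_right_mono mult_left_mono) auto
  finally have 3: "\<bar>E3\<bar> \<le> d * h * norm (q' - s')" by (simp add: d_def mult_ac)
  have "\<bar>E4\<bar> \<le> norm (A y q' - A y s') * norm (p - p')" unfolding E4_def by (rule Cauchy_Schwarz_ineq2)
  also have "\<dots> \<le> (c * norm (q' - s')) * (R * h)"
    unfolding c_def using qq A_lipschitz[of y q' s'] lip_const_nonneg by (intro mult_mono) auto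
  finally have 4: "\<bar>E4\<bar> \<le> c * R * h * norm (q' - s')" by (simp add: mult_ac)
  define n where "n = h + norm (p' - q') + norm (q' - s')"
  have bounds: "C0 * h * (h + norm (p' - q')) \<le> C0 * h * n" "C0 * h * (h + 0) \<le> C0 * h * n"
    "d * h * norm (q' - s') \<le> d * h * n" "c * R * h * norm (q' - s') \<le> c * R * h * n"
    using C0 c d R h by (intro mult_left_mono mult_nonneg_nonneg; simp add: n_def)+
  have "\<bar>D - E1 + E2 - E3 - E4\<bar> \<le> \<bar>D\<bar> + (\<bar>E1\<bar> + \<bar>E2\<bar> + \<bar>E3\<bar> + \<bar>E4\<bar>)" by simp
  also have "\<dots> \<le> \<bar>D\<bar> + (C0 * h * n + C0 * h * n + d * h * n + c * R * h * n)"
    using 1 2 3 4 bounds by linarith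
  also have "\<dots> = \<bar>D\<bar> + (2 * C0 + c * R + d) * h * n" by (simp add: algebra_simps)
  finally show ?thesis unfolding split D_def n_def C0_def c_def d_def .
qed

end

section \<open>Comparison principles\<close>

locale elliptic_control = entropy_control M lam K \<alpha> r a
  for M :: "'u measure" and lam K \<alpha> and r :: "real^'d::finite \<Rightarrow> 'u \<Rightarrow> real"
    and a :: "real^'d \<Rightarrow> 'u \<Rightarrow> (real^'d) \<times> (real^'d^'d)" +
  fixes c \<rho> :: real
  assumes \<alpha>: "0 < \<alpha>" "\<alpha> < 1" and c: "c > 0" and \<rho>: "\<rho> > 0"
    and a_sym: "\<And>x u. u \<in> space M \<Longrightarrow> transpose (snd (a x u)) = snd (a x u)"
    and a_elliptic: "\<And>x u \<xi>. u \<in> space M \<Longrightarrow> c * (\<xi> \<bullet> \<xi>) \<le> \<xi> \<bullet> (snd (a x u) *v \<xi>)"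
begin

text \<open>An entry of the matrix is the inner product with a unit matrix, and in this form it
  passes through the integral by \<open>A_inner\<close>.\<close>

lemma A_sym: "transpose (snd (A x q)) = snd (A x q)"
proof -
  define E where "E i j = (0 :: real^'d, axis i (axis j 1) :: real^'d^'d)" for i j :: 'd
  have E: "p \<bullet> E i j = snd p $ i $ j" for p i j
    by (simp add: E_def inner_prod_def inner_axis)
  have "snd (A x q) $ i $ j = snd (A x q) $ j $ i" for i j
  proof -
    have "A x q \<bullet> E i j = A x q \<bullet> E j i"
      unfolding A_inner
    proof (rule Bochner_Integration.integral_cong[OF refl])
      fix u assume "u \<in> space M"
      then have "snd (a x u) $ i $ j = snd (a x u) $ j $ i"
        using arg_cong[OF a_sym, of u "\<lambda>X. X $ j $ i" x] by (simp add: transpose_def)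
      then show "gibbs (\<theta> x q) u * (a x u \<bullet> E i j) = gibbs (\<theta> x q) u * (a x u \<bullet> E j i)"
        by (simp add: E)
    qed
    then show ?thesis by (simp add: E)
  qed
  then show ?thesis by (simp add: transpose_def vec_eq_iff)
qed

text \<open>Pairing with \<open>rank1 \<xi>\<close> turns the quadratic form into a linear
  functional of the coefficients, whose mean preserves the lower bound since the Gibbs density has
  mass 1.\<close>

lemma A_elliptic: "c * (\<xi> \<bullet> \<xi>) \<le> \<xi> \<bullet> (snd (A x q) *v \<xi>)"
proof -
  have form: "p \<bullet> (0, rank1 \<xi>) = \<xi> \<bullet> (snd p *v \<xi>)" for p :: "(real^'d) \<times> (real^'d^'d)"
    by (simp add: inner_prod_def inner_commute[of "snd p"] rank1_inner)
  have "c * (\<xi> \<bullet> \<xi>) = (\<integral>u. gibbs (\<theta> x q) u * (c * (\<xi> \<bullet> \<xi>)) \<partial>M)"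
    by (simp add: gibbs_integral bdd_meas_\<theta>)
  also have "\<dots> \<le> (\<integral>u. gibbs (\<theta> x q) u * (a x u \<bullet> (0, rank1 \<xi>)) \<partial>M)"
  proof (rule integral_mono)
    show "gibbs (\<theta> x q) u * (c * (\<xi> \<bullet> \<xi>)) \<le> gibbs (\<theta> x q) u * (a x u \<bullet> (0, rank1 \<xi>))" if "u \<in> space M" for u
      using a_elliptic[OF that, of \<xi> x] gibbs_pos[OF bdd_meas_\<theta>, of x q u]
      by (simp add: form mult_left_mono)
  qed (intro bdd_meas_integrable bdd_meas_mult bdd_meas_gibbs bdd_meas_\<theta> bdd_meas_const bdd_meas_inner)+
  also have "\<dots> = A x q \<bullet> (0, rank1 \<xi>)" by (simp add: A_inner)
  finally show ?thesis by (simp add: form)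
qed

lemma A_mono:
  assumes "\<And>e. e \<bullet> ((X - Y) *v e) \<le> 0"
  shows "A x q \<bullet> (p, X) \<le> A x q \<bullet> (p, Y)"
proof -
  have "snd (A x q) \<bullet> (X - Y) \<le> 0"
  proof (rule psd_inner_nonpos[OF A_sym _ assms])
    show "0 \<le> \<xi> \<bullet> (snd (A x q) *v \<xi>)" for \<xi>
      using A_elliptic[of \<xi> x q] c by (meson inner_ge_zero less_imp_le mult_nonneg_nonneg order_trans)
  qed
  then show ?thesis by (simp add: inner_prod_def inner_diff_right)
qed

text \<open>The jet of \<delta>|x|^2 is the pair of 2\<delta>x and 2\<delta> times the identity. The
  constant bounds its pairing with coefficients of norm at most \<open>K\<close>, in the form
  required by \<open>nonpos_of_penalised_max\<close>.\<close>

definition penalty_const :: real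
  where "penalty_const = 2 * K * (1 + norm (mat 1 :: real^'d^'d))"

lemma penalty_const_nonneg: "penalty_const \<ge> 0"
  using K by (simp add: penalty_const_def)

lemma penalty_bound:
  fixes x :: "real^'d"
  assumes "\<delta> > 0"
  shows "K * norm ((2 * \<delta>) *\<^sub>R x, (2 * \<delta>) *\<^sub>R (mat 1 :: real^'d^'d)) \<le> penalty_const * (\<delta> + \<delta> * norm x)"
proof -
  define N where "N = norm (mat 1 :: real^'d^'d)"
  have N: "N \<ge> 0" by (simp add: N_def)
  have "norm ((2 * \<delta>) *\<^sub>R x, (2 * \<delta>) *\<^sub>R (mat 1 :: real^'d^'d)) \<le> 2 * \<delta> * norm x + 2 * \<delta> * N"
    using assms by (intro order_trans[OF norm_Pair_le]) (simp add: N_def)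
  also have "\<dots> \<le> 2 * (1 + N) * (\<delta> + \<delta> * norm x)"
    using N assms by (simp add: algebra_simps)
  finally have "K * norm ((2 * \<delta>) *\<^sub>R x, (2 * \<delta>) *\<^sub>R (mat 1 :: real^'d^'d)) \<le> K * (2 * (1 + N) * (\<delta> + \<delta> * norm x))"
    using K by (rule mult_left_mono)
  then show ?thesis by (simp add: penalty_const_def N_def mult_ac)
qed

lemma A_penalty: "\<delta> > 0 \<Longrightarrow> A x q \<bullet> ((2 * \<delta>) *\<^sub>R x, (2 * \<delta>) *\<^sub>R mat 1) \<le> penalty_const * (\<delta> + \<delta> * norm x)"
proof -
  assume \<delta>: "\<delta> > 0"
  let ?v = "((2 * \<delta>) *\<^sub>R x, (2 * \<delta>) *\<^sub>R mat 1) :: (real^'d) \<times> (real^'d^'d)"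
  have "A x q \<bullet> ?v \<le> norm (A x q) * norm ?v" by (rule norm_cauchy_schwarz)
  also have "\<dots> \<le> K * norm ?v" by (intro mult_right_mono A_bound) simp
  also have "\<dots> \<le> penalty_const * (\<delta> + \<delta> * norm x)" by (rule penalty_bound[OF \<delta>])
  finally show ?thesis .
qed

text \<open>Subtracting the step for \<open>w\<close> from the subsolution inequality for
  \<open>v\<close> cancels \<open>L\<close> and leaves a linear inequality for \<open>v - w\<close>
  with the elliptic coefficient \<open>A\<close> at the jet of \<open>v\<close>. The maximum
  principle applies to it.\<close>

lemma policy_improvement:
  assumes v: "C2_with v g G" "\<And>x. \<bar>v x\<bar> \<le> B" "\<And>x. \<rho> * v x \<le> L x (g x, G x)"
    and w: "C2_with w g' G'" "\<And>x. \<bar>w x\<bar> \<le> B"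
      "\<And>x. \<rho> * w x = L x (g x, G x) + A x (g x, G x) \<bullet> ((g' x, G' x) - (g x, G x))"
  shows "v x \<le> w x"
proof -
  have "v y - w y \<le> 0" for y
  proof (rule nonpos_of_penalised_max[where f="\<lambda>x. v x - w x" and B="B + B", OF _ _ \<rho> penalty_const_nonneg])
    show "continuous_on UNIV (\<lambda>x. v x - w x)"
      by (intro continuous_intros C2_with_deriv[OF v(1)] C2_with_deriv[OF w(1)])
    show "\<bar>v x - w x\<bar> \<le> B + B" for x using v(2)[of x] w(2)[of x] by linarith
    fix \<delta> x assume \<delta>: "\<delta> > 0" and max: "\<And>y. v y - w y - \<delta> * (y \<bullet> y) \<le> v x - w x - \<delta> * (x \<bullet> x)"
    have C2: "C2_with (\<lambda>x. v x - w x - \<delta> * (x \<bullet> x)) (\<lambda>x. g x - g' x - (2 * \<delta>) *\<^sub>R x)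
        (\<lambda>x. G x - G' x - (2 * \<delta>) *\<^sub>R mat 1)"
      by (intro C2_with_diff C2_with_sqnorm v w)
    have ev: "\<forall>\<^sub>F y in nhds x. v y - w y - \<delta> * (y \<bullet> y) \<le> v x - w x - \<delta> * (x \<bullet> x)"
      by (intro always_eventually allI max)
    have grad: "g x - g' x = (2 * \<delta>) *\<^sub>R x" using C2_with_at_max(1)[OF C2 ev] by simp
    have hess: "e \<bullet> ((G x - G' x - (2 * \<delta>) *\<^sub>R mat 1) *v e) \<le> 0" for e
      using C2_with_at_max(2)[OF C2 ev] .
    have "\<rho> * (v x - w x) \<le> A x (g x, G x) \<bullet> (g x - g' x, G x - G' x)"
      using v(3)[of x] w(3)[of x] by (simp add: right_diff_distrib inner_prod_def inner_diff_right)
    also have "\<dots> \<le> A x (g x, G x) \<bullet> (g x - g' x, (2 * \<delta>) *\<^sub>R mat 1)"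
      by (rule A_mono[OF hess])
    also have "\<dots> \<le> penalty_const * (\<delta> + \<delta> * norm x)"
      unfolding grad by (rule A_penalty[OF \<delta>])
    finally show "\<rho> * (v x - w x) \<le> penalty_const * (\<delta> + \<delta> * norm x)" .
  qed
  from this[of x] show ?thesis by simp
qed

text \<open>Since one of the two solutions is classical, \<open>v\<close> plus or minus the penalty
  \<delta>|x|^2 is an admissible test function, and doubling of variables is avoided. The Lipschitz
  bound on \<open>L\<close> absorbs the jet of the penalty.\<close>

lemma viscosity_solution_unique:
  assumes w: "continuous_on UNIV w" "\<And>x. \<bar>w x\<bar> \<le> B"
    and sub: "\<And>\<phi> g G x. C2_with \<phi> g G \<Longrightarrow> (\<And>y. w y - \<phi> y \<le> w x - \<phi> x) \<Longrightarrow> \<rho> * w x \<le> L x (g x, G x)"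
    and super: "\<And>\<phi> g G x. C2_with \<phi> g G \<Longrightarrow> (\<And>y. w y - \<phi> y \<ge> w x - \<phi> x) \<Longrightarrow> \<rho> * w x \<ge> L x (g x, G x)"
    and v: "C2_with v g G" "\<And>x. \<bar>v x\<bar> \<le> B" "\<And>x. \<rho> * v x = L x (g x, G x)"
  shows "w x = v x"
proof -
  have L_le: "\<bar>L x (g x + s *\<^sub>R x, G x + s *\<^sub>R mat 1) - L x (g x, G x)\<bar> \<le> penalty_const * (\<delta> + \<delta> * norm x)"
    if "\<delta> > 0" "\<bar>s\<bar> = 2 * \<delta>" for \<delta> s x
  proof -
    have "\<bar>L x (g x + s *\<^sub>R x, G x + s *\<^sub>R mat 1) - L x (g x, G x)\<bar>
        \<le> K * norm ((g x + s *\<^sub>R x, G x + s *\<^sub>R mat 1) - (g x, G x))"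
      by (rule L_lipschitz)
    also have "norm ((g x + s *\<^sub>R x, G x + s *\<^sub>R mat 1) - (g x, G x))
        = norm ((2 * \<delta>) *\<^sub>R x, (2 * \<delta>) *\<^sub>R (mat 1 :: real^'d^'d))"
      using that by (simp add: norm_Pair)
    also have "K * norm ((2 * \<delta>) *\<^sub>R x, (2 * \<delta>) *\<^sub>R (mat 1 :: real^'d^'d)) \<le> penalty_const * (\<delta> + \<delta> * norm x)"
      by (rule penalty_bound[OF that(1)])
    finally show ?thesis .
  qed
  have bd: "\<bar>w x - v x\<bar> \<le> B + B" "\<bar>v x - w x\<bar> \<le> B + B" for x using w(2)[of x] v(2)[of x] by linarith+
  have "w y - v y \<le> 0" for y
  proof (rule nonpos_of_penalised_max[where f="\<lambda>x. w x - v x", OF _ bd(1) \<rho> penalty_const_nonneg])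
    show "continuous_on UNIV (\<lambda>x. w x - v x)"
      by (intro continuous_intros w C2_with_deriv[OF v(1)])
    fix \<delta> x assume \<delta>: "\<delta> > 0" and max: "\<And>y. w y - v y - \<delta> * (y \<bullet> y) \<le> w x - v x - \<delta> * (x \<bullet> x)"
    have "C2_with (\<lambda>x. v x + \<delta> * (x \<bullet> x)) (\<lambda>x. g x + (2 * \<delta>) *\<^sub>R x) (\<lambda>x. G x + (2 * \<delta>) *\<^sub>R mat 1)"
      by (intro C2_with_add C2_with_sqnorm v)
    then have "\<rho> * w x \<le> L x (g x + (2 * \<delta>) *\<^sub>R x, G x + (2 * \<delta>) *\<^sub>R mat 1)"
      by (rule sub) (use max in \<open>simp add: diff_diff_eq\<close>)
    then show "\<rho> * (w x - v x) \<le> penalty_const * (\<delta> + \<delta> * norm x)"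
      using L_le[OF \<delta>, of "2 * \<delta>" x] v(3)[of x] \<delta> by (simp add: right_diff_distrib abs_le_iff)
  qed
  moreover have "v y - w y \<le> 0" for y
  proof (rule nonpos_of_penalised_max[where f="\<lambda>x. v x - w x", OF _ bd(2) \<rho> penalty_const_nonneg])
    show "continuous_on UNIV (\<lambda>x. v x - w x)"
      by (intro continuous_intros w C2_with_deriv[OF v(1)])
    fix \<delta> x assume \<delta>: "\<delta> > 0" and max: "\<And>y. v y - w y - \<delta> * (y \<bullet> y) \<le> v x - w x - \<delta> * (x \<bullet> x)"
    have "C2_with (\<lambda>x. v x + (- \<delta>) * (x \<bullet> x)) (\<lambda>x. g x + (2 * - \<delta>) *\<^sub>R x) (\<lambda>x. G x + (2 * - \<delta>) *\<^sub>R mat 1)"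
      by (intro C2_with_add C2_with_sqnorm v)
    then have "\<rho> * w x \<ge> L x (g x + (2 * - \<delta>) *\<^sub>R x, G x + (2 * - \<delta>) *\<^sub>R mat 1)"
    proof (rule super)
      show "w x - (v x + - \<delta> * (x \<bullet> x)) \<le> w y - (v y + - \<delta> * (y \<bullet> y))" for y
        using max[of y] by simp
    qed
    then show "\<rho> * (v x - w x) \<le> penalty_const * (\<delta> + \<delta> * norm x)"
      using L_le[OF \<delta>, of "2 * - \<delta>" x] v(3)[of x] \<delta> by (simp add: right_diff_distrib abs_le_iff)
  qed
  ultimately show ?thesis by (meson antisym diff_le_0_iff_le)
qed

end

section \<open>Convergence of policy iteration\<close>

text \<open>The member \<open>v n\<close> of the sequence is \<open>v\<^sup>n\<^sup>+\<^sup>1\<close> in the algorithm, because \<open>v\<^sup>0\<close> is merely of class \<open>C\<^sup>2\<close>.\<close>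

locale policy_sequence = elliptic_control M lam K \<alpha> r a c \<rho>
  for M :: "'u measure" and lam K \<alpha> and r :: "real^'d::finite \<Rightarrow> 'u \<Rightarrow> real"
    and a :: "real^'d \<Rightarrow> 'u \<Rightarrow> (real^'d) \<times> (real^'d^'d)" and c \<rho> +
  fixes v :: "nat \<Rightarrow> real^'d \<Rightarrow> real" and g :: "nat \<Rightarrow> real^'d \<Rightarrow> real^'d"
    and G :: "nat \<Rightarrow> real^'d \<Rightarrow> real^'d^'d" and B :: real
  assumes C2: "\<And>n. C2_with (v n) (g n) (G n)"
    and v_bound: "\<And>n x. \<bar>v n x\<bar> \<le> B" and g_bound: "\<And>n x. norm (g n x) \<le> B"
    and G_bound: "\<And>n x. norm (G n x) \<le> B"
    and G_hoelder: "\<And>n x y. norm (G n x - G n y) \<le> B * norm (x - y) powr \<alpha>"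
    and subsolution: "\<And>n x. \<rho> * v n x \<le> L x (g n x, G n x)"
    and policy_step: "\<And>n x. \<rho> * v (Suc n) x =
      L x (g n x, G n x) + A x (g n x, G n x) \<bullet> ((g (Suc n) x, G (Suc n) x) - (g n x, G n x))"
begin

lemma B_nonneg: "B \<ge> 0"
  using v_bound[of 0 0] by linarith

lemma v_mono: "v n x \<le> v (Suc n) x"
  by (rule policy_improvement[OF C2 v_bound subsolution C2 v_bound policy_step])

definition w :: "real^'d \<Rightarrow> real" where "w x = lim (\<lambda>n. v n x)"

lemma v_tendsto: "(\<lambda>n. v n x) \<longlonglongrightarrow> w x"
proof -
  have "incseq (\<lambda>n. v n x)" by (intro incseq_SucI v_mono)
  moreover have "v n x \<le> B" for n using v_bound[of n x] by linarith
  ultimately have "convergent (\<lambda>n. v n x)" using incseq_convergent by (metis convergentI)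
  then show ?thesis by (simp add: w_def convergent_LIMSEQ_iff)
qed

text \<open>Fixing the derivatives through \<open>grad\<close> and \<open>hess\<close> gives names
  to the limits whose existence the compactness argument supplies; \<open>C2_with_grad_hess\<close>
  matches the two.\<close>

definition gw :: "real^'d \<Rightarrow> real^'d" where "gw = grad w"
definition Gw :: "real^'d \<Rightarrow> real^'d^'d" where "Gw = hess w"

lemma w_C2: "C2_with w gw Gw"
  and v_uniform_limit: "uniform_limit (cball 0 R) v w sequentially"
  and g_uniform_limit: "uniform_limit (cball 0 R) g gw sequentially"
  and G_uniform_limit: "uniform_limit (cball 0 R) G Gw sequentially"
proof -
  have "C2_with w gw Gw \<and> (\<forall>R. uniform_limit (cball 0 R) v w sequentially \<and>
    uniform_limit (cball 0 R) g gw sequentially \<and> uniform_limit (cball 0 R) G Gw sequentially)"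
    by (rule C2_with_convergence[of v g G B w, OF C2 v_bound g_bound G_bound
          equicontinuous_of_Hoelder[OF \<alpha>(1) G_hoelder] v_tendsto])
      (auto simp: gw_def Gw_def C2_with_grad_hess)
  then show "C2_with w gw Gw" "uniform_limit (cball 0 R) v w sequentially"
    "uniform_limit (cball 0 R) g gw sequentially" "uniform_limit (cball 0 R) G Gw sequentially"
    by blast+
qed

lemma g_tendsto: "(\<lambda>n. g n x) \<longlonglongrightarrow> gw x"
  using tendsto_uniform_limitI[OF g_uniform_limit[of "norm x"]] by simp

lemma G_tendsto: "(\<lambda>n. G n x) \<longlonglongrightarrow> Gw x"
  using tendsto_uniform_limitI[OF G_uniform_limit[of "norm x"]] by simp

lemma w_bound: "\<bar>w x\<bar> \<le> B" and gw_bound: "norm (gw x) \<le> B" and Gw_bound: "norm (Gw x) \<le> B"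
  and Gw_hoelder: "norm (Gw x - Gw y) \<le> B * norm (x - y) powr \<alpha>"
proof -
  have ev: "\<forall>\<^sub>F n in sequentially. \<bar>v n x\<bar> \<le> B" "\<forall>\<^sub>F n in sequentially. norm (g n x) \<le> B"
    "\<forall>\<^sub>F n in sequentially. norm (G n x) \<le> B"
    "\<forall>\<^sub>F n in sequentially. norm (G n x - G n y) \<le> B * norm (x - y) powr \<alpha>"
    by (simp_all add: v_bound g_bound G_bound G_hoelder)
  show "\<bar>w x\<bar> \<le> B" by (rule tendsto_upperbound[OF tendsto_rabs[OF v_tendsto] ev(1)]) simp
  show "norm (gw x) \<le> B" by (rule tendsto_upperbound[OF tendsto_norm[OF g_tendsto] ev(2)]) simp
  show "norm (Gw x) \<le> B" by (rule tendsto_upperbound[OF tendsto_norm[OF G_tendsto] ev(3)]) simp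
  show "norm (Gw x - Gw y) \<le> B * norm (x - y) powr \<alpha>"
    by (rule tendsto_upperbound[OF tendsto_norm[OF tendsto_diff[OF G_tendsto G_tendsto]] ev(4)]) simp
qed

text \<open>The Newton correction pairs a bounded coefficient with the difference of consecutive
  jets, which tends to zero, while \<open>L x\<close> is Lipschitz in the jet.\<close>

lemma limit_equation: "\<rho> * w x = L x (gw x, Gw x)"
proof -
  let ?j = "\<lambda>n. (g n x, G n x)"
  have j: "?j \<longlonglongrightarrow> (gw x, Gw x)" by (intro tendsto_Pair g_tendsto G_tendsto)
  have "(\<lambda>n. \<rho> * v (Suc n) x - L x (gw x, Gw x)) \<longlonglongrightarrow> 0"
  proof (rule Lim_null_comparison)
    show "\<forall>\<^sub>F n in sequentially. norm (\<rho> * v (Suc n) x - L x (gw x, Gw x))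
        \<le> K * norm (?j n - (gw x, Gw x)) + K * norm (?j (Suc n) - ?j n)"
    proof (intro always_eventually allI)
      fix n
      have "\<bar>A x (?j n) \<bullet> (?j (Suc n) - ?j n)\<bar> \<le> norm (A x (?j n)) * norm (?j (Suc n) - ?j n)"
        by (rule Cauchy_Schwarz_ineq2)
      also have "\<dots> \<le> K * norm (?j (Suc n) - ?j n)" by (intro mult_right_mono A_bound) simp
      finally show "norm (\<rho> * v (Suc n) x - L x (gw x, Gw x))
        \<le> K * norm (?j n - (gw x, Gw x)) + K * norm (?j (Suc n) - ?j n)"
        using L_lipschitz[of x "?j n" "(gw x, Gw x)"] policy_step[of n x] by simp
    qed
    have "(\<lambda>n. K * norm (?j n - (gw x, Gw x)) + K * norm (?j (Suc n) - ?j n))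
        \<longlonglongrightarrow> K * norm ((gw x, Gw x) - (gw x, Gw x)) + K * norm ((gw x, Gw x) - (gw x, Gw x))"
      by (intro tendsto_intros j LIMSEQ_Suc[OF j])
    then show "(\<lambda>n. K * norm (?j n - (gw x, Gw x)) + K * norm (?j (Suc n) - ?j n)) \<longlonglongrightarrow> 0" by simp
  qed
  then have "(\<lambda>n. \<rho> * v (Suc n) x) \<longlonglongrightarrow> L x (gw x, Gw x)" by (rule LIM_zero_cancel)
  moreover have "(\<lambda>n. \<rho> * v (Suc n) x) \<longlonglongrightarrow> \<rho> * w x"
    by (intro tendsto_intros LIMSEQ_Suc v_tendsto)
  ultimately show ?thesis using LIMSEQ_unique by blast
qed

lemma jet_bound: "norm (g n x, G n x) \<le> 2 * B" "norm (gw x, Gw x) \<le> 2 * B"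
  using norm_Pair_le[of "g n x" "G n x"] norm_Pair_le[of "gw x" "Gw x"]
    g_bound[of n x] G_bound[of n x] gw_bound[of x] Gw_bound[of x] by linarith+

text \<open>Of the constant \<open>3 * B\<close>, the gradient takes \<open>2 * B\<close>, being
  bounded and Lipschitz, and the Hessian takes \<open>B\<close>.\<close>

lemma jet_hoelder:
  "norm ((g n x, G n x) - (g n y, G n y)) \<le> 3 * B * norm (x - y) powr \<alpha>"
  "norm ((gw x, Gw x) - (gw y, Gw y)) \<le> 3 * B * norm (x - y) powr \<alpha>"
proof -
  have "norm (g n x - g n y) \<le> 2 * B * norm (x - y) powr \<alpha>"
    by (rule Hoelder_of_Lipschitz[OF \<alpha> g_bound C2_with_grad_lipschitz[OF C2 convex_UNIV G_bound UNIV_I UNIV_I]])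
  then show "norm ((g n x, G n x) - (g n y, G n y)) \<le> 3 * B * norm (x - y) powr \<alpha>"
    using norm_Pair_le[of "g n x - g n y" "G n x - G n y"] G_hoelder[of n x y] by simp
  have "norm (gw x - gw y) \<le> 2 * B * norm (x - y) powr \<alpha>"
    by (rule Hoelder_of_Lipschitz[OF \<alpha> gw_bound C2_with_grad_lipschitz[OF w_C2 convex_UNIV Gw_bound UNIV_I UNIV_I]])
  then show "norm ((gw x, Gw x) - (gw y, Gw y)) \<le> 3 * B * norm (x - y) powr \<alpha>"
    using norm_Pair_le[of "gw x - gw y" "Gw x - Gw y"] Gw_hoelder[of x y] by simp
qed

section \<open>Blow-up of the errors\<close>

lemma error_C2: "C2_with (\<lambda>x. v n x - w x) (\<lambda>x. g n x - gw x) (\<lambda>x. G n x - Gw x)"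
  by (intro C2_with_diff C2 w_C2)

lemma error_hessian_hoelder:
  "norm ((G n x - Gw x) - (G n y - Gw y)) \<le> 2 * B * norm (x - y) powr \<alpha>"
proof -
  have "norm ((G n x - Gw x) - (G n y - Gw y)) = norm ((G n x - G n y) - (Gw x - Gw y))"
    by (simp add: algebra_simps)
  then show ?thesis
    using norm_triangle_ineq4[of "G n x - G n y" "Gw x - Gw y"] G_hoelder[of n x y] Gw_hoelder[of x y] by linarith
qed

lemma error_grad_lipschitz: "norm ((g n x - gw x) - (g n y - gw y)) \<le> 2 * B * norm (x - y)"
proof (rule C2_with_grad_lipschitz[OF error_C2 convex_UNIV _ UNIV_I UNIV_I])
  show "norm (G n x - Gw x) \<le> 2 * B" for x
    using norm_triangle_ineq4[of "G n x" "Gw x"] G_bound[of n x] Gw_bound[of x] by linarith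
qed

lemma error_lipschitz: "\<bar>(v n x - w x) - (v n y - w y)\<bar> \<le> 2 * B * norm (x - y)"
proof (rule C2_with_lipschitz[OF error_C2 convex_UNIV _ UNIV_I UNIV_I])
  show "norm (g n x - gw x) \<le> 2 * B" for x
    using norm_triangle_ineq4[of "g n x" "gw x"] g_bound[of n x] gw_bound[of x] by linarith
qed

text \<open>Provides the equation of the blow-up limit: the second order part of the linearised
  operator, frozen at the limit \<open>x\<close> of the centres, annihilates the rescaled Hessians
  asymptotically. The terms with the error and its gradient are of size \<open>h k\<close>, hence
  \<open>h k powr (1 - \<alpha>)\<close> after scaling.\<close>

lemma linearised_blow_up:
  assumes h: "\<And>k. h k > 0" "h \<longlonglongrightarrow> 0" and m: "filterlim m at_top sequentially"
    and X: "\<And>k. X k \<in> cball 0 R" "X \<longlonglongrightarrow> x"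
  shows "(\<lambda>k. snd (A x (gw x, Gw x)) \<bullet> (h k powr - \<alpha> *\<^sub>R
    ((G (Suc (m k)) (X k + h k *\<^sub>R z) - Gw (X k + h k *\<^sub>R z)) - (G (Suc (m k)) (X k) - Gw (X k))))) \<longlonglongrightarrow> 0"
proof -
  define Y where "Y k = X k + h k *\<^sub>R z" for k
  define T where "T k = A (X k) (gw (X k), Gw (X k))" for k
  define D where "D k x = G (Suc (m k)) x - Gw x" for k x
  define \<gamma> where "\<gamma> k x = g (Suc (m k)) x - gw x" for k x
  define H where "H k = h k powr - \<alpha> *\<^sub>R (D k (Y k) - D k (X k))" for k
  define \<eta> where "\<eta> k = h k powr \<alpha>" for k
  define Z where "Z = norm z powr \<alpha>"
  have Z: "Z \<ge> 0" by (simp add: Z_def)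
  \<comment> \<open>Dominates simultaneously the distance \<open>Z\<close>, the bound
    \<open>2 * B\<close> on the jets and their scaled increments \<open>3 * B * Z\<close>, as
    \<open>linearised_oscillation\<close> asks for a single radius.\<close>
  define R1 where "R1 = 2 * B + (1 + 3 * B) * Z"
  have B: "B \<ge> 0" by (rule B_nonneg)
  have R1: "Z \<le> R1" "2 * B \<le> R1" "3 * B * Z \<le> R1" using B Z by (simp_all add: R1_def algebra_simps)
  have \<eta>: "\<eta> k > 0" for k using h(1)[of k] by (simp add: \<eta>_def)
  have XY: "norm (Y k - X k) = h k * norm z" for k using h(1)[of k] by (simp add: Y_def)
  have XY\<alpha>: "norm (Y k - X k) powr \<alpha> = Z * \<eta> k" for k
    using h(1)[of k] by (simp add: XY powr_mult Z_def \<eta>_def mult.commute)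
  define C where "C = 2 * osc_const R1 + lip_const * R1 + hoelder_const R1 * R1"
  define j where "j n x = (g n x, G n x)" for n x
  define s where "s x = (gw x, Gw x)" for x
  define N1 where "N1 k = norm (j (Suc (m k)) (X k) - j (m k) (X k))" for k
  define N2 where "N2 k = norm (j (m k) (X k) - s (X k))" for k
  have step: "policy_op x (j n x) (j (Suc n) x) = \<rho> * v (Suc n) x" for n x
    by (simp only: policy_op_def j_def policy_step)
  have limit: "L x (s x) = \<rho> * w x" for x by (simp only: s_def limit_equation)
  \<comment> \<open>The oscillation estimate is divided by \<open>\<eta> k\<close>, the power
    \<alpha> of the scale. Its quadratic remainder keeps a factor composed of the scale and of the
    gaps \<open>N1\<close> and \<open>N2\<close>.\<close>
  have key: "\<bar>snd (T k) \<bullet> H k\<bar> \<le> (K + \<rho>) * 2 * B * norm z * h k powr (1 - \<alpha>) + C * (\<eta> k + N1 k + N2 k)" for k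
  proof -
    have scale: "a \<le> R1 * \<eta> k" if "a \<le> 3 * B * norm (Y k - X k) powr \<alpha>" for a
    proof -
      have "a \<le> 3 * B * Z * \<eta> k" using that by (simp add: XY\<alpha> mult.assoc)
      also have "\<dots> \<le> R1 * \<eta> k" using R1(3) \<eta>[of k] by (intro mult_right_mono) auto
      finally show ?thesis .
    qed
    have "\<bar>A (X k) (s (X k)) \<bullet> ((j (Suc (m k)) (Y k) - s (Y k)) - (j (Suc (m k)) (X k) - s (X k)))\<bar>
      \<le> \<bar>policy_op (Y k) (j (m k) (Y k)) (j (Suc (m k)) (Y k)) - L (Y k) (s (Y k))
         - (policy_op (X k) (j (m k) (X k)) (j (Suc (m k)) (X k)) - L (X k) (s (X k)))\<bar> + C * \<eta> k * (\<eta> k + N1 k + N2 k)"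
      unfolding N1_def N2_def C_def
    proof (rule linearised_oscillation)
      show "norm (Y k - X k) powr \<alpha> \<le> R1 * \<eta> k"
        using mult_right_mono[OF R1(1), of "\<eta> k"] \<eta>[of k] by (simp add: XY\<alpha>)
      show "norm (j (m k) (Y k) - j (m k) (X k)) \<le> R1 * \<eta> k"
        "norm (j (Suc (m k)) (Y k) - j (Suc (m k)) (X k)) \<le> R1 * \<eta> k"
        unfolding j_def by (rule scale[OF jet_hoelder(1)])+
      show "norm (s (Y k) - s (X k)) \<le> R1 * \<eta> k" unfolding s_def by (rule scale[OF jet_hoelder(2)])
      show "norm (j (m k) (X k)) \<le> R1" "norm (s (X k)) \<le> R1"
        unfolding j_def s_def using jet_bound R1(2) order_trans by blast+
    qed (use \<eta>[of k] in simp)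
    also have "A (X k) (s (X k)) \<bullet> ((j (Suc (m k)) (Y k) - s (Y k)) - (j (Suc (m k)) (X k) - s (X k)))
        = fst (T k) \<bullet> (\<gamma> k (Y k) - \<gamma> k (X k)) + snd (T k) \<bullet> (D k (Y k) - D k (X k))"
      by (simp add: T_def D_def \<gamma>_def j_def s_def inner_prod_def)
    finally have "\<bar>fst (T k) \<bullet> (\<gamma> k (Y k) - \<gamma> k (X k)) + snd (T k) \<bullet> (D k (Y k) - D k (X k))\<bar>
      \<le> \<bar>\<rho> * ((v (Suc (m k)) (Y k) - w (Y k)) - (v (Suc (m k)) (X k) - w (X k)))\<bar> + C * \<eta> k * (\<eta> k + N1 k + N2 k)"
      by (simp add: step limit right_diff_distrib)
    moreover have "\<bar>\<rho> * ((v (Suc (m k)) (Y k) - w (Y k)) - (v (Suc (m k)) (X k) - w (X k)))\<bar> \<le> \<rho> * (2 * B * (h k * norm z))"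
      using error_lipschitz[of "Suc (m k)" "Y k" "X k"] \<rho> by (simp add: abs_mult XY)
    moreover have "\<bar>fst (T k) \<bullet> (\<gamma> k (Y k) - \<gamma> k (X k))\<bar> \<le> K * (2 * B * (h k * norm z))"
    proof -
      have "\<bar>fst (T k) \<bullet> (\<gamma> k (Y k) - \<gamma> k (X k))\<bar> \<le> norm (fst (T k)) * norm (\<gamma> k (Y k) - \<gamma> k (X k))"
        by (rule Cauchy_Schwarz_ineq2)
      also have "\<dots> \<le> K * (2 * B * (h k * norm z))"
        using order_trans[OF norm_fst_le[of "fst (T k)" "snd (T k)"], of K] A_bound[of "X k" "(gw (X k), Gw (X k))"]
          error_grad_lipschitz[of "Suc (m k)" "Y k" "X k"] K
        by (intro mult_mono) (auto simp: T_def \<gamma>_def XY)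
      finally show ?thesis .
    qed
    ultimately have "\<bar>snd (T k) \<bullet> (D k (Y k) - D k (X k))\<bar>
        \<le> (K + \<rho>) * 2 * B * norm z * h k + \<eta> k * (C * (\<eta> k + N1 k + N2 k))"
      by (simp add: algebra_simps)
    then have "h k powr - \<alpha> * \<bar>snd (T k) \<bullet> (D k (Y k) - D k (X k))\<bar>
        \<le> h k powr - \<alpha> * ((K + \<rho>) * 2 * B * norm z * h k + \<eta> k * (C * (\<eta> k + N1 k + N2 k)))"
      by (intro mult_left_mono) auto
    moreover have "h k powr - \<alpha> * h k = h k powr (1 - \<alpha>)"
      using h(1)[of k] by (simp add: powr_diff powr_minus field_simps)
    moreover have "h k powr - \<alpha> * \<eta> k = 1"
      using h(1)[of k] by (simp add: \<eta>_def flip: powr_add)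
    moreover have "h k powr - \<alpha> * (a * h k + \<eta> k * b) = a * (h k powr - \<alpha> * h k) + (h k powr - \<alpha> * \<eta> k) * b" for a b
      by (simp add: algebra_simps)
    ultimately show ?thesis by (simp add: H_def abs_mult)
  qed
  have Suc_m: "filterlim (\<lambda>k. Suc (m k)) at_top sequentially"
    using filterlim_compose[OF filterlim_Suc m] .
  \<comment> \<open>The centres \<open>X k\<close> move, so pointwise convergence of the jets would
    not do; they stay in a fixed ball, where the convergence is uniform.\<close>
  have lim: "(\<lambda>k. norm (j (n k) (X k) - s (X k))) \<longlonglongrightarrow> 0" if "filterlim n at_top sequentially" for n
  proof (rule Lim_null_comparison)
    show "\<forall>\<^sub>F k in sequentially. norm (norm (j (n k) (X k) - s (X k)))
        \<le> norm (g (n k) (X k) - gw (X k)) + norm (G (n k) (X k) - Gw (X k))"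
      unfolding j_def s_def by (simp add: norm_Pair_le)
    show "(\<lambda>k. norm (g (n k) (X k) - gw (X k)) + norm (G (n k) (X k) - Gw (X k))) \<longlonglongrightarrow> 0"
      using tendsto_add[OF uniform_limit_moving_points[OF g_uniform_limit that X(1)]
          uniform_limit_moving_points[OF G_uniform_limit that X(1)]] by simp
  qed
  have N2: "N2 \<longlonglongrightarrow> 0" unfolding N2_def by (rule lim[OF m])
  have N1: "N1 \<longlonglongrightarrow> 0"
  proof (rule Lim_null_comparison)
    show "\<forall>\<^sub>F k in sequentially. norm (N1 k) \<le> norm (j (Suc (m k)) (X k) - s (X k)) + N2 k"
    proof (intro always_eventually allI)
      fix k
      show "norm (N1 k) \<le> norm (j (Suc (m k)) (X k) - s (X k)) + N2 k"
        using norm_triangle_ineq4[of "j (Suc (m k)) (X k) - s (X k)" "j (m k) (X k) - s (X k)"]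
        by (simp add: N1_def N2_def)
    qed
    show "(\<lambda>k. norm (j (Suc (m k)) (X k) - s (X k)) + N2 k) \<longlonglongrightarrow> 0"
      using tendsto_add[OF lim[OF Suc_m] N2] by simp
  qed
  have h_nonneg: "\<forall>\<^sub>F k in sequentially. 0 \<le> h k" by (intro always_eventually allI less_imp_le h(1))
  have \<eta>0: "\<eta> \<longlonglongrightarrow> 0" unfolding \<eta>_def
    by (rule tendsto_zero_powrI[OF h(2) tendsto_const h_nonneg \<alpha>(1)])
  have h0: "(\<lambda>k. h k powr (1 - \<alpha>)) \<longlonglongrightarrow> 0"
    by (rule tendsto_zero_powrI[OF h(2) tendsto_const h_nonneg]) (use \<alpha> in simp)
  have TH: "(\<lambda>k. snd (T k) \<bullet> H k) \<longlonglongrightarrow> 0"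
  proof (rule Lim_null_comparison)
    show "\<forall>\<^sub>F k in sequentially. norm (snd (T k) \<bullet> H k)
        \<le> (K + \<rho>) * 2 * B * norm z * h k powr (1 - \<alpha>) + C * (\<eta> k + N1 k + N2 k)"
      using key by simp
    have "(\<lambda>k. (K + \<rho>) * 2 * B * norm z * h k powr (1 - \<alpha>) + C * (\<eta> k + N1 k + N2 k))
      \<longlonglongrightarrow> (K + \<rho>) * 2 * B * norm z * 0 + C * (0 + 0 + 0)"
      by (intro tendsto_intros h0 \<eta>0 N1 N2)
    then show "(\<lambda>k. (K + \<rho>) * 2 * B * norm z * h k powr (1 - \<alpha>) + C * (\<eta> k + N1 k + N2 k)) \<longlonglongrightarrow> 0"
      by simp
  qed
  \<comment> \<open>The coefficients have been frozen at \<open>X k\<close> so far. Replacing them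
    by the value at the limit point costs a null sequence times the bounded
    \<open>H k\<close>.\<close>
  let ?A = "A x (gw x, Gw x)"
  have "T \<longlonglongrightarrow> ?A"
    unfolding T_def
  proof (rule A_tendsto[OF \<alpha>(1) X(2)], rule tendsto_Pair)
    show "(\<lambda>k. gw (X k)) \<longlonglongrightarrow> gw x" "(\<lambda>k. Gw (X k)) \<longlonglongrightarrow> Gw x"
      by (rule continuous_on_tendsto_compose[OF C2_with_deriv(4)[OF w_C2] X(2)]; simp)
        (rule continuous_on_tendsto_compose[OF C2_with_deriv(5)[OF w_C2] X(2)]; simp)
  qed
  then have T0: "(\<lambda>k. norm (snd ?A - snd (T k))) \<longlonglongrightarrow> 0"
    using tendsto_norm_zero[OF LIM_zero[OF tendsto_snd]] by (subst norm_minus_commute) blast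
  have H_bound: "norm (H k) \<le> 2 * B * Z" for k
  proof -
    have "norm (H k) \<le> h k powr - \<alpha> * (2 * B * (Z * \<eta> k))"
      using error_hessian_hoelder[of "Suc (m k)" "Y k" "X k"]
      by (simp add: H_def D_def XY\<alpha> mult_left_mono)
    also have "\<dots> = (h k powr - \<alpha> * \<eta> k) * (2 * B * Z)" by (simp add: mult_ac)
    also have "h k powr - \<alpha> * \<eta> k = 1" using h(1)[of k] by (simp add: \<eta>_def flip: powr_add)
    finally show ?thesis by simp
  qed
  have "(\<lambda>k. (snd ?A - snd (T k)) \<bullet> H k) \<longlonglongrightarrow> 0"
  proof (rule Lim_null_comparison)
    show "\<forall>\<^sub>F k in sequentially. norm ((snd ?A - snd (T k)) \<bullet> H k) \<le> norm (snd ?A - snd (T k)) * (2 * B * Z)"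
    proof (intro always_eventually allI)
      fix k
      have "norm ((snd ?A - snd (T k)) \<bullet> H k) \<le> norm (snd ?A - snd (T k)) * norm (H k)"
        by (simp add: Cauchy_Schwarz_ineq2)
      also have "\<dots> \<le> norm (snd ?A - snd (T k)) * (2 * B * Z)" by (intro mult_left_mono H_bound) simp
      finally show "norm ((snd ?A - snd (T k)) \<bullet> H k) \<le> norm (snd ?A - snd (T k)) * (2 * B * Z)" .
    qed
    show "(\<lambda>k. norm (snd ?A - snd (T k)) * (2 * B * Z)) \<longlonglongrightarrow> 0"
      using tendsto_mult_left_zero[OF T0] .
  qed
  from tendsto_add[OF this TH] have "(\<lambda>k. snd ?A \<bullet> H k) \<longlonglongrightarrow> 0"
    by (simp add: inner_diff_left)
  then show ?thesis by (simp add: H_def D_def Y_def)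
qed

theorem hessian_Hoelder_convergence:
  assumes \<epsilon>: "\<epsilon> > 0"
  shows "\<exists>N. \<forall>n\<ge>N. \<forall>x\<in>cball 0 R. \<forall>y\<in>cball 0 R.
    norm ((G n x - Gw x) - (G n y - Gw y)) \<le> \<epsilon> * norm (x - y) powr \<alpha>"
proof (rule ccontr)
  define D where "D n x = G n x - Gw x" for n x
  assume "\<not> ?thesis"
  then have neg: "\<forall>N. \<exists>n\<ge>N. \<exists>x\<in>cball 0 R. \<exists>y\<in>cball 0 R. \<epsilon> * norm (x - y) powr \<alpha> < norm (D n x - D n y)"
    unfolding D_def by (meson not_le)
  \<comment> \<open>The bad index is written as a successor, because the policy step expresses the
    member \<open>Suc m\<close> through the member \<open>m\<close>.\<close>
  have "\<exists>m x y. m \<ge> k \<and> x \<in> cball 0 R \<and> y \<in> cball 0 R \<and>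
      \<epsilon> * norm (x - y) powr \<alpha> < norm (D (Suc m) x - D (Suc m) y)" for k
  proof -
    obtain n x y where "n \<ge> Suc k" "x \<in> cball 0 R" "y \<in> cball 0 R" "\<epsilon> * norm (x - y) powr \<alpha> < norm (D n x - D n y)"
      using neg by blast
    then show ?thesis by (intro exI[of _ "n - 1"] exI[of _ x] exI[of _ y]) auto
  qed
  then obtain m x y where m: "\<And>k. m k \<ge> k" and xy: "\<And>k. x k \<in> cball 0 R" "\<And>k. y k \<in> cball 0 R"
    and large: "\<And>k. \<epsilon> * norm (x k - y k) powr \<alpha> < norm (D (Suc (m k)) (x k) - D (Suc (m k)) (y k))"
    by metis
  define h where "h k = norm (y k - x k)" for k
  have h: "h k > 0" for k
    using large[of k] by (cases "x k = y k") (auto simp: h_def)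
  define e where "e k = (y k - x k) /\<^sub>R h k" for k
  have e: "e k \<in> cball 0 1" "y k = x k + h k *\<^sub>R e k" for k
    using h[of k] by (simp_all add: e_def h_def)
  \<comment> \<open>Centres and unit directions have to converge along the same subsequence.\<close>
  have comp: "compact (cball 0 R \<times> cball 0 1 :: ((real^'d) \<times> (real^'d)) set)"
    by (intro compact_Times compact_cball)
  have "\<forall>k. (x k, e k) \<in> cball 0 R \<times> cball 0 1" using xy e by auto
  from comp[unfolded compact_def, THEN spec[of _ "\<lambda>k. (x k, e k)"], THEN mp, OF this]
  obtain p l where l: "strict_mono (l :: nat \<Rightarrow> nat)" and p: "((\<lambda>k. (x k, e k)) \<circ> l) \<longlonglongrightarrow> p"
    by blast
  have X: "(\<lambda>k. x (l k)) \<longlonglongrightarrow> fst p" and E: "(\<lambda>k. e (l k)) \<longlonglongrightarrow> snd p"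
    using tendsto_fst[OF p] tendsto_snd[OF p] by (simp_all add: o_def)
  have ml: "filterlim (\<lambda>k. m (l k)) at_top sequentially"
    by (rule filterlim_at_top_mono[OF filterlim_ident])
      (auto intro!: always_eventually order_trans[OF seq_suble[OF l] m])
  have Sml: "filterlim (\<lambda>k. Suc (m (l k))) at_top sequentially"
    using filterlim_compose[OF filterlim_Suc ml] .
  \<comment> \<open>The scales tend to zero because the Hessians of the errors do so uniformly on
    the ball: a Hoelder quotient can stay large only over vanishing distances.\<close>
  have "(\<lambda>k. \<epsilon> * h (l k) powr \<alpha>) \<longlonglongrightarrow> 0"
  proof (rule Lim_null_comparison)
    show "\<forall>\<^sub>F k in sequentially. norm (\<epsilon> * h (l k) powr \<alpha>) \<le> norm (D (Suc (m (l k))) (x (l k))) + norm (D (Suc (m (l k))) (y (l k)))"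
    proof (intro always_eventually allI)
      fix k
      show "norm (\<epsilon> * h (l k) powr \<alpha>) \<le> norm (D (Suc (m (l k))) (x (l k))) + norm (D (Suc (m (l k))) (y (l k)))"
        using large[of "l k"] \<epsilon> norm_triangle_ineq4[of "D (Suc (m (l k))) (x (l k))" "D (Suc (m (l k))) (y (l k))"]
        by (simp add: h_def norm_minus_commute[of "y (l k)"])
    qed
    show "(\<lambda>k. norm (D (Suc (m (l k))) (x (l k))) + norm (D (Suc (m (l k))) (y (l k)))) \<longlonglongrightarrow> 0"
      using tendsto_add[OF uniform_limit_moving_points[OF G_uniform_limit Sml, of "\<lambda>k. x (l k)" R]
          uniform_limit_moving_points[OF G_uniform_limit Sml, of "\<lambda>k. y (l k)" R]] xy
      by (simp add: D_def)
  qed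
  then have "(\<lambda>k. inverse \<epsilon> * (\<epsilon> * h (l k) powr \<alpha>)) \<longlonglongrightarrow> 0" by (rule tendsto_mult_right_zero)
  then have "(\<lambda>k. h (l k) powr \<alpha>) \<longlonglongrightarrow> 0" using \<epsilon> by (simp flip: mult.assoc)
  then have "(\<lambda>k. (h (l k) powr \<alpha>) powr (1 / \<alpha>)) \<longlonglongrightarrow> 0"
    by (rule tendsto_zero_powrI[OF _ tendsto_const]) (use \<alpha> in simp_all)
  then have h0: "(\<lambda>k. h (l k)) \<longlonglongrightarrow> 0"
    using \<alpha> h by (simp add: powr_powr less_imp_le)
  show False
  proof (rule Hoelder_blow_up[OF error_C2 \<alpha> error_hessian_hoelder h E \<epsilon> _ A_sym c A_elliptic])
    show "\<epsilon> * h (l k) powr \<alpha> \<le> norm ((G (Suc (m (l k))) (x (l k) + h (l k) *\<^sub>R e (l k)) - Gw (x (l k) + h (l k) *\<^sub>R e (l k)))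
        - (G (Suc (m (l k))) (x (l k)) - Gw (x (l k))))" for k
      using large[of "l k"] e(2)[of "l k", symmetric]
      by (simp add: D_def h_def norm_minus_commute[of "y (l k)"] norm_minus_commute[of "G (Suc (m (l k))) (y (l k)) - Gw (y (l k))"])
    show "(\<lambda>k. snd (A (fst p) (gw (fst p), Gw (fst p))) \<bullet> (h (l k) powr - \<alpha> *\<^sub>R
        ((G (Suc (m (l k))) (x (l k) + h (l k) *\<^sub>R z) - Gw (x (l k) + h (l k) *\<^sub>R z))
        - (G (Suc (m (l k))) (x (l k)) - Gw (x (l k)))))) \<longlonglongrightarrow> 0" for z
      by (rule linearised_blow_up[OF h h0 ml _ X]) (use xy in auto)
  qed
qed

lemma limit_in_hoelder_space: "w \<in> hoelder_space 2 \<alpha> (ball 0 R)"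
proof -
  have "hoelder_norm 2 \<alpha> (ball 0 R) w \<le> ennreal (6 * B)"
    by (rule C2_with_hoelder_norm_le[OF w_C2 open_ball convex_ball B_nonneg \<alpha>(2) w_bound gw_bound Gw_bound Gw_hoelder])
  also have "\<dots> < \<infinity>" by simp
  finally show ?thesis using C2_with_imp_Ck_on[OF w_C2] by (simp add: hoelder_space_def)
qed

theorem hoelder_norm_tendsto: "(\<lambda>n. hoelder_norm 2 \<alpha> (ball 0 R) (\<lambda>x. v n x - w x)) \<longlonglongrightarrow> 0"
proof (rule tendsto_0_ennrealI)
  fix \<epsilon> :: real assume "\<epsilon> > 0"
  then have e: "\<epsilon> / 6 > 0" by simp
  have "\<forall>\<^sub>F n in sequentially. \<forall>x\<in>cball 0 R. \<forall>y\<in>cball 0 R.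
      norm ((G n x - Gw x) - (G n y - Gw y)) \<le> \<epsilon> / 6 * norm (x - y) powr \<alpha>"
    using hessian_Hoelder_convergence[OF e] by (auto simp: eventually_sequentially)
  then show "\<forall>\<^sub>F n in sequentially. hoelder_norm 2 \<alpha> (ball 0 R) (\<lambda>x. v n x - w x) \<le> ennreal \<epsilon>"
    using uniform_limitD[OF v_uniform_limit[of R] e] uniform_limitD[OF g_uniform_limit[of R] e]
      uniform_limitD[OF G_uniform_limit[of R] e]
  proof eventually_elim
    case (elim n)
    have "hoelder_norm 2 \<alpha> (ball 0 R) (\<lambda>x. v n x - w x) \<le> ennreal (6 * (\<epsilon> / 6))"
    proof (rule C2_with_hoelder_norm_le[OF error_C2 open_ball convex_ball _ \<alpha>(2)])
      fix x :: "real^'d" assume "x \<in> ball 0 R"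
      then have x: "x \<in> cball 0 R" by simp
      show "\<bar>v n x - w x\<bar> \<le> \<epsilon> / 6" "norm (g n x - gw x) \<le> \<epsilon> / 6" "norm (G n x - Gw x) \<le> \<epsilon> / 6"
        using elim x by (auto simp: dist_norm intro: less_imp_le)
      fix y :: "real^'d" assume "y \<in> ball 0 R"
      then have "y \<in> cball 0 R" by simp
      then show "norm (G n x - Gw x - (G n y - Gw y)) \<le> \<epsilon> / 6 * norm (x - y) powr \<alpha>"
        using elim x by blast
    qed (use e in simp)
    then show ?case by simp
  qed
qed

end

section \<open>The Gibbs variational principle\<close>

context entropy_control
begin

lemma ham_eq: "r x u + a x u \<bullet> q = lam * \<theta> x q u"
  using lam by (simp add: \<theta>_def)

text \<open>The logarithm of the Gibbs density is its exponent minus a constant, so reward and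
  entropy combine to an integrand affine in the jet \<open>q\<close>. Integration gives the tangent
  plane of \<open>L x\<close> at \<open>q'\<close>, which is the Newton step.\<close>

lemma policy_integral:
  "ext_integral M (\<lambda>u. ((r x u + a x u \<bullet> q) - lam * ln (gibbs (\<theta> x q') u)) * gibbs (\<theta> x q') u)
    = ereal (L x q' + A x q' \<bullet> (q - q'))"
proof -
  let ?g = "gibbs (\<theta> x q')"
  have ln: "lam * ln (?g u) = r x u + a x u \<bullet> q' - L x q'" for u
    by (simp add: ham_eq ln_gibbs[OF bdd_meas_\<theta>] L_def right_diff_distrib)
  have "((r x u + a x u \<bullet> q) - lam * ln (?g u)) * ?g u = ?g u * (a x u \<bullet> (q - q')) + L x q' * ?g u" for u
    unfolding ln by (simp add: inner_diff_right algebra_simps)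
  moreover have i1: "integrable M (\<lambda>u. ?g u * (a x u \<bullet> (q - q')))" and i2: "integrable M (\<lambda>u. L x q' * ?g u)"
    by (intro bdd_meas_integrable bdd_meas_mult bdd_meas_const bdd_meas_gibbs bdd_meas_\<theta> bdd_meas_inner)+
  ultimately show ?thesis
    using ext_integral_real[OF Bochner_Integration.integrable_add[OF i1 i2]]
    by (simp add: A_inner gibbs_integral bdd_meas_\<theta> Bochner_Integration.integral_add[OF i1 i2] add.commute)
qed

text \<open>Nonnegativity of relative entropy, proved pointwise: ln t \<le> t - 1 at the quotient of
  the Gibbs density and \<open>\<pi>\<close>. The majorant is integrable even when the entropy of
  \<open>\<pi>\<close> is not finite, and its integral is \<open>L x q\<close> because both
  densities have mass 1.\<close>

lemma policy_integral_le:
  assumes \<pi>: "\<pi> \<in> borel_measurable M" "\<And>u. u \<in> space M \<Longrightarrow> 0 \<le> \<pi> u" "(\<integral>\<^sup>+ u. ennreal (\<pi> u) \<partial>M) = 1"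
  shows "ext_integral M (\<lambda>u. ((r x u + a x u \<bullet> q) - lam * ln (\<pi> u)) * \<pi> u) \<le> ereal (L x q)"
proof -
  let ?g = "gibbs (\<theta> x q)"
  have int: "integrable M \<pi>"
    by (rule integrableI_nonneg) (use \<pi> in auto)
  have "(\<integral>u. \<pi> u \<partial>M) = 1"
    using integral_eq_nn_integral[of \<pi> M] \<pi> by auto
  moreover have intg: "integrable M ?g" by (intro bdd_meas_integrable bdd_meas_gibbs bdd_meas_\<theta>)
  ultimately have I: "(\<integral>u. lam * (?g u - \<pi> u) + L x q * \<pi> u \<partial>M) = L x q"
    using int by (simp add: gibbs_integral bdd_meas_\<theta>)
  have "ext_integral M (\<lambda>u. ((r x u + a x u \<bullet> q) - lam * ln (\<pi> u)) * \<pi> u)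
      \<le> ext_integral M (\<lambda>u. lam * (?g u - \<pi> u) + L x q * \<pi> u)"
  proof (rule ext_integral_mono)
    fix u assume u: "u \<in> space M"
    have g: "?g u > 0" by (rule gibbs_pos[OF bdd_meas_\<theta>])
    show "((r x u + a x u \<bullet> q) - lam * ln (\<pi> u)) * \<pi> u \<le> lam * (?g u - \<pi> u) + L x q * \<pi> u"
    proof (cases "\<pi> u = 0")
      case True
      then show ?thesis using g lam by simp
    next
      case False
      then have p: "\<pi> u > 0" using \<pi>(2)[OF u] by simp
      have "r x u + a x u \<bullet> q = lam * ln (?g u) + L x q"
        by (simp add: ham_eq ln_gibbs[OF bdd_meas_\<theta>] L_def right_diff_distrib)
      then have "((r x u + a x u \<bullet> q) - lam * ln (\<pi> u)) * \<pi> u = lam * (ln (?g u / \<pi> u) * \<pi> u) + L x q * \<pi> u"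
        using g p by (simp add: ln_div algebra_simps)
      also have "ln (?g u / \<pi> u) * \<pi> u \<le> (?g u / \<pi> u - 1) * \<pi> u"
        using g p by (intro mult_right_mono ln_le_minus_one) auto
      also have "(?g u / \<pi> u - 1) * \<pi> u = ?g u - \<pi> u" using p by (simp add: field_simps)
      finally show ?thesis using lam by simp
    qed
  qed
  also have "\<dots> = ereal (L x q)"
    using ext_integral_real[of "\<lambda>u. lam * (?g u - \<pi> u) + L x q * \<pi> u"] int intg I by simp
  finally show ?thesis .
qed

lemma nn_integral_gibbs: "(\<integral>\<^sup>+ u. ennreal (gibbs (\<theta> x q) u) \<partial>M) = 1"
  by (subst nn_integral_eq_integral)
    (auto simp: gibbs_integral bdd_meas_\<theta> intro!: bdd_meas_integrable bdd_meas_gibbs AE_I2 less_imp_le gibbs_pos)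

end

section \<open>The exploratory HJB equation\<close>

locale exploratory_hjb =
  fixes U :: "(real^'l::finite) set"
    and lam \<rho> \<alpha> C0 :: real
    and r :: "real^'d::finite \<Rightarrow> real^'l \<Rightarrow> real"
    and b :: "real^'d \<Rightarrow> real^'l \<Rightarrow> real^'d"
    and \<sigma> :: "real^'d \<Rightarrow> real^'l \<Rightarrow> real^'m::finite^'d"
  assumes U: "open U" "measure lebesgue U = 1" and pos: "lam > 0" "\<rho> > 0"
    and r_measurable: "\<And>x. r x \<in> borel_measurable (lebesgue_on U)"
    and b_measurable: "\<And>x. b x \<in> borel_measurable (lebesgue_on U)"
    and \<sigma>_measurable: "\<And>x. \<sigma> x \<in> borel_measurable (lebesgue_on U)"
    and \<alpha>: "0 < \<alpha>" "\<alpha> < 1" and C0: "C0 \<ge> 1"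
    and elliptic: "\<And>x u. u \<in> U \<Longrightarrow> loewner_le ((1 / C0) *\<^sub>R mat 1) (diffusion_matrix \<sigma> x u)"
    and r_norm: "\<And>u. u \<in> U \<Longrightarrow> hoelder_norm 0 \<alpha> UNIV (\<lambda>x. r x u) \<le> ennreal C0"
    and b_norm: "\<And>u. u \<in> U \<Longrightarrow> hoelder_norm 0 \<alpha> UNIV (\<lambda>x. b x u) \<le> ennreal C0"
    and \<sigma>_norm: "\<And>u. u \<in> U \<Longrightarrow> hoelder_norm 0 \<alpha> UNIV (\<lambda>x. diffusion_matrix \<sigma> x u) \<le> ennreal C0"
begin

text \<open>With the pairing of \<open>coeff x u\<close> and the jet \<open>(p, X)\<close> as inner product, the Hamiltonian is affine in the jet.\<close>

definition coeff :: "real^'d \<Rightarrow> real^'l \<Rightarrow> (real^'d) \<times> (real^'d^'d)"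
  where "coeff x u = (b x u, (1 / 2) *\<^sub>R diffusion_matrix \<sigma> x u)"

text \<open>The roots of the dimensions pass from the maximum of the entries to Euclidean norms, for
  \<open>r\<close>, \<open>b\<close> and the diffusion matrix in turn; the 2 comes from
  \<open>Hoelder_global\<close>. The sum serves as the single constant \<open>K\<close>.\<close>

definition bound :: real
  where "bound = 2 * ((1 + sqrt DIM(real^'d) + sqrt DIM(real^'d^'d)) * C0)"

lemma diffusion_matrix_sym: "transpose (diffusion_matrix \<sigma> x u) = diffusion_matrix \<sigma> x u"
  by (simp add: diffusion_matrix_def matrix_transpose_mul)

text \<open>The trace of a product equals the entrywise inner product because the diffusion matrix
  is symmetric.\<close>

lemma hamiltonian_eq: "hamiltonian r b \<sigma> x u p X = r x u + coeff x u \<bullet> (p, X)"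
proof -
  let ?S = "diffusion_matrix \<sigma> x u"
  have "trace (?S ** X) = (\<Sum>i\<in>UNIV. \<Sum>j\<in>UNIV. ?S $ i $ j * X $ j $ i)"
    by (simp add: trace_def matrix_matrix_mult_def)
  also have "\<dots> = (\<Sum>j\<in>UNIV. \<Sum>i\<in>UNIV. ?S $ i $ j * X $ j $ i)" by (rule sum.swap)
  also have "\<dots> = (\<Sum>j\<in>UNIV. \<Sum>i\<in>UNIV. ?S $ j $ i * X $ j $ i)"
    using arg_cong[OF diffusion_matrix_sym[of x u], of "\<lambda>S. S $ i $ j" for i j]
    by (simp add: transpose_def)
  also have "\<dots> = ?S \<bullet> X" by (simp add: inner_matrix_sum)
  finally show ?thesis by (simp add: hamiltonian_def coeff_def inner_prod_def)
qed

lemma diffusion_matrix_measurable: "diffusion_matrix \<sigma> x \<in> borel_measurable (lebesgue_on U)"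
proof -
  have "continuous_on UNIV (\<lambda>S :: real^'m^'d. S ** transpose S)"
    unfolding matrix_matrix_mult_def transpose_def
    by (intro continuous_on_vec_lambda continuous_intros)
  then have "(\<lambda>S :: real^'m^'d. S ** transpose S) \<in> borel_measurable borel"
    by (rule borel_measurable_continuous_onI)
  from measurable_compose[OF \<sigma>_measurable this] show ?thesis
    by (simp add: diffusion_matrix_def[abs_def])
qed

text \<open>The ellipticity constant is half of 1/C0 because \<open>coeff\<close> contains the
  factor 1/2 of the second order term.\<close>

sublocale elliptic_control "lebesgue_on U" lam bound \<alpha> r coeff "1 / (2 * C0)" \<rho>
proof -
  have lm: "U \<in> sets lebesgue" using U(1) by auto
  \<comment> \<open>\<open>measure\<close> returns 0 on sets of infinite measure, so the value 1
    determines \<open>emeasure\<close>.\<close>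
  have "emeasure lebesgue U = 1"
    using U(2) by (metis emeasure_eq_ennreal_measure ennreal_1 measure_zero_top zero_neq_one)
  then have "prob_space (lebesgue_on U)"
    using lm by (intro prob_spaceI) (simp add: space_restrict_space emeasure_restrict_space)
  then interpret prob_space "lebesgue_on U" .
  have C0': "C0 \<ge> 0" using C0 by simp
  define s where "s = 1 + sqrt DIM(real^'d) + sqrt DIM(real^'d^'d)"
  have bound: "bound = 2 * (s * C0)" by (simp add: bound_def s_def)
  have s: "s \<ge> 1" by (simp add: s_def)
  have bs: "2 * (sqrt DIM(real) * C0) \<le> bound"
    "2 * (sqrt DIM(real^'d) * C0) + 2 * (sqrt DIM(real^'d^'d) * C0) \<le> bound"
    using C0' by (auto simp: bound_def algebra_simps)
  have u: "u \<in> U" if "u \<in> space (lebesgue_on U)" for u using that by simp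
  have pair: "norm (coeff x u - coeff y u) \<le> norm (b x u - b y u) + norm (diffusion_matrix \<sigma> x u - diffusion_matrix \<sigma> y u)" for x y u
  proof -
    have "norm (coeff x u - coeff y u) \<le> norm (b x u - b y u)
        + norm ((1 / 2) *\<^sub>R (diffusion_matrix \<sigma> x u - diffusion_matrix \<sigma> y u))"
      unfolding coeff_def by (simp add: scaleR_diff_right norm_Pair_le del: norm_scaleR)
    moreover have "norm ((1 / 2) *\<^sub>R (diffusion_matrix \<sigma> x u - diffusion_matrix \<sigma> y u))
        \<le> norm (diffusion_matrix \<sigma> x u - diffusion_matrix \<sigma> y u)" by simp
    ultimately show ?thesis by linarith
  qed
  have pair0: "norm (coeff x u) \<le> norm (b x u) + norm (diffusion_matrix \<sigma> x u)" for x u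
  proof -
    have "norm (coeff x u) \<le> norm (b x u) + norm ((1 / 2) *\<^sub>R diffusion_matrix \<sigma> x u)"
      unfolding coeff_def by (rule norm_Pair_le)
    moreover have "norm ((1 / 2) *\<^sub>R diffusion_matrix \<sigma> x u) \<le> norm (diffusion_matrix \<sigma> x u)" by simp
    ultimately show ?thesis by linarith
  qed
  have nn: "0 \<le> sqrt DIM(real^'d) * C0" "0 \<le> sqrt DIM(real^'d^'d) * C0" using C0' by auto
  show "elliptic_control (lebesgue_on U) lam bound \<alpha> r coeff (1 / (2 * C0)) \<rho>"
  proof
    show "0 < lam" "0 < \<rho>" by (rule pos)+
    show "0 < \<alpha>" "\<alpha> < 1" by (rule \<alpha>)+
    show "0 < 1 / (2 * C0)" using C0 by simp
    show "0 \<le> bound" using s C0' by (simp add: bound)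
    show "r x \<in> borel_measurable (lebesgue_on U)" for x by (rule r_measurable)
    show "coeff x \<in> borel_measurable (lebesgue_on U)" for x
      unfolding coeff_def[abs_def]
      by (intro borel_measurable_Pair b_measurable borel_measurable_scaleR borel_measurable_const
          diffusion_matrix_measurable)
    fix x u assume *: "u \<in> space (lebesgue_on U)"
    note n = hoelder_norm_0_bounds[OF r_norm[OF u[OF *]] C0' \<alpha>(1)]
      hoelder_norm_0_bounds[OF b_norm[OF u[OF *]] C0' \<alpha>(1)]
      hoelder_norm_0_bounds[OF \<sigma>_norm[OF u[OF *]] C0' \<alpha>(1)]
    show "\<bar>r x u\<bar> \<le> bound" using n(1)[of x] bs(1) C0' by simp
    show "norm (coeff x u) \<le> bound" using n(3)[of x] n(5)[of x] bs(2) pair0[of x u] nn by linarith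
    show "transpose (snd (coeff x u)) = snd (coeff x u)"
      using diffusion_matrix_sym[of x u] by (simp add: coeff_def transpose_def vec_eq_iff)
    show "1 / (2 * C0) * (\<xi> \<bullet> \<xi>) \<le> \<xi> \<bullet> (snd (coeff x u) *v \<xi>)" for \<xi>
    proof -
      have "1 / C0 * (\<xi> \<bullet> \<xi>) \<le> \<xi> \<bullet> (diffusion_matrix \<sigma> x u *v \<xi>)"
        using elliptic[OF u[OF *], of x] unfolding loewner_le_def quadratic_mat by blast
      then show ?thesis by (simp add: coeff_def flip: scaleR_matrix_vector_assoc)
    qed
    fix y
    show "\<bar>r x u - r y u\<bar> \<le> bound * norm (x - y) powr \<alpha>"
      using n(2)[of x y] mult_right_mono[OF bs(1), of "norm (x - y) powr \<alpha>"] by simp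
    have "norm (coeff x u - coeff y u) \<le> (2 * (sqrt DIM(real^'d) * C0) + 2 * (sqrt DIM(real^'d^'d) * C0)) * norm (x - y) powr \<alpha>"
      using n(4)[of x y] n(6)[of x y] pair[of x u y] by (simp only: distrib_right)
    also have "\<dots> \<le> bound * norm (x - y) powr \<alpha>" by (intro mult_right_mono bs(2)) simp
    finally show "norm (coeff x u - coeff y u) \<le> bound * norm (x - y) powr \<alpha>" .
  qed
qed

lemma gibbs_policy_eq: "gibbs_policy U lam r b \<sigma> w x u = gibbs (\<theta> x (grad w x, hess w x)) u"
  by (simp add: gibbs_policy_def gibbs_def partition_fun_def \<theta>_def hamiltonian_eq)

lemma F_policy_gibbs:
  "F_policy U lam r b \<sigma> (gibbs_policy U lam r b \<sigma> w x) x p X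
    = ereal (L x (grad w x, hess w x) + A x (grad w x, hess w x) \<bullet> ((p, X) - (grad w x, hess w x)))"
  unfolding F_policy_def gibbs_policy_eq hamiltonian_eq by (rule policy_integral)

text \<open>The supremum is attained at the Gibbs density of the same jet, where the Newton
  correction in \<open>policy_integral\<close> vanishes.\<close>

lemma F_max_eq: "F_max U lam r b \<sigma> x p X = ereal (L x (p, X))"
  unfolding F_max_def
proof (rule antisym)
  show "(SUP \<pi>\<in>prob_densities U. F_policy U lam r b \<sigma> \<pi> x p X) \<le> ereal (L x (p, X))"
    unfolding F_policy_def hamiltonian_eq
    by (rule SUP_least, rule policy_integral_le) (auto simp: prob_densities_def)
  let ?\<pi> = "gibbs (\<theta> x (p, X))"
  have "?\<pi> \<in> prob_densities U"
    using nn_integral_gibbs[of x "(p, X)"] bdd_meas_measurable[OF bdd_meas_gibbs[OF bdd_meas_\<theta>], of x "(p, X)"]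
      gibbs_pos[OF bdd_meas_\<theta>, of x "(p, X)"]
    by (auto simp: prob_densities_def intro: less_imp_le)
  moreover have "F_policy U lam r b \<sigma> ?\<pi> x p X = ereal (L x (p, X))"
    unfolding F_policy_def hamiltonian_eq policy_integral by simp
  ultimately show "ereal (L x (p, X)) \<le> (SUP \<pi>\<in>prob_densities U. F_policy U lam r b \<sigma> \<pi> x p X)"
    by (metis SUP_upper)
qed

text \<open>A viscosity solution of class C^2 is its own test function, from above and from below at
  every point. The old function \<open>w\<close> enters only through its jet at
  \<open>x\<close>.\<close>

lemma policy_iteration_step:
  assumes "viscosity_solution (\<lambda>x s p X. ereal (\<rho> * s)
      - F_policy U lam r b \<sigma> (gibbs_policy U lam r b \<sigma> w x) x p X) v"
    and "Ck_on 2 UNIV v"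
  shows "\<rho> * v x = L x (grad w x, hess w x)
    + A x (grad w x, hess w x) \<bullet> ((grad v x, hess v x) - (grad w x, hess w x))"
proof -
  have "ereal (\<rho> * v x) - F_policy U lam r b \<sigma> (gibbs_policy U lam r b \<sigma> w x) x (grad v x) (hess v x) \<le> 0"
    using assms unfolding viscosity_solution_def viscosity_subsolution_def by simp
  moreover have "ereal (\<rho> * v x) - F_policy U lam r b \<sigma> (gibbs_policy U lam r b \<sigma> w x) x (grad v x) (hess v x) \<ge> 0"
    using assms unfolding viscosity_solution_def viscosity_supersolution_def by simp
  ultimately show ?thesis unfolding F_policy_gibbs by simp
qed

lemma hjb_solution_eq:
  assumes vs: "viscosity_solution (\<lambda>x s p X. ereal (\<rho> * s) - F_max U lam r b \<sigma> x p X) vstar"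
    and bd: "\<And>x. \<bar>vstar x\<bar> \<le> B"
    and w: "C2_with w g G" "\<And>x. \<bar>w x\<bar> \<le> B" "\<And>x. \<rho> * w x = L x (g x, G x)"
  shows "vstar = w"
proof
  fix x
  show "vstar x = w x"
  proof (rule viscosity_solution_unique[OF _ bd _ _ w])
    show "continuous_on UNIV vstar" using vs by (simp add: viscosity_solution_def)
    fix \<phi> :: "real^'d \<Rightarrow> real" and g G x assume \<phi>: "C2_with \<phi> g G"
    note Ck = C2_with_imp_Ck_on[OF \<phi>] and gh = C2_with_grad_hess[OF \<phi>]
    show "\<rho> * vstar x \<le> L x (g x, G x)" if "\<And>y. vstar y - \<phi> y \<le> vstar x - \<phi> x"
    proof -
      have "ereal (\<rho> * vstar x) - F_max U lam r b \<sigma> x (grad \<phi> x) (hess \<phi> x) \<le> 0"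
        using vs Ck that unfolding viscosity_solution_def viscosity_subsolution_def by (simp add: always_eventually)
      then show ?thesis unfolding F_max_eq gh by simp
    qed
    show "L x (g x, G x) \<le> \<rho> * vstar x" if "\<And>y. vstar x - \<phi> x \<le> vstar y - \<phi> y"
    proof -
      have "ereal (\<rho> * vstar x) - F_max U lam r b \<sigma> x (grad \<phi> x) (hess \<phi> x) \<ge> 0"
        using vs Ck that unfolding viscosity_solution_def viscosity_supersolution_def by (simp add: always_eventually)
      then show ?thesis unfolding F_max_eq gh by simp
    qed
  qed
qed

end

theorem theorem3p1:
  fixes U :: "(real^'l::finite) set"
    and lam \<rho> \<alpha> C0 :: real
    and r :: "real^'d::finite \<Rightarrow> real^'l \<Rightarrow> real"
    and b :: "real^'d \<Rightarrow> real^'l \<Rightarrow> real^'d"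
    and \<sigma> :: "real^'d \<Rightarrow> real^'l \<Rightarrow> real^'m::finite^'d"
    and vstar :: "real^'d \<Rightarrow> real"
    and v :: "nat \<Rightarrow> real^'d \<Rightarrow> real"
  assumes "open U" "connected U" "bounded U" "measure lebesgue U = 1"
    and "lam > 0" "\<rho> > 0"
    and "\<And>x. r x \<in> borel_measurable (lebesgue_on U)"
    and "\<And>x. b x \<in> borel_measurable (lebesgue_on U)"
    and "\<And>x. \<sigma> x \<in> borel_measurable (lebesgue_on U)"
    and "0 < \<alpha>" "\<alpha> < 1" "C0 \<ge> 1"
    and "\<And>x u. u \<in> U \<Longrightarrow> loewner_le ((1 / C0) *\<^sub>R mat 1) (diffusion_matrix \<sigma> x u)"
    and "\<And>u. u \<in> U \<Longrightarrow> hoelder_norm 0 \<alpha> UNIV (\<lambda>x. r x u) \<le> ennreal C0"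
    and "\<And>u. u \<in> U \<Longrightarrow> hoelder_norm 0 \<alpha> UNIV (\<lambda>x. b x u) \<le> ennreal C0"
    and "\<And>u. u \<in> U \<Longrightarrow> hoelder_norm 0 \<alpha> UNIV (\<lambda>x. diffusion_matrix \<sigma> x u) \<le> ennreal C0"
    and "bounded (range vstar)"
    and "viscosity_solution (\<lambda>x s p X. ereal (\<rho> * s) - F_max U lam r b \<sigma> x p X) vstar"
    and "policy_iteration U lam \<rho> r b \<sigma> v"
    and "\<And>n. n \<ge> 1 \<Longrightarrow> bounded (range (v n))"
    and "\<exists>M::real. \<forall>n\<ge>1. v n \<in> hoelder_space 2 \<alpha> UNIV \<and> hoelder_norm 2 \<alpha> UNIV (v n) \<le> ennreal M"
  shows "\<forall>R>0. vstar \<in> hoelder_space 2 \<alpha> (ball 0 R) \<and>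
           ((\<lambda>n. hoelder_norm 2 \<alpha> (ball 0 R) (\<lambda>x. v n x - vstar x)) \<longlonglongrightarrow> 0)"
proof -
  interpret exploratory_hjb U lam \<rho> \<alpha> C0 r b \<sigma>
    by unfold_locales (use assms in auto)
  obtain M where M: "\<And>n. n \<ge> 1 \<Longrightarrow> v n \<in> hoelder_space 2 \<alpha> UNIV"
    "\<And>n. n \<ge> 1 \<Longrightarrow> hoelder_norm 2 \<alpha> UNIV (v n) \<le> ennreal M"
    using assms(21) by blast
  \<comment> \<open>\<open>ennreal\<close> sends a negative \<open>M\<close> to 0, whereas the
    pointwise bounds need a nonnegative real.\<close>
  define k where "k = max M 0"
  have k: "k \<ge> 0" and Mk: "hoelder_norm 2 \<alpha> UNIV (v (Suc n)) \<le> ennreal k" for n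
    using order_trans[OF M(2)[of "Suc n"] ennreal_leI[of M k]] by (simp_all add: k_def)
  define V where "V n = v (Suc n)" for n
  define B where "B = 2 * (real CARD('d) * real CARD('d) * k)"
  have Ck: "Ck_on 2 UNIV (V n)" for n
    using M(1)[of "Suc n"] by (simp add: V_def hoelder_space_def)
  note C2 = Ck_on_2_imp_C2_with[OF Ck]
  note bds = hoelder_norm_2_bounds[OF C2 Mk[folded V_def] k \<open>0 < \<alpha>\<close>, folded B_def]
  have step: "\<rho> * V n x = L x (grad (v n) x, hess (v n) x)
      + A x (grad (v n) x, hess (v n) x) \<bullet> ((grad (V n) x, hess (V n) x) - (grad (v n) x, hess (v n) x))" for n x
  proof (rule policy_iteration_step[OF _ Ck])
    show "viscosity_solution (\<lambda>x s p X. ereal (\<rho> * s)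
        - F_policy U lam r b \<sigma> (gibbs_policy U lam r b \<sigma> (v n) x) x p X) (V n)"
      using assms(19) by (auto simp: policy_iteration_def V_def dest: spec[of _ "Suc n"])
  qed
  interpret policy_sequence "lebesgue_on U" lam bound \<alpha> r coeff "1 / (2 * C0)" \<rho> V
    "\<lambda>n. grad (V n)" "\<lambda>n. hess (V n)" B
  proof
    \<comment> \<open>This covers \<open>V 0\<close> as well: it is the step from
      \<open>v 0\<close>, which serves merely as the point of tangency.\<close>
    show "\<rho> * V n x \<le> L x (grad (V n) x, hess (V n) x)" for n x
      unfolding step by (rule L_tangent)
    show "\<rho> * V (Suc n) x = L x (grad (V n) x, hess (V n) x) + A x (grad (V n) x, hess (V n) x) \<bullet>
        ((grad (V (Suc n)) x, hess (V (Suc n)) x) - (grad (V n) x, hess (V n) x))" for n x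
      using step[of "Suc n" x] by (simp only: V_def)
  qed (rule C2 bds)+
  obtain B' where B': "\<And>x. \<bar>vstar x\<bar> \<le> B'"
    using assms(17) by (auto simp: bounded_iff)
  have "vstar = w"
  proof (rule hjb_solution_eq[OF assms(18) _ w_C2 _ limit_equation])
    show "\<bar>vstar x\<bar> \<le> max B B'" "\<bar>w x\<bar> \<le> max B B'" for x
      using B'[of x] w_bound[of x] by auto
  qed
  then have "vstar \<in> hoelder_space 2 \<alpha> (ball 0 R)"
    and "(\<lambda>n. hoelder_norm 2 \<alpha> (ball 0 R) (\<lambda>x. V n x - vstar x)) \<longlonglongrightarrow> 0" for R
    using limit_in_hoelder_space hoelder_norm_tendsto by simp_all
  \<comment> \<open>\<open>LIMSEQ_imp_Suc\<close> undoes the index shift between \<open>V\<close>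
    and \<open>v\<close>.\<close>
  then show ?thesis unfolding V_def by (auto intro: LIMSEQ_imp_Suc)
qed

end
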